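(* Let $n\geq 2$. The isometry group of $\mathscr{W}_2(\mathbb{R}^n)$ is a semidirect product $$\mathrm{Isom}\,\mathscr{W}_2(\mathbb{R}^n)\;\cong\;\mathrm{Isom}(\mathbb{R}^n)\ltimes \mathrm{O}(n),$$ with $\mathrm{O}(n)$ the normal factor, where the action of an element $\psi\in\mathrm{Isom}(\mathbb{R}^n)$ on $\mathrm{O}(n)$ is conjugation by its linear part $\vec\psi$, i.e. $\varphi\mapsto\vec\psi\,\varphi\,\vec\psi^{-1}$. The left factor is the image of $\#:\mathrm{Isom}(\mathbb{R}^n)\to\mathrm{Isom}\,\mathscr{W}_2(\mathbb{R}^n)$, and each element of the right factor fixes all Dirac masses and preserves shapes.
   Context: $\mathbb{R}^n$ carries its Euclidean distance. For a Polish geodesic metric space $X$, $\mathscr{W}_2(X)$ is the set of Borel probability measures $\mu$ on $X$ with $\int_X d^2(x_0,x)\,\mu(dx)<\infty$ for some (hence every) $x_0\in X$, endowed with the quadratic Wasserstein distance $d_{\mathscr W}^2(\mu_0,\mu_1)=\inf_\Pi\int_{X\times X}d^2(x,y)\,\Pi(dx\,dy)$, the infimum being over all couplings $\Pi$ of $\mu_0,\mu_1$. $\mathrm{Isom}\,Y$ denotes the group of (bijective) isometries of a metric space $Y$. For $\varphi\in\mathrm{Isom}\,X$, $\#(\varphi)=\varphi_\#\in\mathrm{Isom}\,\mathscr{W}_2(X)$ is the push-forward map $\varphi_\#(\mu)(A)=\mu(\varphi^{-1}(A))$; the homomorphism $\#$ is injective. A self-map $\Phi$ of $\mathscr{W}_2(X)$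 preserves shapes if for every $\mu\in\mathscr{W}_2(X)$ there is an isometry $\varphi$ of $X$ (depending on $\mu$) such that $\Phi(\mu)=\varphi_\#(\mu)$. *)

theory Defs
  imports
    "HOL-Analysis.Analysis"
    "HOL-Probability.Probability"
    "HOL-Algebra.Coset"
    "HOL-Algebra.Bij"
begin

definition wasserstein_space :: "'a::polish_space measure set" where
  "wasserstein_space =
     {\<mu>. prob_space \<mu> \<and> sets \<mu> = sets borel \<and>
         (\<exists>x0. (\<integral>\<^sup>+ x. ennreal ((dist x0 x)\<^sup>2) \<partial>\<mu>) < \<infinity>)}"

definition couplings ::
    "'a::polish_space measure \<Rightarrow> 'a measure \<Rightarrow> ('a \<times> 'a) measure set" where
  "couplings \<mu> \<nu> =
     {\<gamma>. prob_space \<gamma> \<and> sets \<gamma> = sets borel \<and>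
         distr \<gamma> borel fst = \<mu> \<and> distr \<gamma> borel snd = \<nu>}"

text \<open>The infimum is taken in the extended nonnegative reals. It is finite on
  \<^const>\<open>wasserstein_space\<close> (use the product coupling), so \<^const>\<open>enn2real\<close> loses nothing there.\<close>

definition wasserstein_dist :: "'a::polish_space measure \<Rightarrow> 'a measure \<Rightarrow> real" where
  "wasserstein_dist \<mu> \<nu> =
     sqrt (enn2real (INF \<gamma>\<in>couplings \<mu> \<nu>. \<integral>\<^sup>+ (x, y). ennreal ((dist x y)\<^sup>2) \<partial>\<gamma>))"

text \<open>As in \<^const>\<open>BijGroup\<close>, a self-map of \<open>S\<close> is represented by a HOL function that is
  \<^const>\<open>undefined\<close> outside \<open>S\<close>, and the group law is composition on \<open>S\<close>.\<close>

definition isom_group :: "'a set \<Rightarrow> ('a \<Rightarrow> 'a \<Rightarrow> real) \<Rightarrow> ('a \<Rightarrow> 'a) monoid" where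
  "isom_group S d =
     BijGroup S \<lparr>carrier := {f \<in> Bij S. \<forall>x\<in>S. \<forall>y\<in>S. d (f x) (f y) = d x y}\<rparr>"

abbreviation Isom :: "('a::metric_space \<Rightarrow> 'a) monoid" where
  "Isom \<equiv> isom_group UNIV dist"

abbreviation IsomW2 :: "('a::polish_space measure \<Rightarrow> 'a measure) monoid" where
  "IsomW2 \<equiv> isom_group wasserstein_space wasserstein_dist"

definition push_forward ::
    "('a::polish_space \<Rightarrow> 'a) \<Rightarrow> 'a measure \<Rightarrow> 'a measure" where
  "push_forward \<phi> = (\<lambda>\<mu>\<in>wasserstein_space. distr \<mu> borel \<phi>)"

definition preserves_shapes :: "('a::polish_space measure \<Rightarrow> 'a measure) \<Rightarrow> bool" where
  "preserves_shapes \<Phi> \<longleftrightarrow>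
     (\<forall>\<mu>\<in>wasserstein_space. \<exists>\<phi>\<in>carrier Isom. \<Phi> \<mu> = push_forward \<phi> \<mu>)"

definition orthogonal_group :: "('a::euclidean_space \<Rightarrow> 'a) monoid" where
  "orthogonal_group = \<lparr>carrier = {f. orthogonal_transformation f}, mult = (\<circ>), one = id\<rparr>"

text \<open>For an affine map \<open>\<psi> x = L x + b\<close> this is \<open>L\<close>; isometries of a Euclidean space are affine.\<close>

definition linear_part :: "('a::real_vector \<Rightarrow> 'a) \<Rightarrow> 'a \<Rightarrow> 'a" where
  "linear_part \<psi> = (\<lambda>x. \<psi> x - \<psi> 0)"

text \<open>For a left action \<open>\<alpha>\<close> of \<open>H\<close> on \<open>N\<close> by automorphisms, with \<open>N\<close> the normal factor.
  The pair \<open>(h, n)\<close> stands for the product \<open>n h\<close>, so that \<open>h n h\<^sup>-\<^sup>1 = \<alpha> h n\<close>.\<close>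

definition semidirect_product ::
    "('h, 'x) monoid_scheme \<Rightarrow> ('n, 'y) monoid_scheme \<Rightarrow> ('h \<Rightarrow> 'n \<Rightarrow> 'n) \<Rightarrow> ('h \<times> 'n) monoid" where
  "semidirect_product H N \<alpha> =
     \<lparr>carrier = carrier H \<times> carrier N,
      mult = (\<lambda>(h, n) (h', n'). (h \<otimes>\<^bsub>H\<^esub> h', n \<otimes>\<^bsub>N\<^esub> \<alpha> h n')),
      one = (\<one>\<^bsub>H\<^esub>, \<one>\<^bsub>N\<^esub>)\<rparr>"

definition conj_by_linear_part ::
    "('a::euclidean_space \<Rightarrow> 'a) \<Rightarrow> ('a \<Rightarrow> 'a) \<Rightarrow> ('a \<Rightarrow> 'a)" where
  "conj_by_linear_part \<psi> \<phi> = linear_part \<psi> \<circ> \<phi> \<circ> inv_into UNIV (linear_part \<psi>)"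

lemma group_isom_group: "group (isom_group S d)"
proof -
  interpret B: group "BijGroup S" by (rule group_BijGroup)
  let ?C = "{f \<in> Bij S. \<forall>x\<in>S. \<forall>y\<in>S. d (f x) (f y) = d x y}"
  have "subgroup ?C (BijGroup S)"
  proof (rule B.subgroupI)
    show "?C \<subseteq> carrier (BijGroup S)" by (auto simp: BijGroup_def)
    show "?C \<noteq> {}" using id_Bij[of S] by force
  next
    fix f assume f: "f \<in> ?C"
    then have fB: "f \<in> Bij S" by simp
    have bij: "bij_betw f S S" using fB by (simp add: Bij_def)
    have "d (inv_into S f x) (inv_into S f y) = d x y" if "x \<in> S" "y \<in> S" for x y
    proof -
      have "inv_into S f x \<in> S" "inv_into S f y \<in> S" using Bij_inv_into_mem[OF fB] that by auto
      moreover have "f (inv_into S f x) = x" "f (inv_into S f y) = y"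
        using bij that by (auto simp: bij_betw_inv_into_right)
      ultimately show ?thesis using f by force
    qed
    then show "inv\<^bsub>BijGroup S\<^esub> f \<in> ?C"
      using restrict_inv_into_Bij[OF fB] by (simp add: inv_BijGroup[OF fB])
  next
    fix f g assume fg: "f \<in> ?C" "g \<in> ?C"
    then show "f \<otimes>\<^bsub>BijGroup S\<^esub> g \<in> ?C"
      using Bij_imp_funcset[of g S]
      by (auto simp: BijGroup_def compose_Bij compose_eq Pi_iff)
  qed
  then show ?thesis unfolding isom_group_def by (rule B.subgroup_imp_group)
qed

lemma group_orthogonal_group: "group orthogonal_group"
proof (rule groupI)
  fix f :: "'a \<Rightarrow> 'a" assume "f \<in> carrier orthogonal_group"
  then have f: "orthogonal_transformation f" by (simp add: orthogonal_group_def)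
  show "\<exists>g\<in>carrier orthogonal_group. g \<otimes>\<^bsub>orthogonal_group\<^esub> f = \<one>\<^bsub>orthogonal_group\<^esub>"
    using orthogonal_transformation_inv[OF f] orthogonal_transformation_inj[OF f]
    by (intro bexI[of _ "inv_into UNIV f"]) (auto simp: orthogonal_group_def)
qed (auto simp: orthogonal_group_def orthogonal_transformation_compose comp_assoc
       orthogonal_transformation_id[unfolded id_def[symmetric]])

end

theory Submission
  imports Defs
begin

text \<open>
  The kernel of the restriction of isometries to Dirac masses is what has to be found: an isometry
  maps Dirac masses to Dirac masses, since these are the measures from which every measure can be
  joined to one twice as far away in the same direction (\<open>reflecting_iff_return\<close>). So after composing
  with a push-forward an isometry \<open>T\<close> fixes all Dirac masses. Distances to Dirac masses know the
  barycenter and the second moment, so \<open>T\<close> preserves both, and with them the correlation of two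
  measures: the supremum over couplings of the mean of \<open>x \<bullet> y\<close>. The rest of the proof
  works with correlations of centered measures.

  Two centered measures have correlation zero exactly if their supports are orthogonal. The
  correlation therefore knows the inclusion order of the spans of supports, in particular which
  measures live on a common line through the origin (\<open>minimal_span_iff\<close>). On a line, a centered measure \<open>\<mu>\<close>
  of second moment one is carried by two points if and only if
  \<open>correlation \<mu> \<nu> * correlation \<mu> \<nu>' \<le> correlation \<nu> \<nu>'\<close> for all centered \<open>\<nu>\<close>, \<open>\<nu>'\<close> on the line
  (\<open>extremal_unit_iff\<close>). So \<open>T\<close> permutes the measures \<open>two_point u a\<close>, where the unit vector \<open>u\<close> gives
  the line and \<open>a > 0\<close> the position and weight of the two points on it. Their mutual correlations are explicit:
  \<open>(u \<bullet> v) * min (a / b) (b / a)\<close> when \<open>u \<bullet> v \<ge> 0\<close>. On a single line this would allow the shift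
  \<open>a \<mapsto> c * a\<close>, and indeed the real line has such exotic isometries. In dimension at least two
  lines can be compared: the best match of \<open>two_point u a\<close> on the line of \<open>v\<close> is \<open>two_point v a\<close> if
  \<open>u \<bullet> v > 0\<close>. Moving along best matches from \<open>u\<close> to \<open>- u\<close> realises the reflection
  \<open>a \<mapsto> 1 / a\<close>, with which the action of \<open>T\<close> must commute. This excludes the shifts, and
  \<open>T\<close> maps \<open>two_point u a\<close> to \<open>two_point (\<phi> u) a\<close> for an orthogonal map \<open>\<phi>\<close> (\<open>two_point_rigidity\<close>).

  Rotating each measure about its own barycenter by \<open>\<phi>\<close> is an isometry that fixes the Dirac masses
  and does the same to two-point measures. An isometry fixing all Dirac masses and all two-point
  measures is the identity (\<open>isometry_fixing_two_points_eq_id\<close>): the correlations with two-point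
  measures determine the one-dimensional projections of a measure, the projections determine it if
  its support is finite, and finitely supported measures are dense. Hence the isometries fixing
  Dirac masses are the rotations about the barycenter, and the group law is computed directly.

  Infima over couplings are handled by explicit couplings, namely images of one measure under two
  maps and reweighted products (\<open>correlation_ge_tilted\<close>), and by pointwise inequalities that hold
  for every coupling.
\<close>

section \<open>The Wasserstein distance as a correlation\<close>

definition second_moment :: "'a::euclidean_space measure \<Rightarrow> real" where
  "second_moment \<mu> = (\<integral>x. (norm x)\<^sup>2 \<partial>\<mu>)"

definition barycenter :: "'a::euclidean_space measure \<Rightarrow> 'a" where
  "barycenter \<mu> = (\<integral>x. x \<partial>\<mu>)"

text \<open>The supremum of the mean inner product over couplings, by \<open>coupling_le_correlation\<close> and
\<open>correlation_le\<close>. It is written through the distance so that a map preserving distances and second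
moments visibly preserves it.\<close>

definition correlation :: "'a::euclidean_space measure \<Rightarrow> 'a measure \<Rightarrow> real" where
  "correlation \<mu> \<nu> = (second_moment \<mu> + second_moment \<nu> - (wasserstein_dist \<mu> \<nu>)\<^sup>2) / 2"

lemma wasserstein_dist_squared:
  "(wasserstein_dist \<mu> \<nu>)\<^sup>2 = second_moment \<mu> + second_moment \<nu> - 2 * correlation \<mu> \<nu>"
  by (simp add: correlation_def field_simps)

lemma wasserstein_dist_nonneg: "wasserstein_dist \<mu> \<nu> \<ge> 0"
  by (simp add: wasserstein_dist_def)

lemma norm_le_1_plus_square: "norm x \<le> 1 + (norm x)\<^sup>2"
proof -
  have "(norm x - 1/2)\<^sup>2 \<ge> 0" by simp
  then show ?thesis by (simp add: power2_eq_square algebra_simps)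
qed

lemma (in prob_space) integrable_of_square_integrable:
  fixes X :: "'a \<Rightarrow> 'b::euclidean_space"
  assumes [measurable]: "X \<in> borel_measurable M" and "integrable M (\<lambda>\<omega>. (norm (X \<omega>))\<^sup>2)"
  shows "integrable M X"
  by (rule Bochner_Integration.integrable_bound[of _ "\<lambda>\<omega>. 1 + (norm (X \<omega>))\<^sup>2"])
     (use assms norm_le_1_plus_square in \<open>auto intro!: AE_I2\<close>)

lemma (in prob_space) integrable_inner_of_square_integrable:
  fixes X Y :: "'a \<Rightarrow> 'b::euclidean_space"
  assumes [measurable]: "X \<in> borel_measurable M" "Y \<in> borel_measurable M"
    and "integrable M (\<lambda>\<omega>. (norm (X \<omega>))\<^sup>2)" "integrable M (\<lambda>\<omega>. (norm (Y \<omega>))\<^sup>2)"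
  shows "integrable M (\<lambda>\<omega>. X \<omega> \<bullet> Y \<omega>)"
proof (rule Bochner_Integration.integrable_bound[of _ "\<lambda>\<omega>. (norm (X \<omega>))\<^sup>2 + (norm (Y \<omega>))\<^sup>2"])
  have "\<bar>x \<bullet> y\<bar> \<le> (norm x)\<^sup>2 + (norm y)\<^sup>2" for x y :: 'b
  proof -
    have "\<bar>x \<bullet> y\<bar> \<le> norm x * norm y" by (rule Cauchy_Schwarz_ineq2)
    also have "\<dots> \<le> (norm x)\<^sup>2 + (norm y)\<^sup>2"
      using sum_squares_bound[of "norm x" "norm y"] norm_ge_zero[of x] norm_ge_zero[of y]
        mult_nonneg_nonneg[of "norm x" "norm y"] by linarith
    finally show ?thesis .
  qed
  then show "AE \<omega> in M. norm (X \<omega> \<bullet> Y \<omega>) \<le> norm ((norm (X \<omega>))\<^sup>2 + (norm (Y \<omega>))\<^sup>2)"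
    by (auto intro!: AE_I2)
qed (use assms in auto)

lemma wasserstein_space_iff:
  fixes \<mu> :: "'a::euclidean_space measure"
  shows "\<mu> \<in> wasserstein_space \<longleftrightarrow>
    prob_space \<mu> \<and> sets \<mu> = sets borel \<and> integrable \<mu> (\<lambda>x. (norm x)\<^sup>2)"
proof safe
  assume "\<mu> \<in> wasserstein_space"
  then obtain x0 where "prob_space \<mu>" and s[measurable_cong]: "sets \<mu> = sets borel"
    and fin: "(\<integral>\<^sup>+ x. ennreal ((dist x0 x)\<^sup>2) \<partial>\<mu>) < \<infinity>"
    by (auto simp: wasserstein_space_def)
  then interpret prob_space \<mu> by simp
  show "prob_space \<mu>" "\<And>x. x \<in> sets \<mu> \<Longrightarrow> x \<in> sets borel" "\<And>x. x \<in> sets borel \<Longrightarrow> x \<in> sets \<mu>"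
    using s \<open>prob_space \<mu>\<close> by auto
  have i: "integrable \<mu> (\<lambda>x. (dist x0 x)\<^sup>2)"
    by (rule integrableI_nonneg) (use fin in auto)
  show "integrable \<mu> (\<lambda>x. (norm x)\<^sup>2)"
  proof (rule Bochner_Integration.integrable_bound[of _ "\<lambda>x. 2 * (norm x0)\<^sup>2 + 2 * (dist x0 x)\<^sup>2"])
    have "(norm x)\<^sup>2 \<le> 2 * (norm x0)\<^sup>2 + 2 * (dist x0 x)\<^sup>2" for x
    proof -
      have "(norm x)\<^sup>2 \<le> (norm x0 + dist x0 x)\<^sup>2"
        by (rule power_mono) (simp_all add: dist_norm norm_triangle_sub norm_minus_commute[of x0 x])
      also have "\<dots> \<le> 2 * (norm x0)\<^sup>2 + 2 * (dist x0 x)\<^sup>2"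
        using sum_squares_bound[of "norm x0" "dist x0 x"] by (simp add: power2_sum)
      finally show ?thesis .
    qed
    then show "AE x in \<mu>. norm ((norm x)\<^sup>2) \<le> norm (2 * (norm x0)\<^sup>2 + 2 * (dist x0 x)\<^sup>2)"
      by (auto intro!: AE_I2)
  qed (use i in auto)
next
  assume "prob_space \<mu>" and s: "sets \<mu> = sets borel" and i: "integrable \<mu> (\<lambda>x. (norm x)\<^sup>2)"
  have "(\<integral>\<^sup>+ x. ennreal ((dist 0 x)\<^sup>2) \<partial>\<mu>) = ennreal (\<integral>x. (norm x)\<^sup>2 \<partial>\<mu>)"
    by (subst nn_integral_eq_integral[symmetric]) (use i in auto)
  then have "(\<integral>\<^sup>+ x. ennreal ((dist 0 x)\<^sup>2) \<partial>\<mu>) < \<infinity>"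
    by (simp only: infinity_ennreal_def ennreal_less_top)
  with \<open>prob_space \<mu>\<close> s show "\<mu> \<in> wasserstein_space"
    unfolding wasserstein_space_def by blast
qed

lemma wasserstein_spaceD:
  fixes \<mu> :: "'a::euclidean_space measure"
  assumes "\<mu> \<in> wasserstein_space"
  shows "prob_space \<mu>" "sets \<mu> = sets borel" "space \<mu> = UNIV"
    "integrable \<mu> (\<lambda>x. (norm x)\<^sup>2)" "integrable \<mu> (\<lambda>x. x)" "integrable \<mu> (\<lambda>x. x \<bullet> a)"
    "integrable \<mu> (\<lambda>x. a \<bullet> x)" "integrable \<mu> (\<lambda>x. (x \<bullet> a)\<^sup>2)" "integrable \<mu> (\<lambda>x. (a \<bullet> x)\<^sup>2)"
proof -
  show *: "prob_space \<mu>" "sets \<mu> = sets borel" "integrable \<mu> (\<lambda>x. (norm x)\<^sup>2)"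
    using assms by (auto simp: wasserstein_space_iff)
  show sp: "space \<mu> = UNIV" using sets_eq_imp_space_eq[OF *(2)] by simp
  have [measurable_cong]: "sets \<mu> = sets borel" by fact
  interpret prob_space \<mu> by fact
  show i: "integrable \<mu> (\<lambda>x. x)"
    by (rule integrable_of_square_integrable) (use *(3) in auto)
  show "integrable \<mu> (\<lambda>x. x \<bullet> a)" "integrable \<mu> (\<lambda>x. a \<bullet> x)" using i by auto
  have "integrable \<mu> (\<lambda>x. (x \<bullet> a)\<^sup>2)"
  proof (rule Bochner_Integration.integrable_bound[of _ "\<lambda>x. (norm x)\<^sup>2 * (norm a)\<^sup>2"])
    have "\<bar>x \<bullet> a\<bar>\<^sup>2 \<le> (norm x * norm a)\<^sup>2" for x
      by (intro power_mono Cauchy_Schwarz_ineq2) auto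
    then show "AE x in \<mu>. norm ((x \<bullet> a)\<^sup>2) \<le> norm ((norm x)\<^sup>2 * (norm a)\<^sup>2)"
      by (auto intro!: AE_I2 simp: power_mult_distrib)
  qed (use *(3) in auto)
  then show "integrable \<mu> (\<lambda>x. (x \<bullet> a)\<^sup>2)" "integrable \<mu> (\<lambda>x. (a \<bullet> x)\<^sup>2)"
    by (simp_all add: inner_commute)
qed

lemma distr_in_wasserstein_space:
  fixes X :: "'b \<Rightarrow> 'a::euclidean_space"
  assumes "prob_space M" and [measurable]: "X \<in> borel_measurable M"
    and "integrable M (\<lambda>\<omega>. (norm (X \<omega>))\<^sup>2)"
  shows "distr M borel X \<in> wasserstein_space"
  using assms by (auto simp: wasserstein_space_iff integrable_distr_eq prob_space.prob_space_distr)

lemma couplingsD: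
  fixes \<mu> \<nu> :: "'a::polish_space measure"
  assumes "\<gamma> \<in> couplings \<mu> \<nu>"
  shows "prob_space \<gamma>" "sets \<gamma> = sets borel" "space \<gamma> = UNIV"
    "\<mu> = distr \<gamma> borel fst" "\<nu> = distr \<gamma> borel snd"
    "fst \<in> borel_measurable \<gamma>" "snd \<in> borel_measurable \<gamma>"
proof -
  show *: "prob_space \<gamma>" "sets \<gamma> = sets borel" "\<mu> = distr \<gamma> borel fst" "\<nu> = distr \<gamma> borel snd"
    using assms by (auto simp: couplings_def)
  show "space \<gamma> = UNIV" using sets_eq_imp_space_eq[OF *(2)] by simp
  have [measurable_cong]: "sets \<gamma> = sets ((borel :: 'a measure) \<Otimes>\<^sub>M (borel :: 'a measure))"
    unfolding borel_prod by (rule *(2))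
  show "fst \<in> borel_measurable \<gamma>" "snd \<in> borel_measurable \<gamma>"
    by measurable
qed

lemma coupling_law:
  fixes X Y :: "'b \<Rightarrow> 'a::euclidean_space"
  assumes "prob_space M" and [measurable]: "X \<in> borel_measurable M" "Y \<in> borel_measurable M"
  shows "distr M borel (\<lambda>\<omega>. (X \<omega>, Y \<omega>)) \<in> couplings (distr M borel X) (distr M borel Y)"
proof -
  have m[measurable]: "fst \<in> borel_measurable (borel :: ('a \<times> 'a) measure)"
      "snd \<in> borel_measurable (borel :: ('a \<times> 'a) measure)"
    by (simp_all add: borel_prod[symmetric])
  show ?thesis
    using assms(1) by (auto simp: couplings_def distr_distr comp_def intro!: prob_space.prob_space_distr)
qed

lemma coupling_AE_fst:
  assumes "\<gamma> \<in> couplings \<mu> \<nu>" "AE x in \<mu>. P x"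
  shows "AE z in \<gamma>. P (fst z)"
  using assms(2) unfolding couplingsD(4)[OF assms(1)]
  by (rule AE_distrD[rotated]) (rule couplingsD[OF assms(1)])

lemma coupling_AE_snd:
  assumes "\<gamma> \<in> couplings \<mu> \<nu>" "AE x in \<nu>. P x"
  shows "AE z in \<gamma>. P (snd z)"
  using assms(2) unfolding couplingsD(5)[OF assms(1)]
  by (rule AE_distrD[rotated]) (rule couplingsD[OF assms(1)])

lemma coupling_integral:
  fixes f :: "'a::euclidean_space \<Rightarrow> 'b::euclidean_space"
  assumes "\<gamma> \<in> couplings \<mu> \<nu>" and [measurable]: "f \<in> borel_measurable borel"
  shows "integrable \<gamma> (\<lambda>z. f (fst z)) = integrable \<mu> f" "(\<integral>z. f (fst z) \<partial>\<gamma>) = (\<integral>x. f x \<partial>\<mu>)"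
    "integrable \<gamma> (\<lambda>z. f (snd z)) = integrable \<nu> f" "(\<integral>z. f (snd z) \<partial>\<gamma>) = (\<integral>x. f x \<partial>\<nu>)"
  using couplingsD[OF assms(1)] by (auto simp: integrable_distr_eq integral_distr)

lemma coupling_integrable_inner:
  fixes \<mu> \<nu> :: "'a::euclidean_space measure"
  assumes "\<mu> \<in> wasserstein_space" "\<nu> \<in> wasserstein_space" and g: "\<gamma> \<in> couplings \<mu> \<nu>"
  shows "integrable \<gamma> (\<lambda>z. fst z \<bullet> snd z)"
proof -
  interpret prob_space \<gamma> using couplingsD[OF g] by simp
  show ?thesis
    by (rule integrable_inner_of_square_integrable)
       (use assms couplingsD[OF g] coupling_integral(1,3)[OF g, of "\<lambda>x. (norm x)\<^sup>2"]
         in \<open>auto simp: wasserstein_space_iff\<close>)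
qed

lemma coupling_cost:
  fixes \<mu> \<nu> :: "'a::euclidean_space measure"
  assumes "\<mu> \<in> wasserstein_space" "\<nu> \<in> wasserstein_space" and g: "\<gamma> \<in> couplings \<mu> \<nu>"
  shows "(\<integral>\<^sup>+ (x, y). ennreal ((dist x y)\<^sup>2) \<partial>\<gamma>) =
      ennreal (second_moment \<mu> + second_moment \<nu> - 2 * (\<integral>z. fst z \<bullet> snd z \<partial>\<gamma>))"
    "second_moment \<mu> + second_moment \<nu> - 2 * (\<integral>z. fst z \<bullet> snd z \<partial>\<gamma>) \<ge> 0"
    "integrable \<gamma> (\<lambda>z. (dist (fst z) (snd z))\<^sup>2)"
    "(\<integral>z. (dist (fst z) (snd z))\<^sup>2 \<partial>\<gamma>) =
      second_moment \<mu> + second_moment \<nu> - 2 * (\<integral>z. fst z \<bullet> snd z \<partial>\<gamma>)"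
proof -
  have *: "(dist x y)\<^sup>2 = (norm x)\<^sup>2 + (norm y)\<^sup>2 - 2 * (x \<bullet> y)" for x y :: 'a
    by (simp add: dist_norm power2_norm_eq_inner inner_diff_left inner_diff_right inner_commute)
  note ii = coupling_integral[OF g, of "\<lambda>x. (norm x)\<^sup>2", simplified]
  have i: "integrable \<gamma> (\<lambda>z. (norm (fst z))\<^sup>2)" "integrable \<gamma> (\<lambda>z. (norm (snd z))\<^sup>2)"
    using assms ii by (auto simp: wasserstein_space_iff)
  note ip = coupling_integrable_inner[OF assms]
  show int: "integrable \<gamma> (\<lambda>z. (dist (fst z) (snd z))\<^sup>2)"
    unfolding * by (intro Bochner_Integration.integrable_diff Bochner_Integration.integrable_add
        integrable_mult_right i ip)
  show e: "(\<integral>z. (dist (fst z) (snd z))\<^sup>2 \<partial>\<gamma>) =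
      second_moment \<mu> + second_moment \<nu> - 2 * (\<integral>z. fst z \<bullet> snd z \<partial>\<gamma>)"
    unfolding * using i ip ii by (simp add: second_moment_def)
  have "(\<integral>z. (dist (fst z) (snd z))\<^sup>2 \<partial>\<gamma>) \<ge> 0" by simp
  then show "second_moment \<mu> + second_moment \<nu> - 2 * (\<integral>z. fst z \<bullet> snd z \<partial>\<gamma>) \<ge> 0"
    unfolding e .
  show "(\<integral>\<^sup>+ (x, y). ennreal ((dist x y)\<^sup>2) \<partial>\<gamma>) =
      ennreal (second_moment \<mu> + second_moment \<nu> - 2 * (\<integral>z. fst z \<bullet> snd z \<partial>\<gamma>))"
    using nn_integral_eq_integral[OF int] unfolding e by (simp add: split_beta')
qed

lemma product_coupling:
  fixes \<mu> \<nu> :: "'a::euclidean_space measure"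
  assumes "\<mu> \<in> wasserstein_space" "\<nu> \<in> wasserstein_space"
  shows "\<mu> \<Otimes>\<^sub>M \<nu> \<in> couplings \<mu> \<nu>"
proof -
  interpret m: prob_space \<mu> using assms by (simp add: wasserstein_spaceD)
  interpret n: prob_space \<nu> using assms by (simp add: wasserstein_spaceD)
  interpret pair_prob_space \<mu> \<nu> ..
  have s: "sets \<mu> = sets borel" "sets \<nu> = sets borel" using assms by (simp_all add: wasserstein_spaceD)
  have f: "distr (\<mu> \<Otimes>\<^sub>M \<nu>) \<mu> fst = \<mu>" by (rule n.distr_pair_fst)
  have f': "distr (\<mu> \<Otimes>\<^sub>M \<nu>) borel fst = distr (\<mu> \<Otimes>\<^sub>M \<nu>) \<mu> fst"
    by (rule distr_cong) (use s in auto)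
  have g': "distr (\<mu> \<Otimes>\<^sub>M \<nu>) borel snd = distr (\<mu> \<Otimes>\<^sub>M \<nu>) \<nu> snd"
    by (rule distr_cong) (use s in auto)
  have g: "distr (\<mu> \<Otimes>\<^sub>M \<nu>) \<nu> snd = \<nu>"
  proof (rule measure_eqI)
    fix A assume "A \<in> sets (distr (\<mu> \<Otimes>\<^sub>M \<nu>) \<nu> snd)"
    then have A: "A \<in> sets \<nu>" by simp
    have "snd -` A \<inter> space (\<mu> \<Otimes>\<^sub>M \<nu>) = space \<mu> \<times> A"
      using sets.sets_into_space[OF A] by (auto simp: space_pair_measure)
    then show "emeasure (distr (\<mu> \<Otimes>\<^sub>M \<nu>) \<nu> snd) A = emeasure \<nu> A"
      using A by (simp add: emeasure_distr n.emeasure_pair_measure_Times m.emeasure_space_1)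
  qed simp
  have "sets (\<mu> \<Otimes>\<^sub>M \<nu>) = sets (borel :: ('a \<times> 'a) measure)"
    by (subst borel_prod[symmetric]) (rule sets_pair_measure_cong[OF s])
  then show ?thesis
    using f f' g g' prob_space_axioms by (simp add: couplings_def)
qed

lemma wasserstein_dist_squared_INF:
  "(wasserstein_dist \<mu> \<nu>)\<^sup>2 =
     enn2real (INF \<gamma>\<in>couplings \<mu> \<nu>. \<integral>\<^sup>+ (x, y). ennreal ((dist x y)\<^sup>2) \<partial>\<gamma>)"
  by (simp add: wasserstein_dist_def)

lemma coupling_le_correlation:
  fixes \<mu> \<nu> :: "'a::euclidean_space measure"
  assumes "\<mu> \<in> wasserstein_space" "\<nu> \<in> wasserstein_space" and g: "\<gamma> \<in> couplings \<mu> \<nu>"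
  shows "(\<integral>z. fst z \<bullet> snd z \<partial>\<gamma>) \<le> correlation \<mu> \<nu>"
proof -
  have "(INF \<gamma>\<in>couplings \<mu> \<nu>. \<integral>\<^sup>+ (x, y). ennreal ((dist x y)\<^sup>2) \<partial>\<gamma>)
      \<le> ennreal (second_moment \<mu> + second_moment \<nu> - 2 * (\<integral>z. fst z \<bullet> snd z \<partial>\<gamma>))"
    unfolding coupling_cost(1)[OF assms, symmetric] by (rule INF_lower[OF g])
  then have "(wasserstein_dist \<mu> \<nu>)\<^sup>2 \<le>
      second_moment \<mu> + second_moment \<nu> - 2 * (\<integral>z. fst z \<bullet> snd z \<partial>\<gamma>)"
    unfolding wasserstein_dist_squared_INF
    by (rule enn2real_leI[OF coupling_cost(2)[OF assms]])
  then show ?thesis by (simp add: wasserstein_dist_squared)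
qed

text \<open>The form in which upper bounds are proved: an estimate valid for every coupling, as a rule the
integral of a pointwise inequality whose right-hand side depends on the marginals only.\<close>

lemma correlation_le:
  fixes \<mu> \<nu> :: "'a::euclidean_space measure"
  assumes W: "\<mu> \<in> wasserstein_space" "\<nu> \<in> wasserstein_space"
    and B: "\<And>\<gamma>. \<gamma> \<in> couplings \<mu> \<nu> \<Longrightarrow> (\<integral>z. fst z \<bullet> snd z \<partial>\<gamma>) \<le> B"
  shows "correlation \<mu> \<nu> \<le> B"
proof -
  let ?c = "INF \<gamma>\<in>couplings \<mu> \<nu>. \<integral>\<^sup>+ (x, y). ennreal ((dist x y)\<^sup>2) \<partial>\<gamma>"
  let ?r = "second_moment \<mu> + second_moment \<nu> - 2 * B"
  have "?c \<le> ennreal (second_moment \<mu> + second_moment \<nu> - 2 * (\<integral>z. fst z \<bullet> snd z \<partial>(\<mu> \<Otimes>\<^sub>M \<nu>)))"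
    unfolding coupling_cost(1)[OF W product_coupling[OF W], symmetric]
    by (rule INF_lower[OF product_coupling[OF W]])
  then have fin: "?c < \<infinity>" by (rule order_le_less_trans) (simp add: less_top[symmetric])
  have "ennreal ?r \<le> ?c"
  proof (rule INF_greatest)
    fix \<gamma> assume g: "\<gamma> \<in> couplings \<mu> \<nu>"
    show "ennreal ?r \<le> (\<integral>\<^sup>+ (x, y). ennreal ((dist x y)\<^sup>2) \<partial>\<gamma>)"
      unfolding coupling_cost(1)[OF W g] using B[OF g] by (intro ennreal_leI) simp
  qed
  then have "?r \<le> enn2real ?c"
  proof (cases "?r \<ge> 0")
    case True
    then show ?thesis using enn2real_mono[OF \<open>ennreal ?r \<le> ?c\<close> fin[unfolded infinity_ennreal_def]] by simp
  next
    case False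
    then show ?thesis using enn2real_nonneg[of ?c] by linarith
  qed
  then have "?r \<le> (wasserstein_dist \<mu> \<nu>)\<^sup>2" by (simp add: wasserstein_dist_squared_INF)
  then show ?thesis by (simp add: wasserstein_dist_squared)
qed

lemma correlation_ge:
  fixes X Y :: "'b \<Rightarrow> 'a::euclidean_space"
  assumes M: "prob_space M" and [measurable]: "X \<in> borel_measurable M" "Y \<in> borel_measurable M"
    and "integrable M (\<lambda>\<omega>. (norm (X \<omega>))\<^sup>2)" "integrable M (\<lambda>\<omega>. (norm (Y \<omega>))\<^sup>2)"
  shows "(\<integral>\<omega>. X \<omega> \<bullet> Y \<omega> \<partial>M) \<le> correlation (distr M borel X) (distr M borel Y)"
proof -
  have m[measurable]: "(\<lambda>z::'a\<times>'a. fst z \<bullet> snd z) \<in> borel_measurable borel"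
    by (simp add: borel_prod[symmetric])
  have "(\<integral>\<omega>. X \<omega> \<bullet> Y \<omega> \<partial>M) = (\<integral>z. fst z \<bullet> snd z \<partial>(distr M borel (\<lambda>\<omega>. (X \<omega>, Y \<omega>))))"
    by (subst integral_distr) auto
  also have "\<dots> \<le> correlation (distr M borel X) (distr M borel Y)"
    by (rule coupling_le_correlation) (use assms in \<open>auto intro!: distr_in_wasserstein_space coupling_law\<close>)
  finally show ?thesis .
qed

lemma correlation_commute:
  fixes \<mu> \<nu> :: "'a::euclidean_space measure"
  assumes "\<mu> \<in> wasserstein_space" "\<nu> \<in> wasserstein_space"
  shows "correlation \<mu> \<nu> = correlation \<nu> \<mu>"
proof -
  have *: "correlation \<mu> \<nu> \<le> correlation \<nu> \<mu>"
    if W: "\<mu> \<in> wasserstein_space" "\<nu> \<in> wasserstein_space" for \<mu> \<nu> :: "'a measure"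
  proof (rule correlation_le[OF W])
    fix \<gamma> assume g: "\<gamma> \<in> couplings \<mu> \<nu>"
    note c = couplingsD[OF g]
    have "(\<integral>z. snd z \<bullet> fst z \<partial>\<gamma>) \<le> correlation (distr \<gamma> borel snd) (distr \<gamma> borel fst)"
      using c W coupling_integral(1,3)[OF g, of "\<lambda>x. (norm x)\<^sup>2"]
      by (intro correlation_ge) (auto simp: wasserstein_space_iff)
    then show "(\<integral>z. fst z \<bullet> snd z \<partial>\<gamma>) \<le> correlation \<nu> \<mu>"
      using c by (simp add: inner_commute)
  qed
  show ?thesis using *[OF assms] *[OF assms(2,1)] by simp
qed

section \<open>Tilted product couplings\<close>

lemma (in pair_prob_space) product_integral:
  fixes f :: "'a \<Rightarrow> real" and g :: "'b \<Rightarrow> real"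
  assumes f: "integrable M1 f" and g: "integrable M2 g"
  shows "integrable (M1 \<Otimes>\<^sub>M M2) (\<lambda>z. f (fst z) * g (snd z))"
    "(\<integral>z. f (fst z) * g (snd z) \<partial>(M1 \<Otimes>\<^sub>M M2)) = (\<integral>x. f x \<partial>M1) * (\<integral>y. g y \<partial>M2)"
proof -
  have [measurable]: "f \<in> borel_measurable M1" "g \<in> borel_measurable M2" using f g by auto
  show i: "integrable (M1 \<Otimes>\<^sub>M M2) (\<lambda>z. f (fst z) * g (snd z))"
  proof (rule Fubini_integrable)
    show "integrable M1 (\<lambda>x. \<integral>y. norm (f (fst (x, y)) * g (snd (x, y))) \<partial>M2)"
      using f by (simp add: abs_mult)
  qed (use g in auto)
  show "(\<integral>z. f (fst z) * g (snd z) \<partial>(M1 \<Otimes>\<^sub>M M2)) = (\<integral>x. f x \<partial>M1) * (\<integral>y. g y \<partial>M2)"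
    using integral_fst'[OF i] by simp
qed

text \<open>Weighting the product \<open>M1 \<Otimes>\<^sub>M M2\<close> by \<open>1 + h1 \<omega> * h2 \<omega>'\<close> changes neither marginal, because \<open>h1\<close> and
\<open>h2\<close> have mean zero, but adds a term to the mean inner product of \<open>X\<close> and \<open>Y\<close>. Three choices are
used below: zero weights give the product coupling, small bounded weights detect orthogonality, and
weights linear in one coordinate of a two-point measure glue two couplings along that measure.\<close>

lemma correlation_ge_tilted:
  fixes X :: "'b \<Rightarrow> 'a::euclidean_space" and Y :: "'c \<Rightarrow> 'a"
  assumes M1: "prob_space M1" and M2: "prob_space M2"
    and [measurable]: "X \<in> borel_measurable M1" "Y \<in> borel_measurable M2"
    and X2: "integrable M1 (\<lambda>\<omega>. (norm (X \<omega>))\<^sup>2)" and Y2: "integrable M2 (\<lambda>\<omega>. (norm (Y \<omega>))\<^sup>2)"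
    and h1: "integrable M1 h1" "(\<integral>\<omega>. h1 \<omega> \<partial>M1) = (0::real)"
    and h2: "integrable M2 h2" "(\<integral>\<omega>. h2 \<omega> \<partial>M2) = (0::real)"
    and hX: "integrable M1 (\<lambda>\<omega>. h1 \<omega> *\<^sub>R X \<omega>)" and hY: "integrable M2 (\<lambda>\<omega>. h2 \<omega> *\<^sub>R Y \<omega>)"
    and pos: "AE \<omega> in M1. AE \<omega>' in M2. 0 \<le> 1 + h1 \<omega> * h2 \<omega>'"
  shows "(\<integral>\<omega>. X \<omega> \<partial>M1) \<bullet> (\<integral>\<omega>. Y \<omega> \<partial>M2) + (\<integral>\<omega>. h1 \<omega> *\<^sub>R X \<omega> \<partial>M1) \<bullet> (\<integral>\<omega>. h2 \<omega> *\<^sub>R Y \<omega> \<partial>M2)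
    \<le> correlation (distr M1 borel X) (distr M2 borel Y)"
proof -
  interpret m1: prob_space M1 by fact
  interpret m2: prob_space M2 by fact
  interpret pair_prob_space M1 M2 ..
  have [measurable]: "h1 \<in> borel_measurable M1" "h2 \<in> borel_measurable M2" using h1 h2 by auto
  let ?P = "M1 \<Otimes>\<^sub>M M2"
  define w where "w z = 1 + h1 (fst z) * h2 (snd z)" for z
  have [measurable]: "w \<in> borel_measurable ?P" unfolding w_def by measurable
  have w0: "AE z in ?P. 0 \<le> w z"
    using pos by (intro AE_pair_measure) (auto simp: w_def)
  define Q where "Q = density ?P (\<lambda>z. ennreal (w z))"
  have sQ[measurable_cong]: "sets Q = sets ?P" and spQ: "space Q = space ?P" by (auto simp: Q_def)
  have prod: "integrable ?P (\<lambda>z. w z * (f (fst z) * g (snd z)))"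
      "(\<integral>z. w z * (f (fst z) * g (snd z)) \<partial>?P) =
        (\<integral>x. f x \<partial>M1) * (\<integral>y. g y \<partial>M2) + (\<integral>x. h1 x * f x \<partial>M1) * (\<integral>y. h2 y * g y \<partial>M2)"
    if "integrable M1 f" "integrable M2 g" "integrable M1 (\<lambda>x. h1 x * f x)" "integrable M2 (\<lambda>x. h2 x * g x)"
    for f :: "'b \<Rightarrow> real" and g :: "'c \<Rightarrow> real"
  proof -
    have *: "w z * (f (fst z) * g (snd z)) =
        f (fst z) * g (snd z) + (h1 (fst z) * f (fst z)) * (h2 (snd z) * g (snd z))" for z
      by (simp add: w_def algebra_simps)
    note i = product_integral[OF that(1,2)] product_integral[OF that(3,4)]
    show "integrable ?P (\<lambda>z. w z * (f (fst z) * g (snd z)))"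
      unfolding * using i by (intro Bochner_Integration.integrable_add)
    show "(\<integral>z. w z * (f (fst z) * g (snd z)) \<partial>?P) =
        (\<integral>x. f x \<partial>M1) * (\<integral>y. g y \<partial>M2) + (\<integral>x. h1 x * f x \<partial>M1) * (\<integral>y. h2 y * g y \<partial>M2)"
      unfolding * using i by (subst Bochner_Integration.integral_add) auto
  qed
  have emQ: "emeasure Q C = ennreal (\<integral>z. w z * indicator C z \<partial>?P)"
    if "C \<in> sets ?P" "integrable ?P (\<lambda>z. w z * indicator C z)" for C
  proof -
    have "emeasure Q C = (\<integral>\<^sup>+z. ennreal (w z) * indicator C z \<partial>?P)"
      unfolding Q_def using that by (subst emeasure_density) auto
    also have "\<dots> = (\<integral>\<^sup>+z. ennreal (w z * indicator C z) \<partial>?P)"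
      by (intro nn_integral_cong) (auto split: split_indicator)
    also have "\<dots> = ennreal (\<integral>z. w z * indicator C z \<partial>?P)"
      using w0 by (intro nn_integral_eq_integral that) (auto elim!: eventually_mono split: split_indicator)
    finally show ?thesis .
  qed
  have Q1: "emeasure Q (fst -` A \<inter> space Q) = emeasure M1 A" if A[measurable]: "A \<in> sets M1" for A
  proof -
    have ind: "w z * indicator (fst -` A \<inter> space Q) z = w z * (indicator A (fst z) * 1)" if "z \<in> space ?P" for z
      using that by (auto simp: spQ split: split_indicator)
    have iA: "integrable M1 (\<lambda>x. indicator A x :: real)" by (simp add: m1.emeasure_eq_measure)
    have ihA: "integrable M1 (\<lambda>x. h1 x * indicator A x)"
      using integrable_mult_indicator[OF A h1(1)] by (simp add: mult.commute)
    note p = prod[OF iA, of "\<lambda>_. 1", simplified, OF ihA h2(1)]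
    have i: "integrable ?P (\<lambda>z. w z * indicator (fst -` A \<inter> space Q) z)"
      using p(1) by (subst Bochner_Integration.integrable_cong[OF refl ind]) auto
    have "fst -` A \<inter> space Q \<in> sets ?P" unfolding spQ by measurable
    then have "emeasure Q (fst -` A \<inter> space Q) = ennreal (\<integral>z. w z * (indicator A (fst z) * 1) \<partial>?P)"
      using i by (subst emQ) (auto intro!: arg_cong[where f=ennreal] Bochner_Integration.integral_cong simp: ind)
    also have "\<dots> = emeasure M1 A" using p(2) h2(2) sets.sets_into_space[OF A]
      by (simp add: m1.emeasure_eq_measure Int_absorb2 m2.prob_space)
    finally show ?thesis .
  qed
  have Q2: "emeasure Q (snd -` A \<inter> space Q) = emeasure M2 A" if A[measurable]: "A \<in> sets M2" for A
  proof -
    have ind: "w z * indicator (snd -` A \<inter> space Q) z = w z * (1 * indicator A (snd z))" if "z \<in> space ?P" for z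
      using that by (auto simp: spQ split: split_indicator)
    have iA: "integrable M2 (\<lambda>x. indicator A x :: real)" by (simp add: m2.emeasure_eq_measure)
    have ihA: "integrable M2 (\<lambda>x. h2 x * indicator A x)"
      using integrable_mult_indicator[OF A h2(1)] by (simp add: mult.commute)
    note p = prod[OF _ iA, of "\<lambda>_. 1", simplified, OF h1(1) ihA]
    have i: "integrable ?P (\<lambda>z. w z * indicator (snd -` A \<inter> space Q) z)"
      using p(1) by (subst Bochner_Integration.integrable_cong[OF refl ind]) auto
    have "snd -` A \<inter> space Q \<in> sets ?P" unfolding spQ by measurable
    then have "emeasure Q (snd -` A \<inter> space Q) = ennreal (\<integral>z. w z * (1 * indicator A (snd z)) \<partial>?P)"
      using i by (subst emQ) (auto intro!: arg_cong[where f=ennreal] Bochner_Integration.integral_cong simp: ind)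
    also have "\<dots> = emeasure M2 A" using p(2) h1(2) sets.sets_into_space[OF A]
      by (simp add: m2.emeasure_eq_measure Int_absorb2 m1.prob_space)
    finally show ?thesis .
  qed
  have "prob_space Q"
  proof
    have "fst -` space M1 \<inter> space Q = space Q" by (auto simp: spQ space_pair_measure)
    then show "emeasure Q (space Q) = 1" using Q1[OF sets.top] m1.emeasure_space_1 by simp
  qed
  then interpret Q: prob_space Q .
  have dX: "distr Q borel (\<lambda>z. X (fst z)) = distr M1 borel X"
  proof (rule measure_eqI)
    fix B :: "'a set" assume "B \<in> sets (distr Q borel (\<lambda>z. X (fst z)))"
    then have [measurable]: "B \<in> sets borel" by simp
    have "(\<lambda>z. X (fst z)) -` B \<inter> space Q = fst -` (X -` B \<inter> space M1) \<inter> space Q"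
      by (auto simp: spQ space_pair_measure)
    moreover have "emeasure Q (fst -` (X -` B \<inter> space M1) \<inter> space Q) = emeasure M1 (X -` B \<inter> space M1)"
      by (rule Q1) measurable
    ultimately show "emeasure (distr Q borel (\<lambda>z. X (fst z))) B = emeasure (distr M1 borel X) B"
      by (subst (1 2) emeasure_distr) (simp_all del: vimage_Int)
  qed simp
  have dY: "distr Q borel (\<lambda>z. Y (snd z)) = distr M2 borel Y"
  proof (rule measure_eqI)
    fix B :: "'a set" assume "B \<in> sets (distr Q borel (\<lambda>z. Y (snd z)))"
    then have [measurable]: "B \<in> sets borel" by simp
    have "(\<lambda>z. Y (snd z)) -` B \<inter> space Q = snd -` (Y -` B \<inter> space M2) \<inter> space Q"
      by (auto simp: spQ space_pair_measure)
    moreover have "emeasure Q (snd -` (Y -` B \<inter> space M2) \<inter> space Q) = emeasure M2 (Y -` B \<inter> space M2)"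
      by (rule Q2) measurable
    ultimately show "emeasure (distr Q borel (\<lambda>z. Y (snd z))) B = emeasure (distr M2 borel Y) B"
      by (subst (1 2) emeasure_distr) (simp_all del: vimage_Int)
  qed simp
  have "integrable (distr Q borel (\<lambda>z. X (fst z))) (\<lambda>x. (norm x)\<^sup>2)"
    unfolding dX using X2 by (simp add: integrable_distr_eq)
  then have QX2: "integrable Q (\<lambda>z. (norm (X (fst z)))\<^sup>2)" by (simp add: integrable_distr_eq)
  have "integrable (distr Q borel (\<lambda>z. Y (snd z))) (\<lambda>x. (norm x)\<^sup>2)"
    unfolding dY using Y2 by (simp add: integrable_distr_eq)
  then have QY2: "integrable Q (\<lambda>z. (norm (Y (snd z)))\<^sup>2)" by (simp add: integrable_distr_eq)
  have X1: "integrable M1 X" using m1.integrable_of_square_integrable[OF _ X2] by simp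
  have Y1: "integrable M2 Y" using m2.integrable_of_square_integrable[OF _ Y2] by simp
  have iX: "integrable M1 (\<lambda>x. X x \<bullet> b)" "integrable M1 (\<lambda>x. h1 x * (X x \<bullet> b))" for b
    using X1 integrable_inner_left[OF hX, of b] by auto
  have iY: "integrable M2 (\<lambda>x. Y x \<bullet> b)" "integrable M2 (\<lambda>x. h2 x * (Y x \<bullet> b))" for b
    using Y1 integrable_inner_left[OF hY, of b] by auto
  have "(\<integral>z. X (fst z) \<bullet> Y (snd z) \<partial>Q) = (\<integral>z. w z * (X (fst z) \<bullet> Y (snd z)) \<partial>?P)"
    unfolding Q_def using w0 by (subst integral_density) auto
  also have "\<dots> = (\<integral>z. (\<Sum>b\<in>Basis. w z * ((X (fst z) \<bullet> b) * (Y (snd z) \<bullet> b))) \<partial>?P)"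
    by (subst euclidean_inner) (simp add: sum_distrib_left)
  also have "\<dots> = (\<Sum>b\<in>Basis. \<integral>z. w z * ((X (fst z) \<bullet> b) * (Y (snd z) \<bullet> b)) \<partial>?P)"
    by (rule Bochner_Integration.integral_sum, rule prod(1)) (simp_all only: iX iY)
  also have "\<dots> = (\<Sum>b\<in>Basis. (\<integral>x. X x \<bullet> b \<partial>M1) * (\<integral>x. Y x \<bullet> b \<partial>M2)
      + (\<integral>x. h1 x * (X x \<bullet> b) \<partial>M1) * (\<integral>x. h2 x * (Y x \<bullet> b) \<partial>M2))"
    by (intro sum.cong refl prod(2) iX iY)
  also have "\<dots> = (\<Sum>b\<in>Basis. ((\<integral>x. X x \<partial>M1) \<bullet> b) * ((\<integral>x. Y x \<partial>M2) \<bullet> b)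
      + ((\<integral>x. h1 x *\<^sub>R X x \<partial>M1) \<bullet> b) * ((\<integral>x. h2 x *\<^sub>R Y x \<partial>M2) \<bullet> b))"
    using X1 Y1 integral_inner_left[of _ M1 "\<lambda>x. h1 x *\<^sub>R X x"] integral_inner_left[of _ M2 "\<lambda>x. h2 x *\<^sub>R Y x"] hX hY
    by simp
  also have "\<dots> = (\<integral>\<omega>. X \<omega> \<partial>M1) \<bullet> (\<integral>\<omega>. Y \<omega> \<partial>M2) + (\<integral>\<omega>. h1 \<omega> *\<^sub>R X \<omega> \<partial>M1) \<bullet> (\<integral>\<omega>. h2 \<omega> *\<^sub>R Y \<omega> \<partial>M2)"
    by (simp only: sum.distrib euclidean_inner[symmetric])
  finally have e: "(\<integral>z. X (fst z) \<bullet> Y (snd z) \<partial>Q) = \<dots>" .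
  have "(\<integral>z. X (fst z) \<bullet> Y (snd z) \<partial>Q)
      \<le> correlation (distr Q borel (\<lambda>z. X (fst z))) (distr Q borel (\<lambda>z. Y (snd z)))"
    by (rule correlation_ge) (use \<open>prob_space Q\<close> QX2 QY2 in auto)
  then show ?thesis unfolding e dX dY .
qed

lemma distr_borel_id: "sets \<mu> = sets borel \<Longrightarrow> distr \<mu> borel (\<lambda>x. x) = \<mu>"
  using distr_id2[of borel \<mu>] by (simp add: id_def)

lemma barycenter_inner:
  assumes "\<mu> \<in> wasserstein_space"
  shows "(\<integral>x. x \<bullet> a \<partial>\<mu>) = barycenter \<mu> \<bullet> a" "(\<integral>x. a \<bullet> x \<partial>\<mu>) = a \<bullet> barycenter \<mu>"
  using wasserstein_spaceD[OF assms] by (simp_all add: barycenter_def)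

lemma barycenters_le_correlation:
  fixes \<mu> \<nu> :: "'a::euclidean_space measure"
  assumes "\<mu> \<in> wasserstein_space" "\<nu> \<in> wasserstein_space"
  shows "barycenter \<mu> \<bullet> barycenter \<nu> \<le> correlation \<mu> \<nu>"
proof -
  note m = wasserstein_spaceD[OF assms(1)] and n = wasserstein_spaceD[OF assms(2)]
  have [measurable_cong]: "sets \<mu> = sets borel" "sets \<nu> = sets borel" by (fact m n)+
  have "(\<integral>x. x \<partial>\<mu>) \<bullet> (\<integral>x. x \<partial>\<nu>) + (\<integral>x. 0 *\<^sub>R x \<partial>\<mu>) \<bullet> (\<integral>x. 0 *\<^sub>R x \<partial>\<nu>)
      \<le> correlation (distr \<mu> borel (\<lambda>x. x)) (distr \<nu> borel (\<lambda>x. x))"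
    by (rule correlation_ge_tilted[where ?h1.0="\<lambda>_. 0" and ?h2.0="\<lambda>_. 0"]) (simp_all add: m n)
  then show ?thesis using m n by (simp add: barycenter_def distr_borel_id)
qed

definition centered :: "'a::euclidean_space measure set" where
  "centered = {\<mu> \<in> wasserstein_space. barycenter \<mu> = 0}"

lemma centeredD:
  assumes "\<mu> \<in> centered"
  shows "\<mu> \<in> wasserstein_space" "barycenter \<mu> = 0"
    "prob_space \<mu>" "sets \<mu> = sets borel" "(\<integral>x. x \<bullet> a \<partial>\<mu>) = 0" "(\<integral>x. a \<bullet> x \<partial>\<mu>) = 0"
    "(\<integral>x. x \<partial>\<mu>) = 0"
  using assms wasserstein_spaceD[of \<mu>] barycenter_inner[of \<mu>]
  by (auto simp: centered_def barycenter_def)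

lemma centered_correlation_nonneg:
  "\<mu> \<in> centered \<Longrightarrow> \<nu> \<in> centered \<Longrightarrow> correlation \<mu> \<nu> \<ge> 0"
  using barycenters_le_correlation[of \<mu> \<nu>] by (simp add: centered_def)

lemma second_moment_eq_0_iff:
  fixes \<mu> :: "'a::euclidean_space measure"
  assumes "\<mu> \<in> wasserstein_space"
  shows "second_moment \<mu> = 0 \<longleftrightarrow> (AE x in \<mu>. x = 0)"
  unfolding second_moment_def using wasserstein_spaceD[OF assms]
  by (subst integral_nonneg_eq_0_iff_AE) auto

text \<open>With \<open>b\<close> the mean of \<open>f x *\<^sub>R x\<close>, tilt the product by the centered \<open>f\<close> and the centered sign of
\<open>b \<bullet> y\<close>. This coupling has mean inner product a quarter of the mean of \<open>\<bar>b \<bullet> y\<bar>\<close>, which must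
therefore vanish.\<close>

lemma orthogonality:
  fixes \<mu> \<nu> :: "'a::euclidean_space measure"
  assumes C: "\<mu> \<in> centered" "\<nu> \<in> centered" and c0: "correlation \<mu> \<nu> = 0"
    and fm: "f \<in> borel_measurable borel" and f1: "\<And>x. \<bar>f x\<bar> \<le> (1::real)"
  shows "AE y in \<nu>. (\<integral>x. f x *\<^sub>R x \<partial>\<mu>) \<bullet> y = 0"
proof -
  note W = centeredD(1)[OF C(1)] centeredD(1)[OF C(2)]
  note m = wasserstein_spaceD[OF W(1)] and n = wasserstein_spaceD[OF W(2)]
  have [measurable_cong]: "sets \<mu> = sets borel" "sets \<nu> = sets borel" by (fact m n)+
  note [measurable] = fm
  interpret m: prob_space \<mu> by fact
  interpret n: prob_space \<nu> by fact
  define b where "b = (\<integral>x. f x *\<^sub>R x \<partial>\<mu>)"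
  define g where "g y = sgn (b \<bullet> y)" for y :: 'a
  have [measurable]: "g \<in> borel_measurable borel" unfolding g_def sgn_if by measurable
  have g1: "\<bar>g y\<bar> \<le> 1" for y by (simp add: g_def sgn_if)
  have fi: "integrable \<mu> f" by (rule m.integrable_const_bound[of _ 1]) (use f1 in auto)
  have gi: "integrable \<nu> g" by (rule n.integrable_const_bound[of _ 1]) (use g1 in auto)
  have fxi: "integrable \<mu> (\<lambda>x. f x *\<^sub>R x)"
    by (rule Bochner_Integration.integrable_bound[OF m(5)]) (use f1 in \<open>auto intro!: AE_I2 mult_left_le_one_le\<close>)
  have gyi: "integrable \<nu> (\<lambda>x. g x *\<^sub>R x)"
    by (rule Bochner_Integration.integrable_bound[OF n(5)]) (use g1 in \<open>auto intro!: AE_I2 mult_left_le_one_le\<close>)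
  define Ef where "Ef = (\<integral>x. f x \<partial>\<mu>)"
  define Eg where "Eg = (\<integral>y. g y \<partial>\<nu>)"
  have Ef: "\<bar>Ef\<bar> \<le> 1"
    unfolding Ef_def using m.integral_le_const[OF fi, of 1] m.integral_ge_const[OF fi, of "-1"] f1
    by (fastforce simp: abs_le_iff intro: AE_I2)
  have Eg: "\<bar>Eg\<bar> \<le> 1"
    unfolding Eg_def using n.integral_le_const[OF gi, of 1] n.integral_ge_const[OF gi, of "-1"] g1
    by (fastforce simp: abs_le_iff intro: AE_I2)
  \<comment> \<open>the factor 4 makes \<open>h1 x * h2 y\<close> at most one in absolute value\<close>
  define h1 where "h1 x = (f x - Ef) / 4" for x
  define h2 where "h2 y = g y - Eg" for y
  have h: "\<bar>h1 x * h2 y\<bar> \<le> 1" for x y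
  proof -
    have "\<bar>h1 x\<bar> \<le> 1/2" using f1[of x] Ef by (simp add: h1_def)
    moreover have "\<bar>h2 y\<bar> \<le> 2" using g1[of y] Eg by (simp add: h2_def)
    ultimately have "\<bar>h1 x\<bar> * \<bar>h2 y\<bar> \<le> 1/2 * 2" by (intro mult_mono) auto
    then show ?thesis by (simp add: abs_mult)
  qed
  have s1: "h1 x *\<^sub>R x = (1/4) *\<^sub>R (f x *\<^sub>R x) - (Ef/4) *\<^sub>R x" for x :: 'a
    by (simp add: h1_def algebra_simps diff_divide_distrib)
  have s2: "h2 x *\<^sub>R x = g x *\<^sub>R x - Eg *\<^sub>R x" for x :: 'a
    by (simp add: h2_def algebra_simps)
  have i1: "(\<integral>x. h1 x *\<^sub>R x \<partial>\<mu>) = (1/4) *\<^sub>R b"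
    unfolding s1 b_def using fxi m(5) centeredD(7)[OF C(1)]
    by (subst Bochner_Integration.integral_diff) (auto simp del: scaleR_scaleR simp: integral_scaleR_right)
  have i2: "(\<integral>x. h2 x *\<^sub>R x \<partial>\<nu>) = (\<integral>x. g x *\<^sub>R x \<partial>\<nu>)"
    unfolding s2 using gyi n(5) centeredD(7)[OF C(2)] by simp
  have "(\<integral>x. x \<partial>\<mu>) \<bullet> (\<integral>x. x \<partial>\<nu>) + (\<integral>x. h1 x *\<^sub>R x \<partial>\<mu>) \<bullet> (\<integral>x. h2 x *\<^sub>R x \<partial>\<nu>)
      \<le> correlation (distr \<mu> borel (\<lambda>x. x)) (distr \<nu> borel (\<lambda>x. x))"
  proof (rule correlation_ge_tilted[where ?h1.0=h1 and ?h2.0=h2])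
    have "0 \<le> 1 + h1 x * h2 y" for x y using h[of x y] by linarith
    then show "AE \<omega> in \<mu>. AE \<omega>' in \<nu>. 0 \<le> 1 + h1 \<omega> * h2 \<omega>'" by simp
    show "integrable \<mu> h1" "(\<integral>\<omega>. h1 \<omega> \<partial>\<mu>) = 0" unfolding h1_def using fi
      by (auto simp: Ef_def m.prob_space)
    show "integrable \<nu> h2" "(\<integral>\<omega>. h2 \<omega> \<partial>\<nu>) = 0" unfolding h2_def using gi
      by (auto simp: Eg_def n.prob_space)
    show "integrable \<mu> (\<lambda>\<omega>. h1 \<omega> *\<^sub>R \<omega>)" unfolding s1 using fxi m(5)
      by (intro Bochner_Integration.integrable_diff integrable_scaleR_right)
    show "integrable \<nu> (\<lambda>\<omega>. h2 \<omega> *\<^sub>R \<omega>)" unfolding s2 using gyi n(5)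
      by (intro Bochner_Integration.integrable_diff integrable_scaleR_right)
  qed (simp_all add: m n)
  then have "(1/4) * (b \<bullet> (\<integral>x. g x *\<^sub>R x \<partial>\<nu>)) \<le> 0"
    using centeredD(7)[OF C(1)] c0 m(2) n(2) by (simp add: i1 i2 distr_borel_id)
  moreover have "b \<bullet> (\<integral>x. g x *\<^sub>R x \<partial>\<nu>) = (\<integral>x. \<bar>b \<bullet> x\<bar> \<partial>\<nu>)"
    using gyi by (subst integral_inner_right[symmetric]) (auto simp: g_def sgn_if intro!: Bochner_Integration.integral_cong)
  moreover have "(\<integral>x. \<bar>b \<bullet> x\<bar> \<partial>\<nu>) \<ge> 0" by simp
  ultimately have "(\<integral>x. \<bar>b \<bullet> x\<bar> \<partial>\<nu>) = 0" by linarith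
  then have "AE x in \<nu>. \<bar>b \<bullet> x\<bar> = 0"
    using n(7) by (subst (asm) integral_nonneg_eq_0_iff_AE) auto
  then show ?thesis by (simp add: b_def)
qed

section \<open>Two-point measures\<close>

text \<open>The weights are those which make the barycenter zero; the positions are scaled such that the second
moment is one for a unit vector \<open>u\<close>. Up to dilation every centered measure carried by two points
has this form, and \<open>(u, a)\<close> and \<open>(- u, 1 / a)\<close> describe the same measure.\<close>

definition two_point :: "'a::euclidean_space \<Rightarrow> real \<Rightarrow> 'a measure" where
  "two_point u a = distr (measure_pmf (bernoulli_pmf (1 / (1 + a\<^sup>2)))) borel
     (\<lambda>b. if b then a *\<^sub>R u else (- 1 / a) *\<^sub>R u)"

lemma sets_two_point [measurable_cong]: "sets (two_point u a) = sets borel"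
  by (simp add: two_point_def)

lemma integrable_bernoulli_pmf:
  fixes f :: "bool \<Rightarrow> 'b::{banach, second_countable_topology}"
  shows "integrable (measure_pmf (bernoulli_pmf p)) f"
  by (rule integrable_measure_pmf_finite) simp

lemma two_point_integral:
  fixes f :: "'a::euclidean_space \<Rightarrow> real"
  assumes [measurable]: "f \<in> borel_measurable borel"
  shows "integrable (two_point u a) f"
    "(\<integral>x. f x \<partial>two_point u a) = (f (a *\<^sub>R u) + a\<^sup>2 * f ((- 1 / a) *\<^sub>R u)) / (1 + a\<^sup>2)"
proof -
  have pos: "1 + a\<^sup>2 > 0" by (simp add: add_pos_nonneg)
  show "integrable (two_point u a) f"
    unfolding two_point_def by (subst integrable_distr_eq) (auto intro: integrable_bernoulli_pmf)
  have "(\<integral>x. f x \<partial>two_point u a) =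
      f (a *\<^sub>R u) * (1 / (1 + a\<^sup>2)) + f ((- 1 / a) *\<^sub>R u) * (1 - 1 / (1 + a\<^sup>2))"
    unfolding two_point_def using pos by (subst integral_distr) auto
  also have "\<dots> = (f (a *\<^sub>R u) + a\<^sup>2 * f ((- 1 / a) *\<^sub>R u)) / (1 + a\<^sup>2)"
  proof -
    have "1 - 1 / (1 + a\<^sup>2) = a\<^sup>2 / (1 + a\<^sup>2)" using pos by (simp add: field_simps)
    then show ?thesis by (simp only: add_divide_distrib) (simp add: mult.commute)
  qed
  finally show "(\<integral>x. f x \<partial>two_point u a) = (f (a *\<^sub>R u) + a\<^sup>2 * f ((- 1 / a) *\<^sub>R u)) / (1 + a\<^sup>2)" .
qed

lemma AE_two_point: "AE x in two_point u a. x = a *\<^sub>R u \<or> x = (- 1 / a) *\<^sub>R u"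
  unfolding two_point_def by (subst AE_distr_iff) auto

lemma two_point_in_wasserstein_space: "two_point u a \<in> wasserstein_space"
  unfolding two_point_def
  by (rule distr_in_wasserstein_space)
     (auto intro: integrable_bernoulli_pmf prob_space_measure_pmf)

lemma two_point_centered:
  assumes "a > 0" shows "two_point u a \<in> centered"
proof -
  have "barycenter (two_point u a) \<bullet> b = 0" for b
    using assms two_point_integral(2)[of "\<lambda>x. x \<bullet> b" u a]
    by (simp add: barycenter_inner(1)[symmetric] two_point_in_wasserstein_space power2_eq_square)
  then have "barycenter (two_point u a) = 0" by (metis inner_eq_zero_iff)
  then show ?thesis by (simp add: centered_def two_point_in_wasserstein_space)
qed

lemma two_point_second_moment:
  assumes "norm u = 1" "a > 0" shows "second_moment (two_point u a) = 1"
proof -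
  have "second_moment (two_point u a) = (a\<^sup>2 + a\<^sup>2 * (1 / a)\<^sup>2) / (1 + a\<^sup>2)"
    unfolding second_moment_def using assms by (subst two_point_integral(2)) (auto simp: power2_eq_square)
  also have "a\<^sup>2 + a\<^sup>2 * (1 / a)\<^sup>2 = 1 + a\<^sup>2" using assms by (simp add: power2_eq_square)
  also have "(1 + a\<^sup>2) / (1 + a\<^sup>2) = 1" using add_pos_nonneg[of 1 "a\<^sup>2"] by simp
  finally show ?thesis .
qed

lemma two_point_uminus:
  assumes "a > 0" shows "two_point (- u) a = two_point u (1 / a)"
proof (rule measure_eqI)
  fix A assume "A \<in> sets (two_point (- u) a)"
  then have A[measurable]: "A \<in> sets borel" by (simp add: sets_two_point)
  interpret p: prob_space "two_point (- u) a"
    using wasserstein_spaceD(1)[OF two_point_in_wasserstein_space] .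
  interpret q: prob_space "two_point u (1 / a)"
    using wasserstein_spaceD(1)[OF two_point_in_wasserstein_space] .
  have "measure (two_point (- u) a) A = (\<integral>x. indicator A x \<partial>two_point (- u) a)"
    by (simp add: two_point_def)
  also have "\<dots> = (indicator A (a *\<^sub>R (- u)) + a\<^sup>2 * indicator A ((- 1 / a) *\<^sub>R (- u))) / (1 + a\<^sup>2)"
    by (subst two_point_integral) auto
  also have "\<dots> = (indicator A ((1 / a) *\<^sub>R u) + (1 / a)\<^sup>2 * indicator A ((- 1 / (1 / a)) *\<^sub>R u)) / (1 + (1 / a)\<^sup>2)"
  proof -
    have "(N + (1 / a)\<^sup>2 * P) / (1 + (1 / a)\<^sup>2) = (P + a\<^sup>2 * N) / (1 + a\<^sup>2)" for P N :: real
    proof -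
      have "(N + (1 / a)\<^sup>2 * P) / (1 + (1 / a)\<^sup>2) = (a\<^sup>2 * (N + (1 / a)\<^sup>2 * P)) / (a\<^sup>2 * (1 + (1 / a)\<^sup>2))"
        using assms by simp
      also have "a\<^sup>2 * (N + (1 / a)\<^sup>2 * P) = P + a\<^sup>2 * N"
        using assms by (simp add: power2_eq_square algebra_simps)
      also have "a\<^sup>2 * (1 + (1 / a)\<^sup>2) = 1 + a\<^sup>2"
        using assms by (simp add: power2_eq_square algebra_simps)
      finally show ?thesis .
    qed
    from this[of "indicator A ((1 / a) *\<^sub>R u)" "indicator A ((- 1 / (1 / a)) *\<^sub>R u)"]
    show ?thesis by simp
  qed
  also have "\<dots> = (\<integral>x. indicator A x \<partial>two_point u (1 / a))"
    by (subst two_point_integral) auto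
  also have "\<dots> = measure (two_point u (1 / a)) A" by (simp add: two_point_def)
  finally show "emeasure (two_point (- u) a) A = emeasure (two_point u (1 / a)) A"
    by (simp add: p.emeasure_eq_measure q.emeasure_eq_measure)
qed (simp add: sets_two_point)

text \<open>On a set of two points every indicator function is an affine function of \<open>x \<bullet> u\<close>, so its mean is
fixed by the barycenter.\<close>

lemma two_point_eqI:
  fixes \<mu> :: "'a::euclidean_space measure"
  assumes C: "\<mu> \<in> centered" and u: "norm u = 1" and a: "a > 0"
    and ae: "AE x in \<mu>. x = a *\<^sub>R u \<or> x = (- 1 / a) *\<^sub>R u"
  shows "\<mu> = two_point u a"
proof (rule measure_eqI)
  note W = centeredD(1)[OF C]
  note m = wasserstein_spaceD[OF W]
  have [measurable_cong]: "sets \<mu> = sets borel" by (fact m)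
  fix A assume "A \<in> sets \<mu>"
  then have A[measurable]: "A \<in> sets borel" using m by simp
  interpret p: prob_space \<mu> by fact
  interpret q: prob_space "two_point u a"
    using wasserstein_spaceD(1)[OF two_point_in_wasserstein_space] .
  let ?P = "indicator A (a *\<^sub>R u) :: real" and ?N = "indicator A ((- 1 / a) *\<^sub>R u) :: real"
  have uu: "u \<bullet> u = 1" using u by (simp add: norm_eq_1)
  have pos: "a + 1 / a > 0" "1 + a\<^sup>2 > 0" using a by (auto intro: add_pos_pos)
  have eq: "indicator A x = (?P * (x \<bullet> u + 1 / a) + ?N * (a - x \<bullet> u)) / (a + 1 / a)"
    if "x = a *\<^sub>R u \<or> x = (- 1 / a) *\<^sub>R u" for x
  proof -
    from that consider "x = a *\<^sub>R u" "x \<bullet> u = a" | "x = (- 1 / a) *\<^sub>R u" "x \<bullet> u = - 1 / a"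
      by (auto simp: uu)
    then show ?thesis
    proof cases
      case 1 then show ?thesis using pos by (simp add: uu)
    next
      case 2
      then have "(?P * (x \<bullet> u + 1 / a) + ?N * (a - x \<bullet> u)) = ?N * (a + 1 / a)" by (simp add: uu)
      then show ?thesis using pos 2 by simp
    qed
  qed
  have "measure \<mu> A = (\<integral>x. indicator A x \<partial>\<mu>)" using m by simp
  also have "\<dots> = (\<integral>x. (?P * (x \<bullet> u + 1 / a) + ?N * (a - x \<bullet> u)) / (a + 1 / a) \<partial>\<mu>)"
  proof (rule integral_cong_AE)
    show "AE x in \<mu>. indicator A x = (?P * (x \<bullet> u + 1 / a) + ?N * (a - x \<bullet> u)) / (a + 1 / a)"
      using ae by (rule eventually_mono) (rule eq)
  qed measurable
  also have "\<dots> = (?P * (1 / a) + ?N * a) / (a + 1 / a)"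
    using m(6)[of u] centeredD(5)[OF C, of u] p.prob_space by (simp del: integral_inner_left)
  also have "\<dots> = (?P + a\<^sup>2 * ?N) / (1 + a\<^sup>2)"
    using a pos by (simp add: divide_simps power2_eq_square) (simp add: algebra_simps)
  also have "\<dots> = (\<integral>x. indicator A x \<partial>two_point u a)"
    by (subst two_point_integral) auto
  also have "\<dots> = measure (two_point u a) A" by (simp add: two_point_def)
  finally show "emeasure \<mu> A = emeasure (two_point u a) A"
    by (simp add: p.emeasure_eq_measure q.emeasure_eq_measure)
qed (use centeredD[OF C] in \<open>simp add: sets_two_point\<close>)

definition on_line :: "'a::euclidean_space \<Rightarrow> 'a measure \<Rightarrow> bool" where
  "on_line u \<mu> \<longleftrightarrow> (AE x in \<mu>. x = (x \<bullet> u) *\<^sub>R u)"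

lemma two_point_on_line:
  assumes "norm u = 1" shows "on_line u (two_point u a)"
  unfolding on_line_def using AE_two_point[of a u]
  by (rule eventually_mono) (use assms in \<open>auto simp: norm_eq_1\<close>)

lemma on_line_uminus: "on_line (- u) \<mu> = on_line u \<mu>"
  by (simp add: on_line_def)

text \<open>For the upper bound let \<open>s\<close> and \<open>t\<close> be the coordinates along \<open>u\<close> and \<open>v\<close>. The inequalities
\<open>(s - a) * (t + 1 / b) \<le> 0\<close> and \<open>(t - b) * (s + 1 / a) \<le> 0\<close> hold on the supports, and their means
bound the mean of \<open>s * t\<close> by \<open>a / b\<close> and by \<open>b / a\<close>. The bound is attained by the product tilted by
\<open>1 + k * s * t\<close> for the largest \<open>k\<close> that keeps this density nonnegative.\<close>

lemma two_point_correlation: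
  fixes u v :: "'a::euclidean_space"
  assumes u: "norm u = 1" and v: "norm v = 1" and a: "a > 0" and b: "b > 0" and c: "u \<bullet> v \<ge> 0"
  shows "correlation (two_point u a) (two_point v b) = (u \<bullet> v) * min (a / b) (b / a)"
proof (rule antisym)
  let ?U = "two_point u a" and ?V = "two_point v b"
  note WU = two_point_in_wasserstein_space[of u a] and WV = two_point_in_wasserstein_space[of v b]
  note CU = two_point_centered[OF a, of u] and CV = two_point_centered[OF b, of v]
  have uu: "u \<bullet> u = 1" and vv: "v \<bullet> v = 1" using u v by (simp_all add: norm_eq_1)
  show "correlation ?U ?V \<le> (u \<bullet> v) * min (a / b) (b / a)"
  proof (rule correlation_le[OF WU WV])
    fix \<gamma> assume g: "\<gamma> \<in> couplings ?U ?V"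
    interpret prob_space \<gamma> using couplingsD[OF g] by simp
    let ?s = "\<lambda>z::'a \<times> 'a. fst z \<bullet> u" and ?t = "\<lambda>z::'a \<times> 'a. snd z \<bullet> v"
    have ae: "AE z in \<gamma>. (fst z = a *\<^sub>R u \<or> fst z = (- 1 / a) *\<^sub>R u) \<and> (snd z = b *\<^sub>R v \<or> snd z = (- 1 / b) *\<^sub>R v)"
      using coupling_AE_fst[OF g AE_two_point] coupling_AE_snd[OF g AE_two_point] by eventually_elim auto
    have si: "integrable \<gamma> ?s" and Es: "(\<integral>z. ?s z \<partial>\<gamma>) = 0"
      using coupling_integral(1,2)[OF g, of "\<lambda>x. x \<bullet> u"] wasserstein_spaceD(6)[OF WU, of u] centeredD(5)[OF CU, of u]
      by (simp_all del: integral_inner_left)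
    have it: "integrable \<gamma> ?t" and Et: "(\<integral>z. ?t z \<partial>\<gamma>) = 0"
      using coupling_integral(3,4)[OF g, of "\<lambda>x. x \<bullet> v"] wasserstein_spaceD(6)[OF WV, of v] centeredD(5)[OF CV, of v]
      by (simp_all del: integral_inner_left)
    have ip: "integrable \<gamma> (\<lambda>z. fst z \<bullet> snd z)" by (rule coupling_integrable_inner[OF WU WV g])
    have bound: "(\<integral>z. fst z \<bullet> snd z \<partial>\<gamma>) \<le> (u \<bullet> v) * r"
      if st: "\<And>s t. s = a \<or> s = - 1 / a \<Longrightarrow> t = b \<or> t = - 1 / b \<Longrightarrow> s * t \<le> p * s + q * t + r" for p q r
    proof -
      have "(\<integral>z. fst z \<bullet> snd z \<partial>\<gamma>) \<le> (\<integral>z. (u \<bullet> v) * (p * ?s z + q * ?t z + r) \<partial>\<gamma>)"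
      proof (rule integral_mono_AE[OF ip])
        show "integrable \<gamma> (\<lambda>z. (u \<bullet> v) * (p * ?s z + q * ?t z + r))" using si it by simp
        show "AE z in \<gamma>. fst z \<bullet> snd z \<le> (u \<bullet> v) * (p * ?s z + q * ?t z + r)"
          using ae
        proof eventually_elim
          fix z :: "'a \<times> 'a"
          assume z: "(fst z = a *\<^sub>R u \<or> fst z = (- 1 / a) *\<^sub>R u) \<and> (snd z = b *\<^sub>R v \<or> snd z = (- 1 / b) *\<^sub>R v)"
          have "fst z \<bullet> snd z = (u \<bullet> v) * (?s z * ?t z)" using z by (auto simp: uu vv)
          moreover have "?s z * ?t z \<le> p * ?s z + q * ?t z + r" using z by (intro st) (auto simp: uu vv)
          ultimately show "fst z \<bullet> snd z \<le> (u \<bullet> v) * (p * ?s z + q * ?t z + r)"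
            using c by (simp add: mult_left_mono)
        qed
      qed
      also have "\<dots> = (u \<bullet> v) * r" using si it Es Et by (simp add: prob_space del: integral_inner_left)
      finally show ?thesis .
    qed
    have le: "s \<le> x" "s \<ge> - 1 / x" if "s = x \<or> s = - 1 / x" "x > 0" for s x :: real
    proof -
      have "0 < 1 / x" using that(2) by simp
      then have "- (1 / x) \<le> x" using that(2) by linarith
      then show "s \<le> x" "s \<ge> - 1 / x" using that by auto
    qed
    have "s * t \<le> - 1 / b * s + a * t + a / b" if "s = a \<or> s = - 1 / a" "t = b \<or> t = - 1 / b" for s t
    proof -
      have "(s - a) * (t + 1 / b) \<le> 0"
        using le[OF that(1) a] le[OF that(2) b] by (intro mult_nonpos_nonneg) auto
      then show ?thesis by (simp add: algebra_simps diff_divide_distrib)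
    qed
    then have 1: "(\<integral>z. fst z \<bullet> snd z \<partial>\<gamma>) \<le> (u \<bullet> v) * (a / b)" by (rule bound)
    have "s * t \<le> b * s + - 1 / a * t + b / a" if "s = a \<or> s = - 1 / a" "t = b \<or> t = - 1 / b" for s t
    proof -
      have "(t - b) * (s + 1 / a) \<le> 0"
        using le[OF that(1) a] le[OF that(2) b] by (intro mult_nonpos_nonneg) auto
      then show ?thesis by (simp add: algebra_simps diff_divide_distrib)
    qed
    then have 2: "(\<integral>z. fst z \<bullet> snd z \<partial>\<gamma>) \<le> (u \<bullet> v) * (b / a)" by (rule bound)
    show "(\<integral>z. fst z \<bullet> snd z \<partial>\<gamma>) \<le> (u \<bullet> v) * min (a / b) (b / a)"
      using 1 2 by (simp add: min_def)
  qed
  \<comment> \<open>for this \<open>k\<close> the density \<open>1 + k * s * t\<close> is nonnegative, and zero at one pair of points\<close>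
  define k where "k = min (a / b) (b / a)"
  have k: "k > 0" "k * a \<le> b" "k * b \<le> a"
    using a b by (auto simp: k_def min_def field_simps)
  have sw: "integrable (two_point w c) (\<lambda>x. (x \<bullet> w) *\<^sub>R x)"
      "(\<integral>x. (x \<bullet> w) *\<^sub>R x \<partial>two_point w c) = w"
    if w: "norm w = 1" and c: "c > 0" for w :: 'a and c
  proof -
    let ?W = "two_point w c"
    note d = wasserstein_spaceD[OF two_point_in_wasserstein_space[of w c]]
    have ww: "w \<bullet> w = 1" using w by (simp add: norm_eq_1)
    have ae: "AE x in ?W. (x \<bullet> w) *\<^sub>R x = (x \<bullet> w)\<^sup>2 *\<^sub>R w"
      using AE_two_point[of c w] by eventually_elim (auto simp: ww power2_eq_square)
    have i: "integrable ?W (\<lambda>x. (x \<bullet> w)\<^sup>2 *\<^sub>R w)" using d(8) by simp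
    then show "integrable ?W (\<lambda>x. (x \<bullet> w) *\<^sub>R x)"
      by (rule integrable_cong_AE_imp) (use ae in auto)
    have "(\<integral>x. (x \<bullet> w) *\<^sub>R x \<partial>?W) = (\<integral>x. (x \<bullet> w)\<^sup>2 *\<^sub>R w \<partial>?W)"
      by (rule integral_cong_AE) (use ae in auto)
    also have "\<dots> = (\<integral>x. (x \<bullet> w)\<^sup>2 \<partial>?W) *\<^sub>R w" using d(8) by simp
    also have "(\<integral>x. (x \<bullet> w)\<^sup>2 \<partial>?W) = 1"
    proof -
      have "(\<integral>x. (x \<bullet> w)\<^sup>2 \<partial>?W) = (c\<^sup>2 + c\<^sup>2 * (1 / c)\<^sup>2) / (1 + c\<^sup>2)"
        by (subst two_point_integral(2)) (auto simp: ww power2_eq_square)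
      also have "c\<^sup>2 + c\<^sup>2 * (1 / c)\<^sup>2 = 1 + c\<^sup>2" using c by (simp add: power2_eq_square)
      also have "(1 + c\<^sup>2) / (1 + c\<^sup>2) = 1" using add_pos_nonneg[of 1 "c\<^sup>2"] by simp
      finally show ?thesis .
    qed
    finally show "(\<integral>x. (x \<bullet> w) *\<^sub>R x \<partial>?W) = w" by simp
  qed
  have "(\<integral>x. x \<partial>?U) \<bullet> (\<integral>x. x \<partial>?V) + (\<integral>x. (k * (x \<bullet> u)) *\<^sub>R x \<partial>?U) \<bullet> (\<integral>x. (x \<bullet> v) *\<^sub>R x \<partial>?V)
      \<le> correlation (distr ?U borel (\<lambda>x. x)) (distr ?V borel (\<lambda>x. x))"
  proof (rule correlation_ge_tilted[where ?h1.0="\<lambda>x. k * (x \<bullet> u)" and ?h2.0="\<lambda>x. x \<bullet> v"])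
    show "AE \<omega> in ?U. AE \<omega>' in ?V. 0 \<le> 1 + k * (\<omega> \<bullet> u) * (\<omega>' \<bullet> v)"
      using AE_two_point[of a u]
    proof eventually_elim
      fix x assume x: "x = a *\<^sub>R u \<or> x = (- 1 / a) *\<^sub>R u"
      show "AE y in ?V. 0 \<le> 1 + k * (x \<bullet> u) * (y \<bullet> v)"
        using AE_two_point[of b v]
      proof eventually_elim
        fix y assume y: "y = b *\<^sub>R v \<or> y = (- 1 / b) *\<^sub>R v"
        have "0 \<le> 1 + k * a * b" "0 \<le> 1 + k * (- 1 / a) * (- 1 / b)" using k a b by simp_all
        moreover have "0 \<le> 1 + k * a * (- 1 / b)" "0 \<le> 1 + k * (- 1 / a) * b"
          using k a b by (simp_all add: field_simps)
        ultimately show "0 \<le> 1 + k * (x \<bullet> u) * (y \<bullet> v)"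
          using x y by (auto simp: uu vv)
      qed
    qed
    show "integrable ?U (\<lambda>\<omega>. (k * (\<omega> \<bullet> u)) *\<^sub>R \<omega>)"
      using sw(1)[OF u a] by (simp add: scaleR_scaleR[symmetric] del: scaleR_scaleR)
  qed (simp_all add: wasserstein_spaceD(1,4,5)[OF WU] wasserstein_spaceD(1,4,5)[OF WV]
      wasserstein_spaceD(6)[OF WU, of u] wasserstein_spaceD(6)[OF WV, of v]
      centeredD(5)[OF CU, of u] centeredD(5)[OF CV, of v] sw(1)[OF v b] del: integral_inner_left)
  moreover have "(\<integral>x. (k * (x \<bullet> u)) *\<^sub>R x \<partial>?U) = k *\<^sub>R u"
    using sw[OF u a] by (simp add: scaleR_scaleR[symmetric] del: scaleR_scaleR)
  ultimately show "(u \<bullet> v) * min (a / b) (b / a) \<le> correlation ?U ?V"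
    using sw[OF v b] centeredD(7)[OF CU] by (simp add: distr_borel_id sets_two_point k_def mult.commute)
qed

section \<open>Measures on lines and extremality\<close>

lemma on_line_orthogonal_correlation:
  assumes C: "\<mu> \<in> centered" "\<nu> \<in> centered" and l: "on_line u \<mu>"
    and ae: "AE y in \<nu>. y \<bullet> u = 0"
  shows "correlation \<mu> \<nu> = 0"
proof (rule antisym)
  note W = centeredD(1)[OF C(1)] centeredD(1)[OF C(2)]
  show "correlation \<mu> \<nu> \<le> 0"
  proof (rule correlation_le[OF W])
    fix \<gamma> assume g: "\<gamma> \<in> couplings \<mu> \<nu>"
    have "AE z in \<gamma>. fst z \<bullet> snd z = 0"
      using coupling_AE_fst[OF g l[unfolded on_line_def]] coupling_AE_snd[OF g ae]
    proof eventually_elim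
      fix z :: "'a \<times> 'a" assume z: "fst z = (fst z \<bullet> u) *\<^sub>R u" "snd z \<bullet> u = 0"
      show "fst z \<bullet> snd z = 0" using z(2) by (subst z(1)) (simp add: inner_commute)
    qed
    then have "(\<integral>z. fst z \<bullet> snd z \<partial>\<gamma>) = 0" by (rule integral_eq_zero_AE)
    then show "(\<integral>z. fst z \<bullet> snd z \<partial>\<gamma>) \<le> 0" by simp
  qed
qed (rule centered_correlation_nonneg[OF C])

text \<open>Orthogonality is applied with the sign of \<open>x \<bullet> u\<close>: on the line of \<open>u\<close> the resulting mean
is a nonzero multiple of \<open>u\<close>.\<close>

lemma on_line_correlation_eq_0_iff:
  fixes u :: "'a::euclidean_space"
  assumes C: "\<mu> \<in> centered" "\<nu> \<in> centered" and l: "on_line u \<mu>" and m0: "second_moment \<mu> \<noteq> 0"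
  shows "correlation \<mu> \<nu> = 0 \<longleftrightarrow> (AE y in \<nu>. y \<bullet> u = 0)"
proof
  assume c0: "correlation \<mu> \<nu> = 0"
  note m = wasserstein_spaceD[OF centeredD(1)[OF C(1)]]
  have [measurable_cong]: "sets \<mu> = sets borel" by (fact m)
  have fm[measurable]: "(\<lambda>x. sgn (x \<bullet> u)) \<in> borel_measurable (borel :: 'a measure)"
    unfolding sgn_if by measurable
  have o: "AE y in \<nu>. (\<integral>x. sgn (x \<bullet> u) *\<^sub>R x \<partial>\<mu>) \<bullet> y = 0"
    by (rule orthogonality[OF C c0 fm]) (simp add: sgn_if)
  have "(\<integral>x. sgn (x \<bullet> u) *\<^sub>R x \<partial>\<mu>) = (\<integral>x. \<bar>x \<bullet> u\<bar> *\<^sub>R u \<partial>\<mu>)"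
  proof (rule integral_cong_AE)
    show "AE x in \<mu>. sgn (x \<bullet> u) *\<^sub>R x = \<bar>x \<bullet> u\<bar> *\<^sub>R u"
      using l[unfolded on_line_def]
    proof eventually_elim
      fix x assume x: "x = (x \<bullet> u) *\<^sub>R u"
      have "sgn (x \<bullet> u) *\<^sub>R x = sgn (x \<bullet> u) *\<^sub>R ((x \<bullet> u) *\<^sub>R u)" using x by simp
      also have "\<dots> = \<bar>x \<bullet> u\<bar> *\<^sub>R u" by (simp add: sgn_if)
      finally show "sgn (x \<bullet> u) *\<^sub>R x = \<bar>x \<bullet> u\<bar> *\<^sub>R u" .
    qed
  qed auto
  also have "\<dots> = (\<integral>x. \<bar>x \<bullet> u\<bar> \<partial>\<mu>) *\<^sub>R u" using m(6)[of u] by simp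
  finally have b: "(\<integral>x. sgn (x \<bullet> u) *\<^sub>R x \<partial>\<mu>) = (\<integral>x. \<bar>x \<bullet> u\<bar> \<partial>\<mu>) *\<^sub>R u" .
  have "(\<integral>x. \<bar>x \<bullet> u\<bar> \<partial>\<mu>) \<noteq> 0"
  proof
    assume "(\<integral>x. \<bar>x \<bullet> u\<bar> \<partial>\<mu>) = 0"
    then have "AE x in \<mu>. \<bar>x \<bullet> u\<bar> = 0"
      using m(6)[of u] by (subst (asm) integral_nonneg_eq_0_iff_AE) auto
    then have "AE x in \<mu>. x = 0" using l[unfolded on_line_def] by eventually_elim auto
    then show False using m0 second_moment_eq_0_iff[OF centeredD(1)[OF C(1)]] by simp
  qed
  with o b show "AE y in \<nu>. y \<bullet> u = 0" by (simp add: inner_commute)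
next
  assume "AE y in \<nu>. y \<bullet> u = 0"
  then show "correlation \<mu> \<nu> = 0" by (rule on_line_orthogonal_correlation[OF C l])
qed

text \<open>For centered measures this says that the linear span of the support of \<open>\<mu>'\<close> lies in that of \<open>\<mu>\<close>,
in terms of correlations alone.\<close>

definition span_le :: "'a::euclidean_space measure \<Rightarrow> 'a measure \<Rightarrow> bool" where
  "span_le \<mu>' \<mu> \<longleftrightarrow> (\<forall>\<nu>\<in>centered. correlation \<mu> \<nu> = 0 \<longrightarrow> correlation \<mu>' \<nu> = 0)"

text \<open>Minimality in the order of spans characterises the measures on a line through the origin, see
\<open>minimal_span_iff\<close>.\<close>

definition minimal_span :: "'a::euclidean_space measure \<Rightarrow> bool" where
  "minimal_span \<mu> \<longleftrightarrow> second_moment \<mu> \<noteq> 0 \<and>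
     (\<forall>\<mu>'\<in>centered. second_moment \<mu>' \<noteq> 0 \<longrightarrow> span_le \<mu>' \<mu> \<longrightarrow> span_le \<mu> \<mu>')"

text \<open>Through their quantile functions the centered measures on a line form a convex cone in a Hilbert
space, the correlation being the inner product. If \<open>\<mu>\<close> has second moment one, the inequality says that
projecting \<open>\<nu>\<close> and \<open>\<nu>'\<close> orthogonally onto the line spanned by \<open>\<mu>\<close> does not increase their inner product.
In this cone that singles out the extremal rays, which consist of step functions with a single step,
that is, of two-point measures.\<close>

definition extremal :: "'a::euclidean_space measure \<Rightarrow> bool" where
  "extremal \<mu> \<longleftrightarrow> minimal_span \<mu> \<and>
     (\<forall>\<nu>\<in>centered. \<forall>\<nu>'\<in>centered. span_le \<nu> \<mu> \<longrightarrow> span_le \<nu>' \<mu> \<longrightarrow>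
        correlation \<mu> \<nu> * correlation \<mu> \<nu>' \<le> correlation \<nu> \<nu>')"

lemma on_lineI:
  fixes u :: "'a::euclidean_space"
  assumes u: "norm u = 1" and orth: "\<And>a. norm a = 1 \<Longrightarrow> a \<bullet> u = 0 \<Longrightarrow> AE x in \<mu>. x \<bullet> a = 0"
  shows "on_line u \<mu>"
proof -
  have uu: "u \<bullet> u = 1" using u by (simp add: norm_eq_1)
  have 0: "AE x in \<mu>. x \<bullet> a = 0" if "a \<bullet> u = 0" for a
  proof (cases "a = 0")
    case False
    then have "AE x in \<mu>. x \<bullet> ((1 / norm a) *\<^sub>R a) = 0" using that by (intro orth) auto
    then show ?thesis using False by simp
  qed simp
  have "AE x in \<mu>. \<forall>e\<in>Basis. x \<bullet> (e - (e \<bullet> u) *\<^sub>R u) = 0"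
    by (intro AE_ball_countable' 0) (auto simp: inner_diff_left uu countable_finite)
  then show ?thesis unfolding on_line_def
  proof (rule eventually_mono)
    fix x assume x: "\<forall>e\<in>Basis. x \<bullet> (e - (e \<bullet> u) *\<^sub>R u) = 0"
    show "x = (x \<bullet> u) *\<^sub>R u"
      by (rule euclidean_eqI) (use x in \<open>simp add: inner_diff_right inner_commute mult.commute\<close>)
  qed
qed

lemma span_le_on_line_iff:
  fixes u :: "'a::euclidean_space"
  assumes C: "\<mu> \<in> centered" "\<nu> \<in> centered" and u: "norm u = 1"
    and l: "on_line u \<mu>" and m0: "second_moment \<mu> \<noteq> 0"
  shows "span_le \<nu> \<mu> \<longleftrightarrow> on_line u \<nu>"
proof
  assume le: "span_le \<nu> \<mu>"
  show "on_line u \<nu>"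
  proof (rule on_lineI[OF u])
    fix a :: 'a assume a: "norm a = 1" "a \<bullet> u = 0"
    let ?T = "two_point a 1"
    have T: "?T \<in> centered" by (rule two_point_centered) simp
    have "AE y in ?T. y \<bullet> u = 0" using AE_two_point[of 1 a] by eventually_elim (use a in auto)
    then have "correlation \<mu> ?T = 0" by (rule on_line_orthogonal_correlation[OF C(1) T l])
    then have "correlation \<nu> ?T = 0" using le T by (simp add: span_le_def)
    then have "correlation ?T \<nu> = 0" by (simp add: correlation_commute centeredD(1) T C)
    then show "AE x in \<nu>. x \<bullet> a = 0"
      by (subst (asm) on_line_correlation_eq_0_iff[OF T C(2) two_point_on_line])
         (use a two_point_second_moment[OF a(1), of 1] in auto)
  qed
next
  assume l': "on_line u \<nu>"
  show "span_le \<nu> \<mu>" unfolding span_le_def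
  proof (intro ballI impI)
    fix \<kappa> :: "'a measure" assume "\<kappa> \<in> centered" "correlation \<mu> \<kappa> = 0"
    then show "correlation \<nu> \<kappa> = 0"
      using on_line_correlation_eq_0_iff[OF C(1) _ l m0] on_line_orthogonal_correlation[OF C(2) _ l'] by blast
  qed
qed

text \<open>If \<open>\<mu>\<close> is not concentrated at the origin, then \<open>b\<close>, the mean of \<open>f x *\<^sub>R x\<close>, is nonzero for a suitable sign
function \<open>f\<close>. By \<open>orthogonality\<close> a two-point measure on the line of \<open>b\<close> is below \<open>\<mu>\<close>, so
minimality places \<open>\<mu>\<close> on that line.\<close>

lemma minimal_span_iff:
  fixes \<mu> :: "'a::euclidean_space measure"
  assumes C: "\<mu> \<in> centered"
  shows "minimal_span \<mu> \<longleftrightarrow> second_moment \<mu> \<noteq> 0 \<and> (\<exists>u. norm u = 1 \<and> on_line u \<mu>)"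
proof
  assume min: "minimal_span \<mu>"
  then have m0: "second_moment \<mu> \<noteq> 0" by (simp add: minimal_span_def)
  note W = centeredD(1)[OF C]
  note m = wasserstein_spaceD[OF W]
  have [measurable_cong]: "sets \<mu> = sets borel" by (fact m)
  obtain e :: 'a where e: "e \<in> Basis" "\<not> (AE x in \<mu>. x \<bullet> e = 0)"
  proof (rule ccontr)
    assume "\<not> thesis"
    then have "\<And>e. e \<in> Basis \<Longrightarrow> AE x in \<mu>. x \<bullet> e = 0" using that by blast
    then have "AE x in \<mu>. \<forall>e\<in>Basis. x \<bullet> e = 0" by (intro AE_ball_countable') (auto simp: countable_finite)
    then have "AE x in \<mu>. x = 0" by eventually_elim (auto simp: euclidean_all_zero_iff)
    then show False using m0 second_moment_eq_0_iff[OF W] by simp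
  qed
  define f where "f x = sgn (x \<bullet> e)" for x :: 'a
  have fm[measurable]: "f \<in> borel_measurable borel" unfolding f_def sgn_if by measurable
  have f1: "\<bar>f x\<bar> \<le> 1" for x by (simp add: f_def sgn_if)
  define b where "b = (\<integral>x. f x *\<^sub>R x \<partial>\<mu>)"
  have fxi: "integrable \<mu> (\<lambda>x. f x *\<^sub>R x)"
    by (rule Bochner_Integration.integrable_bound[OF m(5)]) (use f1 in \<open>auto intro!: AE_I2 mult_left_le_one_le\<close>)
  have "b \<bullet> e = (\<integral>x. \<bar>x \<bullet> e\<bar> \<partial>\<mu>)"
    unfolding b_def using fxi
    by (subst integral_inner_left[symmetric]) (auto simp: f_def sgn_if intro!: Bochner_Integration.integral_cong)
  moreover have "(\<integral>x. \<bar>x \<bullet> e\<bar> \<partial>\<mu>) \<noteq> 0"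
    using e(2) m(6)[of e] by (subst integral_nonneg_eq_0_iff_AE) auto
  ultimately have b0: "b \<noteq> 0" by auto
  define u where "u = (1 / norm b) *\<^sub>R b"
  have u: "norm u = 1" using b0 by (simp add: u_def)
  let ?T = "two_point u 1"
  have T: "?T \<in> centered" by (rule two_point_centered) simp
  have T0: "second_moment ?T \<noteq> 0" using two_point_second_moment[OF u, of 1] by simp
  note lT = two_point_on_line[OF u, of 1]
  have "span_le ?T \<mu>" unfolding span_le_def
  proof (intro ballI impI)
    fix \<kappa> :: "'a measure" assume L: "\<kappa> \<in> centered" and c0: "correlation \<mu> \<kappa> = 0"
    have "AE y in \<kappa>. b \<bullet> y = 0" unfolding b_def by (rule orthogonality[OF C L c0 fm f1])
    then have "AE y in \<kappa>. y \<bullet> u = 0" by (simp add: u_def inner_commute)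
    then show "correlation ?T \<kappa> = 0" by (rule on_line_orthogonal_correlation[OF T L lT])
  qed
  then have "span_le \<mu> ?T" using min T T0 by (simp add: minimal_span_def)
  then have "on_line u \<mu>" using span_le_on_line_iff[OF T C u lT T0] by simp
  with u m0 show "second_moment \<mu> \<noteq> 0 \<and> (\<exists>u. norm u = 1 \<and> on_line u \<mu>)" by blast
next
  assume "second_moment \<mu> \<noteq> 0 \<and> (\<exists>u. norm u = 1 \<and> on_line u \<mu>)"
  then obtain u :: 'a where m0: "second_moment \<mu> \<noteq> 0" and u: "norm u = 1" and l: "on_line u \<mu>" by blast
  show "minimal_span \<mu>" unfolding minimal_span_def
  proof (intro conjI m0 ballI impI)
    fix \<mu>' assume C': "\<mu>' \<in> centered" and m0': "second_moment \<mu>' \<noteq> 0" and le: "span_le \<mu>' \<mu>"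
    have "on_line u \<mu>'" using le span_le_on_line_iff[OF C C' u l m0] by simp
    then show "span_le \<mu> \<mu>'" using span_le_on_line_iff[OF C' C u _ m0'] l by simp
  qed
qed

text \<open>Couplings of the two-point measure with \<open>\<nu>\<close> and with \<open>\<nu>'\<close> are glued by tilting their product by
\<open>1 + s * s'\<close>, where \<open>s\<close> and \<open>s'\<close> are the coordinates of the two-point components. This density is
nonnegative since \<open>s\<close> and \<open>s'\<close> take only the values \<open>a\<close> and \<open>- 1 / a\<close>; it vanishes where they differ, so that
the two couplings become conditionally independent given the common value. The mean inner product
under the glued coupling is the product of the two original ones.\<close>

lemma two_point_correlation_supermultiplicative:
  fixes u :: "'a::euclidean_space"
  assumes u: "norm u = 1" and a: "a > 0" and C: "\<nu> \<in> centered" "\<nu>' \<in> centered"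
    and l: "on_line u \<nu>" "on_line u \<nu>'"
  shows "correlation (two_point u a) \<nu> * correlation (two_point u a) \<nu>' \<le> correlation \<nu> \<nu>'"
proof -
  let ?T = "two_point u a"
  have uu: "u \<bullet> u = 1" using u by (simp add: norm_eq_1)
  note T = two_point_centered[OF a, of u]
  note WT = centeredD(1)[OF T]
  have tilt: "integrable \<gamma> (\<lambda>z. (fst z \<bullet> u) *\<^sub>R snd z)"
      "(\<integral>z. (fst z \<bullet> u) *\<^sub>R snd z \<partial>\<gamma>) = (\<integral>z. fst z \<bullet> snd z \<partial>\<gamma>) *\<^sub>R u"
    if g: "\<gamma> \<in> couplings ?T \<nu>" and C: "\<nu> \<in> centered" and l: "on_line u \<nu>" for \<gamma> \<nu>
  proof -
    note c[measurable] = couplingsD(6,7)[OF g]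
    note ip = coupling_integrable_inner[OF WT centeredD(1)[OF C] g]
    have ae: "AE z in \<gamma>. (fst z \<bullet> u) *\<^sub>R snd z = (fst z \<bullet> snd z) *\<^sub>R u"
      using coupling_AE_fst[OF g two_point_on_line[OF u, of a, unfolded on_line_def]]
        coupling_AE_snd[OF g l[unfolded on_line_def]]
    proof eventually_elim
      fix z :: "'a \<times> 'a" assume z: "fst z = (fst z \<bullet> u) *\<^sub>R u" "snd z = (snd z \<bullet> u) *\<^sub>R u"
      have "fst z \<bullet> snd z = (fst z \<bullet> u) * (snd z \<bullet> u)"
        by (subst z(1), subst z(2)) (simp add: uu)
      moreover have "(fst z \<bullet> u) *\<^sub>R snd z = (fst z \<bullet> u) *\<^sub>R ((snd z \<bullet> u) *\<^sub>R u)" using z(2) by simp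
      ultimately show "(fst z \<bullet> u) *\<^sub>R snd z = (fst z \<bullet> snd z) *\<^sub>R u" by simp
    qed
    show "integrable \<gamma> (\<lambda>z. (fst z \<bullet> u) *\<^sub>R snd z)"
      by (rule integrable_cong_AE_imp[of _ "\<lambda>z. (fst z \<bullet> snd z) *\<^sub>R u"]) (use ip ae in auto)
    have "(\<integral>z. (fst z \<bullet> u) *\<^sub>R snd z \<partial>\<gamma>) = (\<integral>z. (fst z \<bullet> snd z) *\<^sub>R u \<partial>\<gamma>)"
      by (rule integral_cong_AE) (use ae in auto)
    then show "(\<integral>z. (fst z \<bullet> u) *\<^sub>R snd z \<partial>\<gamma>) = (\<integral>z. fst z \<bullet> snd z \<partial>\<gamma>) *\<^sub>R u"
      using ip by simp
  qed
  have prod: "(\<integral>z. fst z \<bullet> snd z \<partial>\<gamma>) * (\<integral>z. fst z \<bullet> snd z \<partial>\<gamma>') \<le> correlation \<nu> \<nu>'"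
    if g: "\<gamma> \<in> couplings ?T \<nu>" and g': "\<gamma>' \<in> couplings ?T \<nu>'" for \<gamma> \<gamma>'
  proof -
    note c = couplingsD[OF g] and c' = couplingsD[OF g']
    note W = centeredD(1)[OF C(1)] centeredD(1)[OF C(2)]
    have aep: "AE z in \<gamma>. AE z' in \<gamma>'. 0 \<le> 1 + (fst z \<bullet> u) * (fst z' \<bullet> u)"
      using coupling_AE_fst[OF g AE_two_point]
    proof eventually_elim
      fix z :: "'a \<times> 'a" assume z: "fst z = a *\<^sub>R u \<or> fst z = (- 1 / a) *\<^sub>R u"
      show "AE z' in \<gamma>'. 0 \<le> 1 + (fst z \<bullet> u) * (fst z' \<bullet> u)"
        using coupling_AE_fst[OF g' AE_two_point] by eventually_elim (use z a in \<open>auto simp: uu\<close>)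
    qed
    have "(\<integral>z. snd z \<partial>\<gamma>) \<bullet> (\<integral>z. snd z \<partial>\<gamma>') + (\<integral>z. (fst z \<bullet> u) *\<^sub>R snd z \<partial>\<gamma>) \<bullet> (\<integral>z. (fst z \<bullet> u) *\<^sub>R snd z \<partial>\<gamma>')
        \<le> correlation (distr \<gamma> borel snd) (distr \<gamma>' borel snd)"
    proof (rule correlation_ge_tilted[where ?h1.0="\<lambda>z. fst z \<bullet> u" and ?h2.0="\<lambda>z. fst z \<bullet> u"])
      show "integrable \<gamma> (\<lambda>\<omega>. (norm (snd \<omega>))\<^sup>2)" "integrable \<gamma>' (\<lambda>\<omega>. (norm (snd \<omega>))\<^sup>2)"
        using coupling_integral(3)[OF g, of "\<lambda>x. (norm x)\<^sup>2"] coupling_integral(3)[OF g', of "\<lambda>x. (norm x)\<^sup>2"]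
          wasserstein_spaceD(4)[OF W(1)] wasserstein_spaceD(4)[OF W(2)] by simp_all
      show "integrable \<gamma> (\<lambda>z. fst z \<bullet> u)" "(\<integral>z. fst z \<bullet> u \<partial>\<gamma>) = 0"
        "integrable \<gamma>' (\<lambda>z. fst z \<bullet> u)" "(\<integral>z. fst z \<bullet> u \<partial>\<gamma>') = 0"
        using coupling_integral(1,2)[OF g, of "\<lambda>x. x \<bullet> u"] coupling_integral(1,2)[OF g', of "\<lambda>x. x \<bullet> u"]
          wasserstein_spaceD(6)[OF WT, of u] centeredD(5)[OF T, of u] by (simp_all del: integral_inner_left)
    qed (use c c' tilt(1)[OF g C(1) l(1)] tilt(1)[OF g' C(2) l(2)] aep in simp_all)
    moreover have "(\<integral>z. snd z \<partial>\<gamma>) = 0"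
      using coupling_integral(4)[OF g, of "\<lambda>x. x"] centeredD(7)[OF C(1)] by simp
    ultimately show ?thesis
      by (simp add: tilt(2)[OF g C(1) l(1)] tilt(2)[OF g' C(2) l(2)] uu c(5)[symmetric] c'(5)[symmetric] mult.commute)
  qed
  define K where "K = correlation \<nu> \<nu>'"
  define c2 where "c2 = correlation ?T \<nu>'"
  have K0: "K \<ge> 0" unfolding K_def by (rule centered_correlation_nonneg[OF C])
  have c20: "c2 \<ge> 0" unfolding c2_def by (rule centered_correlation_nonneg[OF T C(2)])
  have 1: "(\<integral>z. fst z \<bullet> snd z \<partial>\<gamma>) * c2 \<le> K" if g: "\<gamma> \<in> couplings ?T \<nu>" for \<gamma>
  proof (cases "(\<integral>z. fst z \<bullet> snd z \<partial>\<gamma>) > 0")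
    case True
    have "c2 \<le> K / (\<integral>z. fst z \<bullet> snd z \<partial>\<gamma>)" unfolding c2_def
      by (rule correlation_le[OF WT centeredD(1)[OF C(2)]])
         (use prod[OF g] True in \<open>auto simp: K_def field_simps\<close>)
    then show ?thesis using True by (simp add: field_simps)
  next
    case False
    then have "(\<integral>z. fst z \<bullet> snd z \<partial>\<gamma>) * c2 \<le> 0" using c20 by (simp add: mult_nonpos_nonneg)
    then show ?thesis using K0 by simp
  qed
  show ?thesis
  proof (cases "c2 = 0")
    case True then show ?thesis using K0 by (simp add: K_def c2_def)
  next
    case False
    then have "c2 > 0" using c20 by simp
    have "correlation ?T \<nu> \<le> K / c2"
      by (rule correlation_le[OF WT centeredD(1)[OF C(1)]]) (use 1 \<open>c2 > 0\<close> in \<open>auto simp: field_simps\<close>)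
    then show ?thesis using \<open>c2 > 0\<close> by (simp add: field_simps K_def c2_def)
  qed
qed

section \<open>Extremal measures are two-point measures\<close>

text \<open>The hypothesis is applied to the recentered truncations of \<open>\<mu>\<close> to the two half-lines. Let \<open>s\<close> be the
coordinate along \<open>u\<close>, \<open>k\<close> the common mean of its positive and negative parts, \<open>Q\<close> and \<open>P\<close> their
second moments. With \<open>\<mu>\<close> the negative truncation has correlation at least \<open>P\<close> and the positive one at
least \<open>Q\<close>; with each other they have correlation at most \<open>k\<^sup>2\<close>. Hence \<open>P * Q \<le> k\<^sup>2\<close>. As \<open>P + Q = 1\<close>, this is the reverse of a Cauchy-Schwarz
inequality, and its equality case says that both parts of \<open>s\<close> are constant where they do not vanish.\<close>

lemma two_point_of_supermultiplicative:
  fixes u :: "'a::euclidean_space"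
  assumes C: "\<mu> \<in> centered" and u: "norm u = 1" and l: "on_line u \<mu>" and m1: "second_moment \<mu> = 1"
    and ext: "\<And>\<nu> \<nu>'. \<nu> \<in> centered \<Longrightarrow> \<nu>' \<in> centered \<Longrightarrow> on_line u \<nu> \<Longrightarrow> on_line u \<nu>' \<Longrightarrow>
      correlation \<mu> \<nu> * correlation \<mu> \<nu>' \<le> correlation \<nu> \<nu>'"
  shows "\<exists>a>0. \<mu> = two_point u a"
proof -
  note W = centeredD(1)[OF C]
  note m = wasserstein_spaceD[OF W]
  have [measurable_cong]: "sets \<mu> = sets borel" by (fact m)
  interpret p: prob_space \<mu> by (fact m)
  have uu: "u \<bullet> u = 1" using u by (simp add: norm_eq_1)
  define s where "s x = x \<bullet> u" for x :: 'a
  define sp where "sp x = max (s x) 0" for x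
  define sm where "sm x = max (- s x) 0" for x
  have [measurable]: "s \<in> borel_measurable borel" "sp \<in> borel_measurable borel" "sm \<in> borel_measurable borel"
    unfolding s_def sp_def sm_def by measurable
  have pm: "s x = sp x - sm x" "(s x)\<^sup>2 = (sp x)\<^sup>2 + (sm x)\<^sup>2" "sp x * sm x = 0" "sp x \<ge> 0" "sm x \<ge> 0"
    "s x * sp x = (sp x)\<^sup>2" "s x * sm x = - (sm x)\<^sup>2" for x
    by (auto simp: sp_def sm_def max_def power2_eq_square)
  have si: "integrable \<mu> s" using m(6)[of u] by (simp add: s_def[abs_def])
  have s2i: "integrable \<mu> (\<lambda>x. (s x)\<^sup>2)" using m(8)[of u] by (simp add: s_def[abs_def])
  have spi: "integrable \<mu> sp"
    by (rule Bochner_Integration.integrable_bound[OF si]) (auto simp: sp_def)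
  have smi: "integrable \<mu> sm"
    by (rule Bochner_Integration.integrable_bound[OF si]) (auto simp: sm_def)
  have sp2i: "integrable \<mu> (\<lambda>x. (sp x)\<^sup>2)"
    by (rule Bochner_Integration.integrable_bound[OF s2i]) (auto simp: pm(2))
  have sm2i: "integrable \<mu> (\<lambda>x. (sm x)\<^sup>2)"
    by (rule Bochner_Integration.integrable_bound[OF s2i]) (auto simp: pm(2))
  have Es: "(\<integral>x. s x \<partial>\<mu>) = 0" using centeredD(5)[OF C, of u] by (simp add: s_def[abs_def] del: integral_inner_left)
  have "second_moment \<mu> = (\<integral>x. (s x)\<^sup>2 \<partial>\<mu>)" unfolding second_moment_def
  proof (rule integral_cong_AE)
    show "AE x in \<mu>. (norm x)\<^sup>2 = (s x)\<^sup>2" using l[unfolded on_line_def]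
    proof eventually_elim
      fix x assume x: "x = (x \<bullet> u) *\<^sub>R u"
      have "norm x = \<bar>x \<bullet> u\<bar>" by (subst x) (simp add: u)
      then show "(norm x)\<^sup>2 = (s x)\<^sup>2" by (simp add: s_def)
    qed
  qed auto
  then have Es2: "(\<integral>x. (s x)\<^sup>2 \<partial>\<mu>) = 1" using m1 by simp
  define k where "k = (\<integral>x. sp x \<partial>\<mu>)"
  define P where "P = (\<integral>x. (sm x)\<^sup>2 \<partial>\<mu>)"
  define Q where "Q = (\<integral>x. (sp x)\<^sup>2 \<partial>\<mu>)"
  have Esm: "(\<integral>x. sm x \<partial>\<mu>) = k" using Es spi smi by (simp add: pm(1) k_def)
  have PQ: "P + Q = 1" using Es2 sp2i sm2i by (simp add: pm(2) P_def Q_def)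
  have P0: "P \<ge> 0" and Q0: "Q \<ge> 0" by (simp_all add: P_def Q_def)

  define \<nu> where "\<nu> = distr \<mu> borel (\<lambda>x. (k - sm x) *\<^sub>R u)"
  define \<nu>' where "\<nu>' = distr \<mu> borel (\<lambda>x. (sp x - k) *\<^sub>R u)"
  have i1: "integrable \<mu> (\<lambda>x. (k - sm x)\<^sup>2)" and i2: "integrable \<mu> (\<lambda>x. (sp x - k)\<^sup>2)"
    using spi smi sp2i sm2i by (simp_all add: power2_diff)
  have "prob_space \<mu>" by (fact m)
  have gen: "distr \<mu> borel (\<lambda>x. h x *\<^sub>R u) \<in> centered" "on_line u (distr \<mu> borel (\<lambda>x. h x *\<^sub>R u))"
      "(\<integral>x. s x * h x \<partial>\<mu>) \<le> correlation \<mu> (distr \<mu> borel (\<lambda>x. h x *\<^sub>R u))"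
    if [measurable]: "h \<in> borel_measurable borel" and hi: "integrable \<mu> h" "(\<integral>x. h x \<partial>\<mu>) = 0"
      and h2: "integrable \<mu> (\<lambda>x. (h x)\<^sup>2)" for h
  proof -
    have "distr \<mu> borel (\<lambda>x. h x *\<^sub>R u) \<in> wasserstein_space"
      by (rule distr_in_wasserstein_space[OF \<open>prob_space \<mu>\<close>]) (use h2 in \<open>simp_all add: u\<close>)
    moreover have "barycenter (distr \<mu> borel (\<lambda>x. h x *\<^sub>R u)) = 0"
      unfolding barycenter_def by (subst integral_distr) (use hi in auto)
    ultimately show "distr \<mu> borel (\<lambda>x. h x *\<^sub>R u) \<in> centered" by (simp add: centered_def)
    show "on_line u (distr \<mu> borel (\<lambda>x. h x *\<^sub>R u))"
      unfolding on_line_def by (subst AE_distr_iff) (auto simp: uu)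
    have "(\<integral>x. x \<bullet> (h x *\<^sub>R u) \<partial>\<mu>) \<le> correlation (distr \<mu> borel (\<lambda>x. x)) (distr \<mu> borel (\<lambda>x. h x *\<^sub>R u))"
      by (rule correlation_ge[OF \<open>prob_space \<mu>\<close>]) (use h2 m(4) in \<open>simp_all add: u\<close>)
    then show "(\<integral>x. s x * h x \<partial>\<mu>) \<le> correlation \<mu> (distr \<mu> borel (\<lambda>x. h x *\<^sub>R u))"
      using m(2) by (simp add: distr_borel_id s_def mult.commute)
  qed
  have e1: "(\<integral>x. k - sm x \<partial>\<mu>) = 0" and e2: "(\<integral>x. sp x - k \<partial>\<mu>) = 0"
    using spi smi Esm p.prob_space by (simp_all add: k_def)
  note g1 = gen[of "\<lambda>x. k - sm x", folded \<nu>_def] and g2 = gen[of "\<lambda>x. sp x - k", folded \<nu>'_def]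
  have N: "\<nu> \<in> centered" "on_line u \<nu>" "(\<integral>x. s x * (k - sm x) \<partial>\<mu>) \<le> correlation \<mu> \<nu>"
    using g1 smi e1 i1 by auto
  have N': "\<nu>' \<in> centered" "on_line u \<nu>'" "(\<integral>x. s x * (sp x - k) \<partial>\<mu>) \<le> correlation \<mu> \<nu>'"
    using g2 spi e2 i2 by auto
  have "(\<integral>x. s x * (k - sm x) \<partial>\<mu>) = (\<integral>x. k * s x + (sm x)\<^sup>2 \<partial>\<mu>)"
    by (rule Bochner_Integration.integral_cong) (auto simp: right_diff_distrib pm(7) mult.commute)
  also have "\<dots> = P" using si sm2i Es by (simp add: P_def)
  finally have cP: "P \<le> correlation \<mu> \<nu>" using N by simp
  have "(\<integral>x. s x * (sp x - k) \<partial>\<mu>) = (\<integral>x. (sp x)\<^sup>2 - k * s x \<partial>\<mu>)"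
    by (rule Bochner_Integration.integral_cong) (auto simp: right_diff_distrib pm(6) mult.commute)
  also have "\<dots> = Q" using si sp2i Es by (simp add: Q_def)
  finally have cQ: "Q \<le> correlation \<mu> \<nu>'" using N' by simp

  have "correlation \<nu> \<nu>' \<le> k\<^sup>2"
  proof (rule correlation_le[OF centeredD(1)[OF N(1)] centeredD(1)[OF N'(1)]])
    fix \<gamma> assume g: "\<gamma> \<in> couplings \<nu> \<nu>'"
    interpret g: prob_space \<gamma> using couplingsD[OF g] by simp
    have u1: "AE y in \<nu>. y \<bullet> u \<le> k" unfolding \<nu>_def by (subst AE_distr_iff) (auto simp: uu pm)
    have u2: "AE y in \<nu>'. - k \<le> y \<bullet> u" unfolding \<nu>'_def by (subst AE_distr_iff) (auto simp: uu pm)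
    have gi: "integrable \<gamma> (\<lambda>z. fst z \<bullet> u)" "(\<integral>z. fst z \<bullet> u \<partial>\<gamma>) = 0"
      "integrable \<gamma> (\<lambda>z. snd z \<bullet> u)" "(\<integral>z. snd z \<bullet> u \<partial>\<gamma>) = 0"
      using coupling_integral[OF g, of "\<lambda>x. x \<bullet> u"] wasserstein_spaceD(6)[OF centeredD(1)[OF N(1)], of u]
        wasserstein_spaceD(6)[OF centeredD(1)[OF N'(1)], of u] centeredD(5)[OF N(1), of u] centeredD(5)[OF N'(1), of u]
      by (simp_all del: integral_inner_left)
    have "(\<integral>z. fst z \<bullet> snd z \<partial>\<gamma>) \<le> (\<integral>z. k * (snd z \<bullet> u) - k * (fst z \<bullet> u) + k\<^sup>2 \<partial>\<gamma>)"
    proof (rule integral_mono_AE)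
      show "integrable \<gamma> (\<lambda>z. fst z \<bullet> snd z)"
        by (rule coupling_integrable_inner[OF centeredD(1)[OF N(1)] centeredD(1)[OF N'(1)] g])
      show "integrable \<gamma> (\<lambda>z. k * (snd z \<bullet> u) - k * (fst z \<bullet> u) + k\<^sup>2)" using gi by simp
      show "AE z in \<gamma>. fst z \<bullet> snd z \<le> k * (snd z \<bullet> u) - k * (fst z \<bullet> u) + k\<^sup>2"
        using coupling_AE_fst[OF g N(2)[unfolded on_line_def]] coupling_AE_snd[OF g N'(2)[unfolded on_line_def]]
          coupling_AE_fst[OF g u1] coupling_AE_snd[OF g u2]
      proof eventually_elim
        fix z :: "'a \<times> 'a"
        assume z: "fst z = (fst z \<bullet> u) *\<^sub>R u" "snd z = (snd z \<bullet> u) *\<^sub>R u" "fst z \<bullet> u \<le> k" "- k \<le> snd z \<bullet> u"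
        have e: "fst z \<bullet> snd z = (fst z \<bullet> u) * (snd z \<bullet> u)"
          by (subst z(1), subst z(2)) (simp add: uu)
        have "(fst z \<bullet> u - k) * (snd z \<bullet> u + k) \<le> 0" using z by (intro mult_nonpos_nonneg) auto
        then show "fst z \<bullet> snd z \<le> k * (snd z \<bullet> u) - k * (fst z \<bullet> u) + k\<^sup>2"
          unfolding e by (simp add: algebra_simps power2_eq_square)
      qed
    qed
    also have "\<dots> = k\<^sup>2" using gi g.prob_space by (simp del: integral_inner_left)
    finally show "(\<integral>z. fst z \<bullet> snd z \<partial>\<gamma>) \<le> k\<^sup>2" .
  qed
  moreover have "P * Q \<le> correlation \<mu> \<nu> * correlation \<mu> \<nu>'"
    using cP cQ P0 Q0 by (intro mult_mono) auto
  ultimately have PQk: "P * Q \<le> k\<^sup>2" using ext[OF N(1) N'(1) N(2) N'(2)] by linarith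
  have k0: "k \<ge> 0" unfolding k_def by (rule integral_nonneg_AE) (auto simp: pm)
  have zero: "Q = 0 \<longleftrightarrow> k = 0" "P = 0 \<longleftrightarrow> k = 0"
  proof -
    have "Q = 0 \<longleftrightarrow> (AE x in \<mu>. (sp x)\<^sup>2 = 0)" unfolding Q_def
      using sp2i by (subst integral_nonneg_eq_0_iff_AE) auto
    moreover have "k = 0 \<longleftrightarrow> (AE x in \<mu>. sp x = 0)" unfolding k_def
      using spi by (subst integral_nonneg_eq_0_iff_AE) (auto simp: pm)
    ultimately show "Q = 0 \<longleftrightarrow> k = 0" by simp
    have "P = 0 \<longleftrightarrow> (AE x in \<mu>. (sm x)\<^sup>2 = 0)" unfolding P_def
      using sm2i by (subst integral_nonneg_eq_0_iff_AE) auto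
    moreover have "k = 0 \<longleftrightarrow> (AE x in \<mu>. sm x = 0)" unfolding Esm[symmetric]
      using smi by (subst integral_nonneg_eq_0_iff_AE) (auto simp: pm)
    ultimately show "P = 0 \<longleftrightarrow> k = 0" by simp
  qed
  have kpos: "k > 0" and Ppos: "P > 0" and Qpos: "Q > 0" using zero PQ k0 P0 Q0 by force+

  \<comment> \<open>the combination of the two parts of \<open>s\<close> that equals one if \<open>s\<close> takes only the values \<open>Q / k\<close> and \<open>- P / k\<close>\<close>
  define z where "z x = sp x * (k / Q) + sm x * (k / P)" for x
  have [measurable]: "z \<in> borel_measurable borel" unfolding z_def by measurable
  have z2: "(z x - 1)\<^sup>2 = (k / Q)\<^sup>2 * (sp x)\<^sup>2 + (k / P)\<^sup>2 * (sm x)\<^sup>2 - 2 * (k / Q) * sp x - 2 * (k / P) * sm x + 1" for x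
  proof -
    have "(z x - 1)\<^sup>2 = (k / Q)\<^sup>2 * (sp x)\<^sup>2 + (k / P)\<^sup>2 * (sm x)\<^sup>2 + 2 * (k / Q) * (k / P) * (sp x * sm x)
        - 2 * (k / Q) * sp x - 2 * (k / P) * sm x + 1"
      unfolding z_def by (simp add: power2_eq_square algebra_simps)
    then show ?thesis by (simp add: pm(3))
  qed
  have zi: "integrable \<mu> (\<lambda>x. (z x - 1)\<^sup>2)" unfolding z2 using sp2i sm2i spi smi by simp
  have "(\<integral>x. (z x - 1)\<^sup>2 \<partial>\<mu>) = (k / Q)\<^sup>2 * Q + (k / P)\<^sup>2 * P - 2 * (k / Q) * k - 2 * (k / P) * k + 1"
    unfolding z2 using sp2i sm2i spi smi Esm p.prob_space by (simp add: P_def Q_def k_def)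
  also have "\<dots> = 1 - k\<^sup>2 / (P * Q)"
  proof -
    have "(k / Q)\<^sup>2 * Q = k\<^sup>2 / Q" "(k / P)\<^sup>2 * P = k\<^sup>2 / P" using Ppos Qpos by (simp_all add: power2_eq_square)
    moreover have e: "2 * (k / Q) * k = 2 * (k\<^sup>2 / Q)" "2 * (k / P) * k = 2 * (k\<^sup>2 / P)" by (simp_all add: power2_eq_square)
    moreover have "k\<^sup>2 / (P * Q) = k\<^sup>2 / Q + k\<^sup>2 / P"
    proof -
      have "k\<^sup>2 / Q + k\<^sup>2 / P = k\<^sup>2 * (P + Q) / (P * Q)" using Ppos Qpos by (simp add: field_simps)
      then show ?thesis by (simp add: PQ)
    qed
    ultimately show ?thesis unfolding e by linarith
  qed
  finally have zE: "(\<integral>x. (z x - 1)\<^sup>2 \<partial>\<mu>) = 1 - k\<^sup>2 / (P * Q)" .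
  have PQpos: "P * Q > 0" using Ppos Qpos by simp
  have "k\<^sup>2 / (P * Q) \<ge> 1" using PQk PQpos by simp
  moreover have "(\<integral>x. (z x - 1)\<^sup>2 \<partial>\<mu>) \<ge> 0" by simp
  ultimately have z0: "(\<integral>x. (z x - 1)\<^sup>2 \<partial>\<mu>) = 0" and "k\<^sup>2 / (P * Q) = 1" using zE by linarith+
  then have kPQ: "k\<^sup>2 = P * Q" using PQpos by simp
  have "AE x in \<mu>. (z x - 1)\<^sup>2 = 0" using z0 zi by (subst (asm) integral_nonneg_eq_0_iff_AE) auto
  then have z1: "AE x in \<mu>. z x = 1" by eventually_elim simp
  define a where "a = Q / k"
  have a: "a > 0" using Qpos kpos by (simp add: a_def)
  have "AE x in \<mu>. x = a *\<^sub>R u \<or> x = (- 1 / a) *\<^sub>R u"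
    using z1 l[unfolded on_line_def]
  proof eventually_elim
    fix x assume zx: "z x = 1" and x: "x = (x \<bullet> u) *\<^sub>R u"
    have "s x = a \<or> s x = - 1 / a"
    proof (cases "s x \<ge> 0")
      case True
      then have "z x = s x * (k / Q)" by (simp add: z_def sp_def sm_def)
      then have "s x * k = Q" using zx Qpos by (simp add: divide_eq_eq)
      then have "s x = a" using kpos by (simp add: a_def eq_divide_eq)
      then show ?thesis ..
    next
      case False
      then have "z x = - s x * (k / P)" by (simp add: z_def sp_def sm_def)
      then have "(- s x * k) / P = 1" using zx by simp
      then have "- s x * k = P" using Ppos by (simp only: divide_eq_eq split: if_splits)
      then have "P / k = (- s x * k) / k" by (simp only:)
      also have "\<dots> = - s x" using kpos by simp
      finally have "s x = - (P / k)" by simp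
      moreover have "P / k = 1 / a" using kPQ kpos Qpos by (simp add: a_def field_simps power2_eq_square)
      ultimately show ?thesis by simp
    qed
    then show "x = a *\<^sub>R u \<or> x = (- 1 / a) *\<^sub>R u" using x by (metis s_def)
  qed
  then have "\<mu> = two_point u a" by (rule two_point_eqI[OF C u a])
  with a show ?thesis by blast
qed

lemma extremal_unit_iff:
  fixes \<mu> :: "'a::euclidean_space measure"
  assumes C: "\<mu> \<in> centered"
  shows "extremal \<mu> \<and> second_moment \<mu> = 1 \<longleftrightarrow> (\<exists>u a. norm u = 1 \<and> a > 0 \<and> \<mu> = two_point u a)"
proof
  assume e: "extremal \<mu> \<and> second_moment \<mu> = 1"
  then have "minimal_span \<mu>" by (simp add: extremal_def)
  then obtain u where m0: "second_moment \<mu> \<noteq> 0" and u: "norm u = 1" and l: "on_line u \<mu>"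
    using minimal_span_iff[OF C] by blast
  have "\<exists>a>0. \<mu> = two_point u a"
  proof (rule two_point_of_supermultiplicative[OF C u l])
    fix \<nu> \<nu>' :: "'a measure"
    assume "\<nu> \<in> centered" "\<nu>' \<in> centered" "on_line u \<nu>" "on_line u \<nu>'"
    then show "correlation \<mu> \<nu> * correlation \<mu> \<nu>' \<le> correlation \<nu> \<nu>'"
      using e span_le_on_line_iff[OF C _ u l m0] by (auto simp: extremal_def)
  qed (use e in simp)
  then show "\<exists>u a. norm u = 1 \<and> a > 0 \<and> \<mu> = two_point u a" using u by blast
next
  assume "\<exists>u a. norm u = 1 \<and> a > 0 \<and> \<mu> = two_point u a"
  then obtain u a where u: "norm u = 1" and a: "a > 0" and \<mu>: "\<mu> = two_point u a" by blast
  have l: "on_line u \<mu>" unfolding \<mu> by (rule two_point_on_line[OF u])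
  have m1: "second_moment \<mu> = 1" unfolding \<mu> by (rule two_point_second_moment[OF u a])
  have "minimal_span \<mu>" using minimal_span_iff[OF C] l u m1 by auto
  moreover have "correlation \<mu> \<nu> * correlation \<mu> \<nu>' \<le> correlation \<nu> \<nu>'"
    if "\<nu> \<in> centered" "\<nu>' \<in> centered" "span_le \<nu> \<mu>" "span_le \<nu>' \<mu>" for \<nu> \<nu>'
    unfolding \<mu> using that span_le_on_line_iff[OF C _ u l] m1
    by (intro two_point_correlation_supermultiplicative[OF u a]) auto
  ultimately show "extremal \<mu> \<and> second_moment \<mu> = 1" using m1 by (auto simp: extremal_def)
qed

section \<open>Rigidity on two-point measures\<close>

text \<open>Unit vectors that are not antipodal both have positive inner product with their normalised sum;
antipodal ones are connected through a vector orthogonal to them.\<close>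

lemma eq_on_sphere_of_locally_constant:
  fixes f :: "'a::euclidean_space \<Rightarrow> 'b"
  assumes dim: "DIM('a) \<ge> 2"
    and f: "\<And>u v. norm u = 1 \<Longrightarrow> norm v = 1 \<Longrightarrow> u \<bullet> v > 0 \<Longrightarrow> f u = f v"
    and u: "norm u = 1" and v: "norm v = 1"
  shows "f u = f v"
proof -
  have *: "f u = f v" if u: "norm u = 1" and v: "norm v = 1" and ne: "v \<noteq> - u" for u v
  proof -
    have uu: "u \<bullet> u = 1" "v \<bullet> v = 1" using u v by (simp_all add: norm_eq_1)
    have "u + v \<noteq> 0" using ne by (metis add_eq_0_iff)
    then have "(u + v) \<bullet> (u + v) > 0" by simp
    then have c: "1 + u \<bullet> v > 0" by (simp add: inner_add_left inner_add_right uu inner_commute)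
    define w where "w = (1 / norm (u + v)) *\<^sub>R (u + v)"
    have w: "norm w = 1" using \<open>u + v \<noteq> 0\<close> by (simp add: w_def)
    have "u \<bullet> w > 0" "w \<bullet> v > 0"
      using c \<open>u + v \<noteq> 0\<close> by (simp_all add: w_def inner_add_left inner_add_right uu inner_commute add.commute)
    then show ?thesis using f[OF u w] f[OF w v] by simp
  qed
  show ?thesis
  proof (cases "v = - u")
    case False then show ?thesis using *[OF u v] by simp
  next
    case True
    obtain y where y: "y \<noteq> 0" "orthogonal u y" using orthogonal_to_vector_exists[OF dim, of u] by blast
    define e where "e = (1 / norm y) *\<^sub>R y"
    have e: "norm e = 1" and ue: "u \<bullet> e = 0" using y by (simp_all add: e_def orthogonal_def)
    have "e \<noteq> - u" "v \<noteq> - e" using ue u True by (auto simp: norm_eq_1)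
    then show ?thesis using *[OF u e] *[OF e v] by simp
  qed
qed

lemma AE_two_point_iff:
  assumes a: "a > 0" and [measurable]: "Measurable.pred borel P"
  shows "(AE x in two_point u a. P x) \<longleftrightarrow> P (a *\<^sub>R u) \<and> P ((- 1 / a) *\<^sub>R u)"
proof -
  have p: "1 / (1 + a\<^sup>2) > 0" "1 / (1 + a\<^sup>2) < 1" using a by (simp_all add: add_pos_pos)
  have "set_pmf (bernoulli_pmf (1 / (1 + a\<^sup>2))) = UNIV" using p by (rule set_pmf_bernoulli)
  then show ?thesis unfolding two_point_def
    by (subst AE_distr_iff) (auto simp: AE_measure_pmf_iff)
qed

lemma two_point_on_line_iff:
  fixes u v :: "'a::euclidean_space"
  assumes u: "norm u = 1" and v: "norm v = 1" and a: "a > 0"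
  shows "on_line v (two_point u a) \<longleftrightarrow> u = v \<or> u = - v"
proof
  assume "on_line v (two_point u a)"
  moreover have "(AE x in two_point u a. x = (x \<bullet> v) *\<^sub>R v) \<longleftrightarrow> a *\<^sub>R u = ((a *\<^sub>R u) \<bullet> v) *\<^sub>R v \<and>
      (- 1 / a) *\<^sub>R u = (((- 1 / a) *\<^sub>R u) \<bullet> v) *\<^sub>R v"
    by (rule AE_two_point_iff[OF a]) measurable
  ultimately have "a *\<^sub>R u = ((a *\<^sub>R u) \<bullet> v) *\<^sub>R v" unfolding on_line_def by blast
  then have "a *\<^sub>R u = a *\<^sub>R ((u \<bullet> v) *\<^sub>R v)" by simp
  then have e: "u = (u \<bullet> v) *\<^sub>R v" using a by (simp only: scaleR_cancel_left) auto
  then have "\<bar>u \<bullet> v\<bar> = 1" using u v by (metis norm_scaleR mult.right_neutral)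
  then have "u \<bullet> v = 1 \<or> u \<bullet> v = -1" by linarith
  then show "u = v \<or> u = - v" using e by (metis scaleR_minus_left scaleR_one)
next
  assume "u = v \<or> u = - v"
  then show "on_line v (two_point u a)"
    using two_point_on_line[OF u, of a] on_line_uminus[of v] by auto
qed

text \<open>In terms of \<open>ln a\<close> and \<open>ln b\<close> the factor \<open>similarity (a / b)\<close> in the correlation of two-point
measures on one line is \<open>exp (- \<bar>ln a - ln b\<bar>)\<close>, a decreasing function of a distance.\<close>

definition similarity :: "real \<Rightarrow> real" where
  "similarity x = min x (1 / x)"

lemma similarity_le_1: "x > 0 \<Longrightarrow> similarity x \<le> 1"
  by (cases "x \<le> 1") (simp_all add: similarity_def min_le_iff_disj)

lemma similarity_1 [simp]: "similarity 1 = 1"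
  by (simp add: similarity_def)

lemma similarity_eq_1: "x > 0 \<Longrightarrow> similarity x = 1 \<Longrightarrow> x = 1"
  by (simp add: similarity_def min_def split: if_splits)

definition match :: "real \<Rightarrow> real \<Rightarrow> real \<Rightarrow> real" where
  "match c a b = \<bar>c\<bar> * similarity (if c \<ge> 0 then a / b else a * b)"

lemma two_point_correlation_match:
  fixes u v :: "'a::euclidean_space"
  assumes u: "norm u = 1" and v: "norm v = 1" and a: "a > 0" and b: "b > 0"
  shows "correlation (two_point u a) (two_point v b) = match (u \<bullet> v) a b"
proof (cases "u \<bullet> v \<ge> 0")
  case True
  then show ?thesis using two_point_correlation[OF u v a b] by (simp add: match_def similarity_def)
next
  case False
  have e: "two_point v b = two_point (- v) (1 / b)" using two_point_uminus[OF b, of "- v"] by simp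
  have "correlation (two_point u a) (two_point (- v) (1 / b)) = (u \<bullet> (- v)) * min (a / (1 / b)) ((1 / b) / a)"
    using False v b by (intro two_point_correlation[OF u _ a]) simp_all
  then show ?thesis unfolding e using False by (simp add: match_def similarity_def mult.commute)
qed

lemma match_le:
  assumes "a > 0" "b > 0" shows "match c a b \<le> \<bar>c\<bar>"
proof -
  have "\<bar>c\<bar> * similarity (if c \<ge> 0 then a / b else a * b) \<le> \<bar>c\<bar> * 1"
    using assms by (intro mult_left_mono similarity_le_1) auto
  then show ?thesis by (simp add: match_def)
qed

lemma match_1: "match c 1 1 = \<bar>c\<bar>"
  by (simp add: match_def)

lemma match_refl: "c > 0 \<Longrightarrow> a > 0 \<Longrightarrow> match c a a = c"
  by (simp add: match_def)

text \<open>The best match of \<open>two_point u a\<close> on the line of \<open>v\<close> is \<open>two_point v a\<close> if \<open>u \<bullet> v\<close> is positive and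
\<open>two_point v (1 / a)\<close>, which is \<open>two_point (- v) a\<close>, if it is negative.\<close>

lemma match_maximal:
  assumes "a > 0" "b > 0" "c \<noteq> 0" "match c a b = \<bar>c\<bar>"
  shows "if c > 0 then a = b else a * b = 1"
proof -
  have "similarity (if c \<ge> 0 then a / b else a * b) = 1" using assms by (simp add: match_def)
  then have "(if c \<ge> 0 then a / b else a * b) = 1"
    by (rule similarity_eq_1[rotated]) (use assms in simp)
  then show ?thesis using assms by (simp split: if_splits)
qed

lemma two_point_inject:
  fixes u v :: "'a::euclidean_space"
  assumes u: "norm u = 1" and v: "norm v = 1" and a: "a > 0" and b: "b > 0"
    and e: "two_point u a = two_point v b"
  shows "u = v \<and> a = b \<or> u = - v \<and> a * b = 1"
proof -
  have uu: "u \<bullet> u = 1" "v \<bullet> v = 1" using u v by (simp_all add: norm_eq_1)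
  have "match (u \<bullet> v) a b = 1"
    using two_point_correlation_match[OF u v a b] two_point_correlation_match[OF u u a a] match_refl[of 1 a] a
    by (simp add: e uu)
  have "on_line v (two_point u a)" unfolding e by (rule two_point_on_line[OF v])
  then consider "u = v" | "u = - v" using two_point_on_line_iff[OF u v a] by blast
  then show ?thesis
  proof cases
    case 1
    then have "match 1 a b = \<bar>1\<bar>" using \<open>match (u \<bullet> v) a b = 1\<close> uu by simp
    then show ?thesis using match_maximal[OF a b, of 1] 1 by simp
  next
    case 2
    then have "match (- 1) a b = \<bar>- 1\<bar>" using \<open>match (u \<bullet> v) a b = 1\<close> uu by simp
    then show ?thesis using match_maximal[OF a b, of "- 1"] 2 by simp
  qed
qed

lemma unit_neq_uminus:
  fixes u :: "'a::real_inner"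
  assumes "norm u = 1" shows "u \<noteq> - u"
proof
  assume "u = - u"
  then have "u \<bullet> u = - (u \<bullet> u)" by (metis inner_minus_left)
  then show False using assms by (simp add: norm_eq_1)
qed

text \<open>What an isometry fixing all Dirac masses induces on centered measures.\<close>

locale centered_isometry =
  fixes \<Psi> :: "'a::euclidean_space measure \<Rightarrow> 'a measure"
  assumes bij: "bij_betw \<Psi> centered centered"
    and corr: "\<And>\<mu> \<nu>. \<mu> \<in> centered \<Longrightarrow> \<nu> \<in> centered \<Longrightarrow> correlation (\<Psi> \<mu>) (\<Psi> \<nu>) = correlation \<mu> \<nu>"
    and moment: "\<And>\<mu>. \<mu> \<in> centered \<Longrightarrow> second_moment (\<Psi> \<mu>) = second_moment \<mu>"
begin

lemma mem: "\<mu> \<in> centered \<Longrightarrow> \<Psi> \<mu> \<in> centered"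
  using bij by (auto simp: bij_betw_def)

lemma inj: "\<mu> \<in> centered \<Longrightarrow> \<nu> \<in> centered \<Longrightarrow> \<Psi> \<mu> = \<Psi> \<nu> \<Longrightarrow> \<mu> = \<nu>"
  using bij by (auto simp: bij_betw_def inj_on_def)

lemma ball_centered: "(\<forall>\<nu>\<in>centered. P \<nu>) \<longleftrightarrow> (\<forall>\<nu>\<in>centered. P (\<Psi> \<nu>))"
  using bij_betw_imp_surj_on[OF bij] by (metis (no_types, lifting) imageE imageI)

lemma span_le_image:
  "\<mu> \<in> centered \<Longrightarrow> \<mu>' \<in> centered \<Longrightarrow> span_le (\<Psi> \<mu>') (\<Psi> \<mu>) \<longleftrightarrow> span_le \<mu>' \<mu>"
  unfolding span_le_def by (subst ball_centered) (simp add: corr)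

lemma extremal_image:
  assumes "\<mu> \<in> centered" shows "extremal (\<Psi> \<mu>) \<longleftrightarrow> extremal \<mu>"
proof -
  have "minimal_span (\<Psi> \<mu>) \<longleftrightarrow> minimal_span \<mu>"
    unfolding minimal_span_def using assms
    by (subst ball_centered) (simp add: moment span_le_image)
  moreover have "(\<forall>\<nu>\<in>centered. \<forall>\<nu>'\<in>centered. span_le \<nu> (\<Psi> \<mu>) \<longrightarrow> span_le \<nu>' (\<Psi> \<mu>) \<longrightarrow>
        correlation (\<Psi> \<mu>) \<nu> * correlation (\<Psi> \<mu>) \<nu>' \<le> correlation \<nu> \<nu>') \<longleftrightarrow>
      (\<forall>\<nu>\<in>centered. \<forall>\<nu>'\<in>centered. span_le \<nu> \<mu> \<longrightarrow> span_le \<nu>' \<mu> \<longrightarrow>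
        correlation \<mu> \<nu> * correlation \<mu> \<nu>' \<le> correlation \<nu> \<nu>')"
    by (subst ball_centered, subst (2) ball_centered) (simp add: assms corr span_le_image)
  ultimately show ?thesis by (simp add: extremal_def)
qed

lemma two_point_image:
  assumes "norm u = 1" "a > 0"
  shows "\<exists>v b. norm v = 1 \<and> b > 0 \<and> \<Psi> (two_point u a) = two_point v b"
proof -
  note C = two_point_centered[OF assms(2), of u]
  have "extremal (two_point u a) \<and> second_moment (two_point u a) = 1"
    using extremal_unit_iff[OF C] assms by blast
  then have "extremal (\<Psi> (two_point u a)) \<and> second_moment (\<Psi> (two_point u a)) = 1"
    using extremal_image[OF C] moment[OF C] by simp
  then show ?thesis using extremal_unit_iff[OF mem[OF C]] by blast
qed

lemma two_point_preimage:
  assumes "norm v = 1" "b > 0"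
  shows "\<exists>u a. norm u = 1 \<and> a > 0 \<and> \<Psi> (two_point u a) = two_point v b"
proof -
  note C = two_point_centered[OF assms(2), of v]
  obtain \<mu> where M: "\<mu> \<in> centered" "\<Psi> \<mu> = two_point v b"
    using C bij_betw_imp_surj_on[OF bij] by (metis imageE)
  have "extremal (two_point v b) \<and> second_moment (two_point v b) = 1"
    using extremal_unit_iff[OF C] assms by blast
  then have "extremal \<mu> \<and> second_moment \<mu> = 1"
    using extremal_image[OF M(1)] moment[OF M(1)] M(2) by simp
  then show ?thesis using extremal_unit_iff[OF M(1)] M(2) by metis
qed

lemma same_line_image:
  assumes u: "norm u = 1" and u': "norm u' = 1" and v: "norm v = 1" and v': "norm v' = 1"
    and pos: "a > 0" "a' > 0" "b > 0" "b' > 0"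
    and I: "\<Psi> (two_point u a) = two_point v b" and I': "\<Psi> (two_point u' a') = two_point v' b'"
  shows "u' = u \<or> u' = - u \<longleftrightarrow> v' = v \<or> v' = - v"
proof -
  note C = two_point_centered[OF pos(1), of u] and C' = two_point_centered[OF pos(2), of u']
  note D = two_point_centered[OF pos(3), of v] and D' = two_point_centered[OF pos(4), of v']
  have "span_le (two_point u' a') (two_point u a) \<longleftrightarrow> span_le (two_point v' b') (two_point v b)"
    using span_le_image[OF C C'] I I' by simp
  then show ?thesis
    using span_le_on_line_iff[OF C C' u two_point_on_line[OF u]] two_point_second_moment[OF u pos(1)]
      span_le_on_line_iff[OF D D' v two_point_on_line[OF v]] two_point_second_moment[OF v pos(3)]
      two_point_on_line_iff[OF u' u pos(2)] two_point_on_line_iff[OF v' v pos(4)] by simp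
qed

text \<open>Since \<open>(v, b)\<close> and \<open>(- v, 1 / b)\<close> describe the same measure, the direction of the image line can be
chosen such that the image of \<open>two_point u 2\<close> has a parameter at least one. This makes the choice
coherent over the sphere once the parameter is known to be different from one.\<close>

lemma ex_direction:
  assumes u: "norm u = 1"
  shows "\<exists>v. norm v = 1 \<and> (\<exists>b\<ge>1. \<Psi> (two_point u 2) = two_point v b) \<and>
    (\<forall>a>0. \<exists>b>0. \<Psi> (two_point u a) = two_point v b)"
proof -
  obtain w c where w: "norm w = 1" "c > 0" "\<Psi> (two_point u 2) = two_point w c"
    using two_point_image[OF u, of 2] by auto
  have flip: "two_point w c = two_point (- w) (1 / c)" using two_point_uminus[of c "- w"] w by simp
  have "\<exists>v b. norm v = 1 \<and> b \<ge> 1 \<and> \<Psi> (two_point u 2) = two_point v b"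
  proof (cases "c \<ge> 1")
    case False
    then have "1 / c \<ge> 1" using w by simp
    then show ?thesis using w flip by (metis norm_minus_cancel)
  qed (use w in blast)
  then obtain v b where v: "norm v = 1" "b \<ge> 1" "\<Psi> (two_point u 2) = two_point v b" by blast
  have "\<exists>b>0. \<Psi> (two_point u a) = two_point v b" if a: "a > 0" for a
  proof -
    obtain w c where w: "norm w = 1" "c > 0" "\<Psi> (two_point u a) = two_point w c"
      using two_point_image[OF u a] by auto
    have "w = v \<or> w = - v"
      using same_line_image[OF u u v(1) w(1) _ a _ w(2) v(3) w(3)] v(2) by simp
    then show ?thesis using w two_point_uminus[OF w(2), of v] by (metis divide_pos_pos zero_less_one)
  qed
  then show ?thesis using v by blast
qed

text \<open>Write the image of \<open>two_point u a\<close> as \<open>two_point (g u) (\<tau> u a)\<close> with the direction \<open>g u\<close> chosen as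
above. Maximal correlations between lines give \<open>\<bar>u \<bullet> v\<bar> = \<bar>g u \<bullet> g v\<bar>\<close>, and best matches
show that \<open>\<tau> u\<close> and \<open>\<tau> v\<close> agree for \<open>u \<bullet> v > 0\<close>, hence for all unit vectors. Since
\<open>g (- u) = - g u\<close>, the common function \<open>\<tau>\<close> commutes with \<open>a \<mapsto> 1 / a\<close> and
fixes \<open>1\<close>. It also preserves the distance of logarithms, so it is the identity or the inversion, and
\<open>\<tau> 2 > 1\<close> decides.\<close>

theorem two_point_rigidity:
  assumes dim: "DIM('a) \<ge> 2"
  shows "\<exists>\<phi>. orthogonal_transformation \<phi> \<and>
    (\<forall>u a. norm u = 1 \<longrightarrow> a > 0 \<longrightarrow> \<Psi> (two_point u a) = two_point (\<phi> u) a)"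
proof -
  have "\<exists>g. \<forall>u. norm u = 1 \<longrightarrow> norm (g u) = 1 \<and> (\<exists>b\<ge>1. \<Psi> (two_point u 2) = two_point (g u) b) \<and>
    (\<forall>a>0. \<exists>b>0. \<Psi> (two_point u a) = two_point (g u) b)"
    using ex_direction by (intro choice) blast
  then obtain g where g: "\<And>u. norm u = 1 \<Longrightarrow> norm (g u) = 1"
    and g2: "\<And>u. norm u = 1 \<Longrightarrow> \<exists>b\<ge>1. \<Psi> (two_point u 2) = two_point (g u) b"
    and ga: "\<And>u a. norm u = 1 \<Longrightarrow> a > 0 \<Longrightarrow> \<exists>b>0. \<Psi> (two_point u a) = two_point (g u) b" by blast
  define \<tau> where "\<tau> u a = (SOME b. b > 0 \<and> \<Psi> (two_point u a) = two_point (g u) b)" for u a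
  have t: "\<tau> u a > 0" "\<Psi> (two_point u a) = two_point (g u) (\<tau> u a)" if "norm u = 1" "a > 0" for u a
    using someI_ex[of "\<lambda>b. b > 0 \<and> \<Psi> (two_point u a) = two_point (g u) b"] ga[OF that]
    unfolding \<tau>_def by blast+
  have uniq: "a = b" if "two_point u a = two_point u b" "norm u = 1" "a > 0" "b > 0" for u :: 'a and a b
    using two_point_inject[OF that(2,2,3,4,1)] unit_neq_uminus[OF that(2)] by blast
  have t2: "\<tau> u 2 \<ge> 1" if u: "norm u = 1" for u
  proof -
    obtain b where "b \<ge> 1" "\<Psi> (two_point u 2) = two_point (g u) b" using g2[OF u] by blast
    then show ?thesis using uniq[of "g u" "\<tau> u 2" b] t[OF u, of 2] g[OF u] by simp
  qed
  have surj: "\<exists>a>0. \<tau> u a = b" if u: "norm u = 1" and b: "b > 0" for u b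
  proof -
    obtain u' a' where u': "norm u' = 1" "a' > 0" "\<Psi> (two_point u' a') = two_point (g u) b"
      using two_point_preimage[OF g[OF u] b] by blast
    have "u' = u \<or> u' = - u"
      using same_line_image[OF u u'(1) g[OF u] g[OF u] _ u'(2) _ b t(2)[OF u] u'(3), of 1] t(1)[OF u, of 1] by simp
    then obtain a where a: "a > 0" "\<Psi> (two_point u a) = two_point (g u) b"
      using u' two_point_uminus[OF u'(2), of u] by (metis divide_pos_pos zero_less_one)
    then show ?thesis using uniq[of "g u" "\<tau> u a" b] t[OF u a(1)] g[OF u] b by auto
  qed
  have match: "match (u \<bullet> v) a b = match (g u \<bullet> g v) (\<tau> u a) (\<tau> v b)"
    if "norm u = 1" "norm v = 1" "a > 0" "b > 0" for u v a b
    using two_point_correlation_match[OF that]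
      two_point_correlation_match[OF g[OF that(1)] g[OF that(2)] t(1)[OF that(1,3)] t(1)[OF that(2,4)]]
      corr[OF two_point_centered[OF that(3), of u] two_point_centered[OF that(4), of v]]
      t(2)[OF that(1,3)] t(2)[OF that(2,4)] by simp
  have angle: "\<bar>u \<bullet> v\<bar> = \<bar>g u \<bullet> g v\<bar>" if u: "norm u = 1" and v: "norm v = 1" for u v
  proof (rule antisym)
    show "\<bar>u \<bullet> v\<bar> \<le> \<bar>g u \<bullet> g v\<bar>"
      using match[OF u v, of 1 1] match_le[OF t(1)[OF u, of 1] t(1)[OF v, of 1]] by (simp add: match_1)
    obtain a b where "a > 0" "\<tau> u a = 1" "b > 0" "\<tau> v b = 1" using surj[OF u, of 1] surj[OF v, of 1] by auto
    then show "\<bar>g u \<bullet> g v\<bar> \<le> \<bar>u \<bullet> v\<bar>"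
      using match[OF u v, of a b] match_le[of a b "u \<bullet> v"] by (simp add: match_1)
  qed
  have matched: "if g u \<bullet> g v > 0 then \<tau> u a = \<tau> v a else \<tau> u a * \<tau> v a = 1"
    if u: "norm u = 1" and v: "norm v = 1" and c: "u \<bullet> v > 0" and a: "a > 0" for u v a
  proof (rule match_maximal)
    show "match (g u \<bullet> g v) (\<tau> u a) (\<tau> v a) = \<bar>g u \<bullet> g v\<bar>"
      using match[OF u v a a] match_refl[OF c a] angle[OF u v] c by simp
    show "g u \<bullet> g v \<noteq> 0" using angle[OF u v] c by auto
  qed (use t u v a in auto)
  have inj': "\<Psi> (two_point u a) \<noteq> \<Psi> (two_point v b)"
    if "two_point u a \<noteq> two_point v b" "a > 0" "b > 0" for u v a b
    using that inj[OF two_point_centered two_point_centered] by blast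
  have neq: "two_point (- u) 2 \<noteq> two_point u 2" if u: "norm u = 1" for u :: 'a
  proof
    assume "two_point (- u) 2 = two_point u 2"
    from two_point_inject[OF _ u _ _ this] u unit_neq_uminus[OF u] show False by auto
  qed
  have pm: "g (- u) = g u \<or> g (- u) = - g u" if u: "norm u = 1" for u
  proof -
    have "norm (- u) = 1" using u by simp
    from same_line_image[OF u this g[OF u] g[OF this] _ _ _ _ t(2)[OF u] t(2)[OF this], of 1 1]
    show ?thesis using t(1)[OF u, of 1] t(1)[OF \<open>norm (- u) = 1\<close>, of 1] by simp
  qed
  \<comment> \<open>for a negative inner product of the images the parameters are inverse to each other; both being at least one, they are one\<close>
  have const2: "\<tau> u 2 = \<tau> v 2" if "norm u = 1" "norm v = 1" for u v
  proof (rule eq_on_sphere_of_locally_constant[OF dim _ that, where f="\<lambda>u. \<tau> u 2"])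
    fix u v :: 'a assume u: "norm u = 1" and v: "norm v = 1" and c: "u \<bullet> v > 0"
    show "\<tau> u 2 = \<tau> v 2"
    proof (cases "g u \<bullet> g v > 0")
      case False
      then have p: "\<tau> u 2 * \<tau> v 2 = 1" using matched[OF u v c, of 2] by simp
      have "\<tau> u 2 * 1 \<le> \<tau> u 2 * \<tau> v 2" "1 * \<tau> v 2 \<le> \<tau> u 2 * \<tau> v 2"
        using t2[OF u] t2[OF v] by (intro mult_mono; simp)+
      then show ?thesis using p t2[OF u] t2[OF v] by simp
    qed (use matched[OF u v c, of 2] in simp)
  qed
  \<comment> \<open>if the parameter were one, the distinct measures \<open>two_point u 2\<close> and \<open>two_point (- u) 2\<close> would have the same image\<close>
  have t2': "\<tau> u 2 > 1" if u: "norm u = 1" for u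
  proof (rule ccontr)
    assume "\<not> \<tau> u 2 > 1"
    then have 1: "\<tau> u 2 = 1" using t2[OF u] by simp
    have u': "norm (- u) = 1" using u by simp
    have "\<tau> (- u) 2 = 1" using const2[OF u' u] 1 by simp
    then have "\<Psi> (two_point (- u) 2) = \<Psi> (two_point u 2)"
      using pm[OF u] t(2)[OF u, of 2] t(2)[OF u', of 2] 1 two_point_uminus[of 1 "g u"] by auto
    then show False using inj' neq[OF u] by force
  qed
  have pos: "g u \<bullet> g v = u \<bullet> v" "\<And>a. a > 0 \<Longrightarrow> \<tau> u a = \<tau> v a"
    if u: "norm u = 1" and v: "norm v = 1" and c: "u \<bullet> v > 0" for u v
  proof -
    have gp: "g u \<bullet> g v > 0"
    proof (rule ccontr)
      assume "\<not> g u \<bullet> g v > 0"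
      then have p: "\<tau> u 2 * \<tau> v 2 = 1" using matched[OF u v c, of 2] by simp
      have "1 * 1 < \<tau> u 2 * \<tau> v 2" using t2'[OF u] t2'[OF v] by (intro mult_strict_mono) auto
      then show False using p by simp
    qed
    then show "g u \<bullet> g v = u \<bullet> v" using angle[OF u v] c by simp
    show "\<tau> u a = \<tau> v a" if "a > 0" for a using matched[OF u v c that] gp by simp
  qed
  have const: "\<tau> u a = \<tau> v a" if "norm u = 1" "norm v = 1" "a > 0" for u v a
    by (rule eq_on_sphere_of_locally_constant[OF dim _ that(1,2), where f="\<lambda>u. \<tau> u a"])
       (use pos(2) that(3) in blast)
  have odd: "g (- u) = - g u" if u: "norm u = 1" for u
  proof (rule ccontr)
    assume "g (- u) \<noteq> - g u"
    then have "g (- u) = g u" using pm[OF u] by simp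
    moreover have u': "norm (- u) = 1" using u by simp
    ultimately have "\<Psi> (two_point (- u) 2) = \<Psi> (two_point u 2)"
      using t(2)[OF u, of 2] t(2)[OF u', of 2] const[OF u u', of 2] by simp
    then show False using inj' neq[OF u] by force
  qed
  have inner: "g u \<bullet> g v = u \<bullet> v" if u: "norm u = 1" and v: "norm v = 1" for u v
  proof -
    consider "u \<bullet> v > 0" | "u \<bullet> v = 0" | "(- u) \<bullet> v > 0" by fastforce
    then show ?thesis
    proof cases
      case 3
      then have "g (- u) \<bullet> g v = (- u) \<bullet> v" using u v by (intro pos) auto
      then show ?thesis using odd[OF u] by simp
    qed (use pos(1)[OF u v] angle[OF u v] in auto)
  qed
  have id: "\<tau> u a = a" if u: "norm u = 1" and a: "a > 0" for u a
  proof -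
    have uu: "u \<bullet> u = 1" "g u \<bullet> g u = 1" using u g[OF u] by (simp_all add: norm_eq_1)
    have u': "norm (- u) = 1" using u by simp
    have inv: "\<tau> u (1 / a) = 1 / \<tau> u a" if a: "a > 0" for a
    proof -
      have "two_point (g u) (\<tau> u (1 / a)) = \<Psi> (two_point (- u) a)"
        using t(2)[OF u, of "1 / a"] two_point_uminus[OF a, of u] a by simp
      also have "\<dots> = two_point (- g u) (\<tau> u a)"
        using t(2)[OF u' a] odd[OF u] const[OF u' u a] by simp
      also have "\<dots> = two_point (g u) (1 / \<tau> u a)" by (rule two_point_uminus[OF t(1)[OF u a]])
      finally show ?thesis using uniq g[OF u] t(1)[OF u, of "1 / a"] t(1)[OF u a] a by simp
    qed
    have m: "min (a / b) (b / a) = min (\<tau> u a / \<tau> u b) (\<tau> u b / \<tau> u a)" if "a > 0" "b > 0" for a b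
      using match[OF u u that] by (simp add: uu match_def similarity_def)
    have "\<tau> u 1 * \<tau> u 1 = 1" using inv[of 1] t(1)[OF u, of 1] by (simp add: field_simps)
    then have t1: "\<tau> u 1 = 1" using t(1)[OF u, of 1] by (simp add: square_eq_1_iff)
    have pm: "\<tau> u a = a \<or> \<tau> u a = 1 / a" if a: "a > 0" for a
      using m[OF a, of 1] t(1)[OF u a] a unfolding t1 by (auto simp: min_def field_simps split: if_splits)
    \<comment> \<open>comparison with the parameter 2 excludes the inversion for every other parameter as well\<close>
    have two: "\<tau> u 2 = 2" using pm[of 2] t2'[OF u] by auto
    show "\<tau> u a = a"
    proof (rule ccontr)
      assume "\<tau> u a \<noteq> a"
      then have ta: "\<tau> u a = 1 / a" using pm[OF a] by simp
      then have a1: "a \<noteq> 1" using \<open>\<tau> u a \<noteq> a\<close> by auto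
      have "min (a / 2) (2 / a) = min ((1 / a) / 2) (2 / (1 / a))"
        using m[OF a, of 2] by (simp add: two ta)
      then have "a / 2 = 2 * a \<or> a / 2 = (1 / a) / 2 \<or> 2 / a = 2 * a \<or> 2 / a = (1 / a) / 2"
        by (auto simp: min_def split: if_splits)
      then have "a * a = 1" using a by (auto simp: field_simps)
      then show False using a1 a by (simp add: square_eq_1_iff)
    qed
  qed
  have "dist (g x) (g y) = dist x y" if "norm x = 1" "norm y = 1" for x y
    using inner that by (simp add: dist_norm norm_eq_sqrt_inner inner_diff_left inner_diff_right)
  then obtain \<phi> where "orthogonal_transformation \<phi>" "\<And>x. norm x = 1 \<Longrightarrow> \<phi> x = g x"
    using isometry_sphere_extend[of g] g by blast
  then show ?thesis using t(2) id by metis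
qed

end

section \<open>Measures determined by their correlations with two-point measures\<close>

text \<open>Among the ways to send a fraction \<open>a\<^sup>2 / (1 + a\<^sup>2)\<close> of the mass of \<open>\<nu>\<close> to the lower point
the best one takes the mass with the smallest \<open>x \<bullet> u\<close>. The number \<open>t\<close> is a Lagrange multiplier for the
constraint on the mass, and the bound follows from a pointwise inequality.\<close>

lemma correlation_two_point_le:
  fixes u :: "'a::euclidean_space"
  assumes W: "\<nu> \<in> wasserstein_space" and u: "norm u = 1" and a: "a > 0"
  shows "correlation (two_point u a) \<nu> \<le>
    a * (barycenter \<nu> \<bullet> u) - a * t + (a + 1 / a) * (\<integral>x. max (t - x \<bullet> u) 0 \<partial>\<nu>)"
proof (rule correlation_le[OF two_point_in_wasserstein_space W])
  let ?T = "two_point u a"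
  have uu: "u \<bullet> u = 1" using u by (simp add: norm_eq_1)
  note n = wasserstein_spaceD[OF W]
  interpret n: prob_space \<nu> by (fact n)
  have [measurable_cong]: "sets \<nu> = sets borel" by (fact n)
  fix \<gamma> assume g: "\<gamma> \<in> couplings ?T \<nu>"
  interpret prob_space \<gamma> using couplingsD[OF g] by simp
  have mi: "integrable \<nu> (\<lambda>x. max (t - x \<bullet> u) 0)" using n(6)[of u] by simp
  have i1: "integrable \<gamma> (\<lambda>z. fst z \<bullet> u)" "(\<integral>z. fst z \<bullet> u \<partial>\<gamma>) = 0"
    using coupling_integral(1,2)[OF g, of "\<lambda>x. x \<bullet> u"] wasserstein_spaceD(6)[OF two_point_in_wasserstein_space, of u a u]
      centeredD(5)[OF two_point_centered[OF a], of u u] by (simp_all del: integral_inner_left)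
  have i2: "integrable \<gamma> (\<lambda>z. snd z \<bullet> u)" "(\<integral>z. snd z \<bullet> u \<partial>\<gamma>) = barycenter \<nu> \<bullet> u"
    using coupling_integral(3,4)[OF g, of "\<lambda>x. x \<bullet> u"] n(6)[of u] barycenter_inner(1)[OF W, of u]
    by (simp_all del: integral_inner_left)
  have i3: "integrable \<gamma> (\<lambda>z. max (t - snd z \<bullet> u) 0)"
    "(\<integral>z. max (t - snd z \<bullet> u) 0 \<partial>\<gamma>) = (\<integral>x. max (t - x \<bullet> u) 0 \<partial>\<nu>)"
    using coupling_integral(3,4)[OF g, of "\<lambda>x. max (t - x \<bullet> u) 0"] mi by simp_all
  have "(\<integral>z. fst z \<bullet> snd z \<partial>\<gamma>) \<le>
      (\<integral>z. a * (snd z \<bullet> u) + (a + 1 / a) * max (t - snd z \<bullet> u) 0 - t * (a - fst z \<bullet> u) \<partial>\<gamma>)"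
  proof (rule integral_mono_AE)
    show "integrable \<gamma> (\<lambda>z. fst z \<bullet> snd z)"
      by (rule coupling_integrable_inner[OF two_point_in_wasserstein_space W g])
    show "integrable \<gamma> (\<lambda>z. a * (snd z \<bullet> u) + (a + 1 / a) * max (t - snd z \<bullet> u) 0 - t * (a - fst z \<bullet> u))"
      by (intro Bochner_Integration.integrable_diff Bochner_Integration.integrable_add integrable_mult_right
          i1 i2 i3) simp
    show "AE z in \<gamma>. fst z \<bullet> snd z \<le> a * (snd z \<bullet> u) + (a + 1 / a) * max (t - snd z \<bullet> u) 0 - t * (a - fst z \<bullet> u)"
      using coupling_AE_fst[OF g AE_two_point]
    proof eventually_elim
      fix z :: "'a \<times> 'a" assume "fst z = a *\<^sub>R u \<or> fst z = (- 1 / a) *\<^sub>R u"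
      then show "fst z \<bullet> snd z \<le> a * (snd z \<bullet> u) + (a + 1 / a) * max (t - snd z \<bullet> u) 0 - t * (a - fst z \<bullet> u)"
      proof
        assume z: "fst z = a *\<^sub>R u"
        have "(a + 1 / a) * max (t - snd z \<bullet> u) 0 \<ge> 0" using a by simp
        then show ?thesis by (simp add: z uu inner_commute)
      next
        assume z: "fst z = (- 1 / a) *\<^sub>R u"
        have "(a + 1 / a) * (t - snd z \<bullet> u) \<le> (a + 1 / a) * max (t - snd z \<bullet> u) 0"
          using a by (intro mult_left_mono) auto
        then show ?thesis by (simp add: z uu inner_commute algebra_simps)
      qed
    qed
  qed
  also have "\<dots> = (\<integral>z. (a * (snd z \<bullet> u) + (a + 1 / a) * max (t - snd z \<bullet> u) 0) + (t * (fst z \<bullet> u) - t * a) \<partial>\<gamma>)"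
    by (simp add: algebra_simps)
  also have "\<dots> = (\<integral>z. a * (snd z \<bullet> u) + (a + 1 / a) * max (t - snd z \<bullet> u) 0 \<partial>\<gamma>) + (\<integral>z. t * (fst z \<bullet> u) - t * a \<partial>\<gamma>)"
    by (intro Bochner_Integration.integral_add Bochner_Integration.integrable_diff
        Bochner_Integration.integrable_add integrable_mult_right i1 i2 i3) simp
  also have "(\<integral>z. a * (snd z \<bullet> u) + (a + 1 / a) * max (t - snd z \<bullet> u) 0 \<partial>\<gamma>) =
      a * (\<integral>z. snd z \<bullet> u \<partial>\<gamma>) + (a + 1 / a) * (\<integral>z. max (t - snd z \<bullet> u) 0 \<partial>\<gamma>)"
    using i2(1) i3(1) by (subst Bochner_Integration.integral_add) (simp_all del: integral_inner_left)
  also have "(\<integral>z. t * (fst z \<bullet> u) - t * a \<partial>\<gamma>) = - (a * t)"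
    using i1 by (simp add: prob_space mult.commute del: integral_inner_left)
  finally show "(\<integral>z. fst z \<bullet> snd z \<partial>\<gamma>) \<le>
    a * (barycenter \<nu> \<bullet> u) - a * t + (a + 1 / a) * (\<integral>x. max (t - x \<bullet> u) 0 \<partial>\<nu>)"
    by (simp only: i2 i3)
qed

text \<open>The bound of \<open>correlation_two_point_le\<close> is attained if the fraction is the mass of a half-space:
send \<open>{x. x \<bullet> u < t}\<close> to the lower point and its complement to the upper one.\<close>

lemma correlation_two_point_ge:
  fixes u :: "'a::euclidean_space"
  assumes W: "\<nu> \<in> wasserstein_space" and u: "norm u = 1"
    and p: "p = measure \<nu> {x. x \<bullet> u < t}" "0 < p" "p < 1" and a: "a = sqrt (p / (1 - p))"
  shows "a * (barycenter \<nu> \<bullet> u) - a * t + (a + 1 / a) * (\<integral>x. max (t - x \<bullet> u) 0 \<partial>\<nu>)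
    \<le> correlation (two_point u a) \<nu>"
proof -
  note n = wasserstein_spaceD[OF W]
  interpret n: prob_space \<nu> by (fact n)
  have [measurable_cong]: "sets \<nu> = sets borel" by (fact n)
  have a0: "a > 0" and a2: "a\<^sup>2 * (1 - p) = p" using p by (simp_all add: a)
  have ap: "(a + 1 / a) * p = a"
  proof -
    have "a * ((a + 1 / a) * p) = a\<^sup>2 * p + p" using a0 by (simp add: power2_eq_square algebra_simps)
    also have "\<dots> = a * a"
    proof -
      have "a\<^sup>2 - a\<^sup>2 * p = p" using a2 by (simp add: right_diff_distrib)
      then show ?thesis by (simp add: power2_eq_square)
    qed
    finally show ?thesis using a0 by (metis mult_left_cancel less_irrefl)
  qed
  define A where "A = {x. x \<bullet> u < t}"
  have A[measurable]: "A \<in> sets borel" unfolding A_def by measurable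
  have iA: "integrable \<nu> (\<lambda>x. indicator A x :: real)" "(\<integral>x. indicator A x \<partial>\<nu>) = p"
    using n(2,3) A by (simp_all add: n.emeasure_eq_measure p(1) A_def)
  define h where "h x = a - (a + 1 / a) * indicator A x" for x
  have hm[measurable]: "h \<in> borel_measurable borel" unfolding h_def by measurable
  have hv: "h x = a \<or> h x = - 1 / a" for x by (auto simp: h_def split: split_indicator)
  have hb: "\<bar>h x\<bar> \<le> a + 1 / a" for x using hv[of x] a0 by (auto simp: abs_le_iff)
  have hi: "integrable \<nu> h" "(\<integral>x. h x \<partial>\<nu>) = 0"
    unfolding h_def using iA n.prob_space ap by simp_all
  have h2: "integrable \<nu> (\<lambda>x. (h x)\<^sup>2)"
  proof (rule n.integrable_const_bound)
    have "(h x)\<^sup>2 \<le> (a + 1 / a)\<^sup>2" for x using power_mono[OF hb[of x], of 2] by simp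
    then show "AE x in \<nu>. norm ((h x)\<^sup>2) \<le> (a + 1 / a)\<^sup>2" by simp
  qed measurable
  let ?D = "distr \<nu> borel (\<lambda>x. h x *\<^sub>R u)"
  have "?D = two_point u a"
  proof (rule two_point_eqI[OF _ u a0])
    have "?D \<in> wasserstein_space"
      by (rule distr_in_wasserstein_space[OF n(1)]) (use h2 in \<open>simp_all add: u\<close>)
    moreover have "barycenter ?D = 0" unfolding barycenter_def
      by (subst integral_distr) (use hi in auto)
    ultimately show "?D \<in> centered" by (simp add: centered_def)
    show "AE x in ?D. x = a *\<^sub>R u \<or> x = (- 1 / a) *\<^sub>R u"
    proof (subst AE_distr_iff)
      have "h x *\<^sub>R u = a *\<^sub>R u \<or> h x *\<^sub>R u = (- 1 / a) *\<^sub>R u" for x using hv[of x] by metis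
      then show "AE x in \<nu>. h x *\<^sub>R u = a *\<^sub>R u \<or> h x *\<^sub>R u = (- 1 / a) *\<^sub>R u" by (rule AE_I2)
    qed measurable
  qed
  moreover have "distr \<nu> borel (\<lambda>x. x) = \<nu>" using n(2) by (rule distr_borel_id)
  moreover have "(\<integral>x. (h x *\<^sub>R u) \<bullet> x \<partial>\<nu>) \<le> correlation ?D (distr \<nu> borel (\<lambda>x. x))"
    by (rule correlation_ge[OF n(1)]) (use h2 n(4) in \<open>simp_all add: u\<close>)
  ultimately have "(\<integral>x. (h x *\<^sub>R u) \<bullet> x \<partial>\<nu>) \<le> correlation (two_point u a) \<nu>" by simp
  moreover have "(\<integral>x. (h x *\<^sub>R u) \<bullet> x \<partial>\<nu>) =
      (\<integral>x. (a * (x \<bullet> u) + (a + 1 / a) * max (t - x \<bullet> u) 0) - t * ((a + 1 / a) * indicator A x) \<partial>\<nu>)"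
  proof (rule Bochner_Integration.integral_cong[OF refl])
    fix x
    have pt: "(a - c * i) * s = (a * s + c * m) - t * (c * i)" if "i = 1 \<and> m = t - s \<or> i = 0 \<and> m = 0"
      for i m s c :: real
      using that by (auto simp: algebra_simps)
    show "(h x *\<^sub>R u) \<bullet> x = (a * (x \<bullet> u) + (a + 1 / a) * max (t - x \<bullet> u) 0) - t * ((a + 1 / a) * indicator A x)"
      unfolding h_def inner_scaleR_left inner_commute[of u x]
      by (rule pt) (auto simp: A_def max_def)
  qed
  moreover have "\<dots> = (\<integral>x. a * (x \<bullet> u) + (a + 1 / a) * max (t - x \<bullet> u) 0 \<partial>\<nu>) - (\<integral>x. t * ((a + 1 / a) * indicator A x) \<partial>\<nu>)"
    using n(6)[of u] iA(1) by (intro Bochner_Integration.integral_diff) auto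
  moreover have "(\<integral>x. a * (x \<bullet> u) + (a + 1 / a) * max (t - x \<bullet> u) 0 \<partial>\<nu>) =
      a * (\<integral>x. x \<bullet> u \<partial>\<nu>) + (a + 1 / a) * (\<integral>x. max (t - x \<bullet> u) 0 \<partial>\<nu>)"
    using n(6)[of u] by (subst Bochner_Integration.integral_add) (simp_all del: integral_inner_left)
  moreover have "(\<integral>x. t * ((a + 1 / a) * indicator A x) \<partial>\<nu>) = a * t"
  proof -
    have "(\<integral>x. t * ((a + 1 / a) * indicator A x) \<partial>\<nu>) = t * ((a + 1 / a) * p)" using iA by simp
    then show ?thesis unfolding ap by (simp only: mult.commute[of t a])
  qed
  moreover have "a * (\<integral>x. x \<bullet> u \<partial>\<nu>) = a * (barycenter \<nu> \<bullet> u)" by (simp only: barycenter_inner(1)[OF W])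
  ultimately show ?thesis by linarith
qed

text \<open>The integrals of \<open>max (t - x \<bullet> u) 0\<close> and the correlations with two-point measures are Legendre
transforms of each other. When the half-space has mass zero or one no two-point measure is
available, but then the integral is zero or read off from the barycenter.\<close>

lemma stop_loss_eq:
  fixes \<nu> \<nu>' :: "'a::euclidean_space measure"
  assumes W: "\<nu> \<in> wasserstein_space" "\<nu>' \<in> wasserstein_space" and b: "barycenter \<nu> = barycenter \<nu>'"
    and c: "\<And>u a. norm u = 1 \<Longrightarrow> a > 0 \<Longrightarrow> correlation (two_point u a) \<nu> = correlation (two_point u a) \<nu>'"
    and u: "norm u = 1"
  shows "(\<integral>x. max (t - x \<bullet> u) 0 \<partial>\<nu>) = (\<integral>x. max (t - x \<bullet> u) 0 \<partial>\<nu>')"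
proof -
  have *: "(\<integral>x. max (t - x \<bullet> u) 0 \<partial>\<nu>) \<le> (\<integral>x. max (t - x \<bullet> u) 0 \<partial>\<nu>')"
    if W: "\<nu> \<in> wasserstein_space" "\<nu>' \<in> wasserstein_space" and b: "barycenter \<nu> = barycenter \<nu>'"
      and c: "\<And>u a. norm u = 1 \<Longrightarrow> a > 0 \<Longrightarrow> correlation (two_point u a) \<nu> = correlation (two_point u a) \<nu>'"
    for \<nu> \<nu>' :: "'a measure"
  proof -
    note n = wasserstein_spaceD[OF W(1)] and n' = wasserstein_spaceD[OF W(2)]
    interpret n: prob_space \<nu> by (fact n)
    interpret n': prob_space \<nu>' by (fact n')
    have [measurable_cong]: "sets \<nu> = sets borel" "sets \<nu>' = sets borel" by (fact n n')+
    define p where "p = measure \<nu> {x. x \<bullet> u < t}"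
    have S: "{x \<in> space \<nu>. x \<bullet> u < t} = {x. x \<bullet> u < t}" using n(3) by simp
    have Sm: "{x. x \<bullet> u < t} \<in> sets \<nu>" using n(2) by simp
    consider "p = 0" | "p = 1" | "0 < p" "p < 1"
      using n.prob_le_1[of "{x. x \<bullet> u < t}"] measure_nonneg[of \<nu> "{x. x \<bullet> u < t}"]
      unfolding p_def[symmetric] by linarith
    then show ?thesis
    proof cases
      case 1
      then have "AE x in \<nu>. \<not> x \<bullet> u < t" using n.prob_eq_0[OF Sm] S by (simp add: p_def)
      then have "(\<integral>x. max (t - x \<bullet> u) 0 \<partial>\<nu>) = 0"
        by (intro integral_eq_zero_AE) (auto elim!: eventually_mono)
      then show ?thesis by simp
    next
      case 2
      then have "AE x in \<nu>. x \<bullet> u < t" using n.prob_eq_1[OF Sm] S by (simp add: p_def)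
      then have "(\<integral>x. max (t - x \<bullet> u) 0 \<partial>\<nu>) = (\<integral>x. t - x \<bullet> u \<partial>\<nu>)"
        by (intro integral_cong_AE) (auto elim!: eventually_mono)
      also have "\<dots> = t - barycenter \<nu> \<bullet> u"
        using n(6)[of u] barycenter_inner(1)[OF W(1), of u] n.prob_space by (simp del: integral_inner_left)
      also have "\<dots> = (\<integral>x. t - x \<bullet> u \<partial>\<nu>')"
        using n'(6)[of u] barycenter_inner(1)[OF W(2), of u] n'.prob_space b by (simp del: integral_inner_left)
      also have "\<dots> \<le> (\<integral>x. max (t - x \<bullet> u) 0 \<partial>\<nu>')"
        using n'(6)[of u] by (intro integral_mono) auto
      finally show ?thesis .
    next
      case 3
      define a where "a = sqrt (p / (1 - p))"
      have a: "a > 0" using 3 by (simp add: a_def)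
      have "a * (barycenter \<nu> \<bullet> u) - a * t + (a + 1 / a) * (\<integral>x. max (t - x \<bullet> u) 0 \<partial>\<nu>)
        \<le> a * (barycenter \<nu>' \<bullet> u) - a * t + (a + 1 / a) * (\<integral>x. max (t - x \<bullet> u) 0 \<partial>\<nu>')"
        using correlation_two_point_ge[OF W(1) u p_def 3 a_def] correlation_two_point_le[OF W(2) u a, of t] c[OF u a]
        by linarith
      then have "(a + 1 / a) * (\<integral>x. max (t - x \<bullet> u) 0 \<partial>\<nu>) \<le> (a + 1 / a) * (\<integral>x. max (t - x \<bullet> u) 0 \<partial>\<nu>')"
        by (simp add: b)
      moreover have "a + 1 / a > 0" using a by (simp add: add_pos_pos)
      ultimately show ?thesis by (simp add: mult_le_cancel_left_pos)
    qed
  qed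
  show ?thesis using *[OF W b c] *[OF W(2,1) b[symmetric] c[symmetric]] by simp
qed

text \<open>The difference quotients in \<open>t\<close> of \<open>max (x \<bullet> u - t) 0\<close> converge, up to sign, boundedly to the
indicator function of a half-space.\<close>

lemma projection_eq:
  fixes \<nu> \<nu>' :: "'a::euclidean_space measure"
  assumes W: "\<nu> \<in> wasserstein_space" "\<nu>' \<in> wasserstein_space"
    and e: "\<And>u t. norm u = 1 \<Longrightarrow> (\<integral>x. max (t - x \<bullet> u) 0 \<partial>\<nu>) = (\<integral>x. max (t - x \<bullet> u) 0 \<partial>\<nu>')"
    and u: "norm u = 1"
  shows "distr \<nu> borel (\<lambda>x. x \<bullet> u) = distr \<nu>' borel (\<lambda>x. x \<bullet> u)"
proof -
  have e': "(\<integral>x. max (x \<bullet> u - t) 0 \<partial>\<nu>) = (\<integral>x. max (x \<bullet> u - t) 0 \<partial>\<nu>')" for t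
    using e[of "- u" "- t"] u by simp
  define f where "f t n x = real (Suc n) * (max (x \<bullet> u - t) 0 - max (x \<bullet> u - (t + 1 / Suc n)) 0)" for t n and x :: 'a
  have fm[measurable]: "f t n \<in> borel_measurable borel" for t n unfolding f_def by measurable
  have f_lim: "(\<lambda>n. f t n x) \<longlonglongrightarrow> indicator {x. t < x \<bullet> u} x" for t x
  proof (cases "t < x \<bullet> u")
    case True
    then have "\<forall>\<^sub>F n in sequentially. 1 / real (Suc n) < x \<bullet> u - t"
      by (intro order_tendstoD(2)[OF LIMSEQ_Suc[OF lim_1_over_n]]) simp
    then have "\<forall>\<^sub>F n in sequentially. f t n x = 1"
    proof eventually_elim
      fix n assume "1 / real (Suc n) < x \<bullet> u - t"
      then have "max (x \<bullet> u - t) 0 - max (x \<bullet> u - (t + 1 / Suc n)) 0 = 1 / Suc n" using True by simp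
      then show "f t n x = 1" by (simp add: f_def)
    qed
    then show ?thesis using True by (simp add: tendsto_eventually)
  next
    case False
    have "max (x \<bullet> u - t) 0 = 0" "max (x \<bullet> u - (t + 1 / Suc n)) 0 = 0" for n
    proof -
      have "0 \<le> 1 / real (Suc n)" by simp
      then show "max (x \<bullet> u - t) 0 = 0" "max (x \<bullet> u - (t + 1 / Suc n)) 0 = 0"
        using False by linarith+
    qed
    then show ?thesis using False by (simp add: f_def)
  qed
  have f_bound: "\<bar>f t n x\<bar> \<le> 1" for t n x
  proof -
    have "0 \<le> 1 / real (Suc n)" by simp
    then have "0 \<le> max (x \<bullet> u - t) 0 - max (x \<bullet> u - (t + 1 / Suc n)) 0"
      "max (x \<bullet> u - t) 0 - max (x \<bullet> u - (t + 1 / Suc n)) 0 \<le> 1 / Suc n"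
      by linarith+
    then have "0 \<le> f t n x" "f t n x \<le> real (Suc n) * (1 / Suc n)"
      unfolding f_def by (intro mult_nonneg_nonneg mult_left_mono; simp)+
    then show ?thesis by simp
  qed
  have lim: "(\<lambda>n. \<integral>x. f t n x \<partial>\<kappa>) \<longlonglongrightarrow> measure \<kappa> {x. t < x \<bullet> u}"
    if "\<kappa> \<in> wasserstein_space" for \<kappa> :: "'a measure" and t
  proof -
    note k = wasserstein_spaceD[OF that]
    interpret k: prob_space \<kappa> by (fact k)
    have [measurable_cong]: "sets \<kappa> = sets borel" by (fact k)
    have "(\<lambda>n. \<integral>x. f t n x \<partial>\<kappa>) \<longlonglongrightarrow> (\<integral>x. indicator {x. t < x \<bullet> u} x \<partial>\<kappa>)"
      by (rule integral_dominated_convergence[where w="\<lambda>_. 1"]) (use f_lim f_bound in auto)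
    then show ?thesis using k by simp
  qed
  have fe: "(\<integral>x. f t n x \<partial>\<nu>) = (\<integral>x. f t n x \<partial>\<nu>')" for t n
  proof -
    have i: "(\<integral>x. f t n x \<partial>\<kappa>) = real (Suc n) * ((\<integral>x. max (x \<bullet> u - t) 0 \<partial>\<kappa>) - (\<integral>x. max (x \<bullet> u - (t + 1 / Suc n)) 0 \<partial>\<kappa>))"
      if "\<kappa> \<in> wasserstein_space" for \<kappa> :: "'a measure"
    proof -
      interpret k: prob_space \<kappa> using that by (rule wasserstein_spaceD)
      show ?thesis unfolding f_def using wasserstein_spaceD(6)[OF that, of u]
        by (simp del: integral_inner_left of_nat_Suc)
    qed
    show ?thesis unfolding i[OF W(1)] i[OF W(2)] by (simp only: e')
  qed
  have "measure \<nu> {x. t < x \<bullet> u} = measure \<nu>' {x. t < x \<bullet> u}" for t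
    using LIMSEQ_unique[OF lim[OF W(1)] lim[OF W(2), of t, folded fe]] .
  then have m: "emeasure \<nu> {x. t < x \<bullet> u} = emeasure \<nu>' {x. t < x \<bullet> u}" for t
    using wasserstein_spaceD(1)[OF W(1)] wasserstein_spaceD(1)[OF W(2)]
    by (simp add: finite_measure.emeasure_eq_measure prob_space.finite_measure)
  have em: "emeasure (distr \<kappa> borel (\<lambda>x. x \<bullet> u)) {t<..} = emeasure \<kappa> {x. t < x \<bullet> u}"
    if "\<kappa> \<in> wasserstein_space" for \<kappa> :: "'a measure" and t
  proof -
    have [measurable_cong]: "sets \<kappa> = sets borel" using that by (rule wasserstein_spaceD)
    show ?thesis using wasserstein_spaceD(3)[OF that]
      by (subst emeasure_distr) (auto intro!: arg_cong[where f="emeasure \<kappa>"])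
  qed
  show ?thesis
  proof (rule measure_eqI_lessThan)
    fix t
    interpret prob_space \<nu> using W(1) by (rule wasserstein_spaceD)
    show "emeasure (distr \<nu> borel (\<lambda>x. x \<bullet> u)) {t<..} < \<infinity>"
      unfolding em[OF W(1)] by (simp add: emeasure_eq_measure)
    show "emeasure (distr \<nu> borel (\<lambda>x. x \<bullet> u)) {t<..} = emeasure (distr \<nu>' borel (\<lambda>x. x \<bullet> u)) {t<..}"
      unfolding em[OF W(1)] em[OF W(2)] by (rule m)
  qed simp_all
qed

text \<open>Finitely many hyperplanes do not cover the space, so some direction is orthogonal to no difference
of points in \<open>H\<close>.\<close>

lemma ex_separating_direction:
  fixes H :: "'a::euclidean_space set"
  assumes "finite H"
  shows "\<exists>u. norm u = 1 \<and> inj_on (\<lambda>x. x \<bullet> u) H"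
proof -
  define D where "D = insert (SOME b. b \<in> Basis) ((\<lambda>(x, y). x - y) ` {(x, y). x \<in> H \<and> y \<in> H \<and> x \<noteq> y})"
  have "finite {(x, y). x \<in> H \<and> y \<in> H \<and> x \<noteq> y}"
    by (rule finite_subset[OF _ finite_cartesian_product[OF assms assms]]) auto
  then have "finite D" by (simp add: D_def)
  moreover have d0: "d \<noteq> 0" if "d \<in> D" for d
    using that nonzero_Basis[OF SOME_Basis, where 'a='a] by (auto simp: D_def)
  ultimately have "negligible (\<Union>d\<in>D. {u. d \<bullet> u = 0})"
    by (intro negligible_Union) (auto intro!: negligible_hyperplane)
  then have "(\<Union>d\<in>D. {u. d \<bullet> u = 0}) \<noteq> UNIV" using non_negligible_UNIV by metis
  then obtain w where w: "\<And>d. d \<in> D \<Longrightarrow> d \<bullet> w \<noteq> 0" by blast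
  have w0: "w \<noteq> 0" using w[of "SOME b. b \<in> Basis"] by (auto simp: D_def)
  define u where "u = (1 / norm w) *\<^sub>R w"
  have "inj_on (\<lambda>x. x \<bullet> u) H"
  proof (rule inj_onI, rule ccontr)
    fix x y assume xy: "x \<in> H" "y \<in> H" "x \<bullet> u = y \<bullet> u" "x \<noteq> y"
    then have "x - y \<in> D" by (auto simp: D_def)
    moreover have "(x - y) \<bullet> w = 0" using xy(3) w0 by (simp add: u_def inner_diff_left)
    ultimately show False using w by blast
  qed
  moreover have "norm u = 1" using w0 by (simp add: u_def)
  ultimately show ?thesis by blast
qed

text \<open>The projections to the coordinate axes confine \<open>\<nu>'\<close> to a finite grid. A projection that is
injective on this grid and on \<open>F\<close> then identifies the two measures.\<close>

lemma finite_support_eq_of_projections: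
  fixes \<nu> \<nu>' :: "'a::euclidean_space measure"
  assumes W: "\<nu> \<in> wasserstein_space" "\<nu>' \<in> wasserstein_space"
    and pr: "\<And>u. norm u = 1 \<Longrightarrow> distr \<nu> borel (\<lambda>x. x \<bullet> u) = distr \<nu>' borel (\<lambda>x. x \<bullet> u)"
    and F: "finite F" "AE x in \<nu>. x \<in> F"
  shows "\<nu> = \<nu>'"
proof (rule measure_eqI)
  note n = wasserstein_spaceD[OF W(1)] and n' = wasserstein_spaceD[OF W(2)]
  have [measurable_cong]: "sets \<nu> = sets borel" "sets \<nu>' = sets borel" by (fact n n')+
  show "sets \<nu> = sets \<nu>'" using n n' by simp
  define G where "G = {x. \<forall>b\<in>Basis. x \<bullet> b \<in> (\<lambda>x. x \<bullet> b) ` F}"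
  have G: "AE x in \<nu>'. x \<in> G"
  proof -
    have "AE x in \<nu>'. x \<bullet> b \<in> (\<lambda>x. x \<bullet> b) ` F" if "b \<in> Basis" for b
    proof -
      have S: "(\<lambda>x. x \<bullet> b) ` F \<in> sets borel" using F(1) by (simp add: finite_imp_closed)
      then have S': "{x \<in> space borel. x \<in> (\<lambda>x. x \<bullet> b) ` F} \<in> sets borel" by simp
      have "AE y in distr \<nu> borel (\<lambda>x. x \<bullet> b). y \<in> (\<lambda>x. x \<bullet> b) ` F"
        using F(2) by (subst AE_distr_iff[OF _ S']) (auto elim!: eventually_mono)
      then have "AE y in distr \<nu>' borel (\<lambda>x. x \<bullet> b). y \<in> (\<lambda>x. x \<bullet> b) ` F"
        unfolding pr[OF norm_Basis[OF that]] .
      then show ?thesis by (subst (asm) AE_distr_iff[OF _ S']) auto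
    qed
    then have "AE x in \<nu>'. \<forall>b\<in>Basis. x \<bullet> b \<in> (\<lambda>x. x \<bullet> b) ` F"
      by (intro AE_ball_countable') (auto simp: countable_finite)
    then show ?thesis by (simp add: G_def)
  qed
  have finG: "finite G"
  proof (rule inj_on_finite)
    show "inj_on (\<lambda>x. \<lambda>b\<in>Basis. x \<bullet> b) G"
      by (rule inj_onI, rule euclidean_eqI) (metis restrict_apply')
    show "(\<lambda>x. \<lambda>b\<in>Basis. x \<bullet> b) ` G \<subseteq> (\<Pi>\<^sub>E b\<in>Basis. (\<lambda>x. x \<bullet> b) ` F)"
      by (auto simp: G_def)
    show "finite (\<Pi>\<^sub>E b\<in>(Basis::'a set). (\<lambda>x. x \<bullet> b) ` F)" using F(1) by (intro finite_PiE) auto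
  qed
  define H where "H = F \<union> G"
  have finH: "finite H" using F(1) finG by (simp add: H_def)
  obtain u where u: "norm u = 1" and inj: "inj_on (\<lambda>x. x \<bullet> u) H"
    using ex_separating_direction[OF finH] by blast
  fix A assume "A \<in> sets \<nu>"
  then have A[measurable]: "A \<in> sets borel" using n by simp
  define B where "B = (\<lambda>x. x \<bullet> u) ` (A \<inter> H)"
  have B[measurable]: "B \<in> sets borel" using finH by (auto simp: B_def intro!: borel_closed finite_imp_closed)
  have key: "emeasure \<kappa> A = emeasure (distr \<kappa> borel (\<lambda>x. x \<bullet> u)) B"
    if K: "\<kappa> \<in> wasserstein_space" "AE x in \<kappa>. x \<in> H" for \<kappa> :: "'a measure"
  proof -
    have [measurable_cong]: "sets \<kappa> = sets borel" using K(1) by (rule wasserstein_spaceD)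
    have "emeasure \<kappa> A = emeasure \<kappa> ((\<lambda>x. x \<bullet> u) -` B \<inter> space \<kappa>)"
    proof (rule emeasure_eq_AE)
      show "AE x in \<kappa>. x \<in> A \<longleftrightarrow> x \<in> (\<lambda>x. x \<bullet> u) -` B \<inter> space \<kappa>"
        using K(2) by eventually_elim
          (use inj wasserstein_spaceD(3)[OF K(1)] in \<open>auto simp: B_def dest: inj_onD\<close>)
    qed measurable
    then show ?thesis by (simp add: emeasure_distr)
  qed
  have "AE x in \<nu>. x \<in> H" using F(2) by eventually_elim (simp add: H_def)
  moreover have "AE x in \<nu>'. x \<in> H" using G by eventually_elim (simp add: H_def)
  ultimately show "emeasure \<nu> A = emeasure \<nu>' A" using key W pr[OF u] by simp
qed

lemma wasserstein_dist_le:
  fixes X Y :: "'b \<Rightarrow> 'a::euclidean_space"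
  assumes M: "prob_space M" and [measurable]: "X \<in> borel_measurable M" "Y \<in> borel_measurable M"
    and X2: "integrable M (\<lambda>\<omega>. (norm (X \<omega>))\<^sup>2)" and Y2: "integrable M (\<lambda>\<omega>. (norm (Y \<omega>))\<^sup>2)"
  shows "(wasserstein_dist (distr M borel X) (distr M borel Y))\<^sup>2 \<le> (\<integral>\<omega>. (dist (X \<omega>) (Y \<omega>))\<^sup>2 \<partial>M)"
proof -
  interpret prob_space M by fact
  have *: "(dist x y)\<^sup>2 = (norm x)\<^sup>2 + (norm y)\<^sup>2 - 2 * (x \<bullet> y)" for x y :: 'a
    by (simp add: dist_norm power2_norm_eq_inner inner_diff_left inner_diff_right inner_commute)
  have i: "integrable M (\<lambda>\<omega>. X \<omega> \<bullet> Y \<omega>)" by (rule integrable_inner_of_square_integrable) (use assms in auto)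
  have "(\<integral>\<omega>. (dist (X \<omega>) (Y \<omega>))\<^sup>2 \<partial>M) =
      second_moment (distr M borel X) + second_moment (distr M borel Y) - 2 * (\<integral>\<omega>. X \<omega> \<bullet> Y \<omega> \<partial>M)"
    unfolding * second_moment_def using i X2 Y2 by (simp add: integral_distr)
  then show ?thesis
    using correlation_ge[OF M _ _ X2 Y2] by (simp add: wasserstein_dist_squared)
qed

text \<open>The identity is a limit of simple functions with \<open>norm (q i x) \<le> 2 * norm x\<close>; the images of \<open>\<nu>\<close>
under these functions converge by dominated convergence.\<close>

lemma finite_support_dense:
  fixes \<nu> :: "'a::euclidean_space measure"
  assumes W: "\<nu> \<in> wasserstein_space" and e: "\<epsilon> > 0"
  shows "\<exists>\<kappa>\<in>wasserstein_space. (\<exists>F. finite F \<and> (AE x in \<kappa>. x \<in> F)) \<and> wasserstein_dist \<nu> \<kappa> < \<epsilon>"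
proof -
  note n = wasserstein_spaceD[OF W]
  interpret prob_space \<nu> by (fact n)
  have [measurable_cong]: "sets \<nu> = sets borel" by (fact n)
  obtain q where q: "\<And>i. simple_function \<nu> (q i)" and lim: "\<And>x. (\<lambda>i. q i x) \<longlonglongrightarrow> x"
    and bd: "\<And>i x. norm (q i x) \<le> 2 * norm x"
    using borel_measurable_implies_sequence_metric[of "\<lambda>x. x" \<nu> 0] n(3) by auto
  have qm[measurable]: "q i \<in> borel_measurable \<nu>" for i using q by (rule borel_measurable_simple_function)
  have q2: "integrable \<nu> (\<lambda>x. (norm (q i x))\<^sup>2)" for i
  proof (rule Bochner_Integration.integrable_bound[of _ "\<lambda>x. 4 * (norm x)\<^sup>2"])
    have "(norm (q i x))\<^sup>2 \<le> 4 * (norm x)\<^sup>2" for x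
      using power_mono[OF bd[of i x], of 2] by (simp add: power_mult_distrib)
    then show "AE x in \<nu>. norm ((norm (q i x))\<^sup>2) \<le> norm (4 * (norm x)\<^sup>2)" by simp
  qed (use n(4) in auto)
  have "(\<lambda>i. \<integral>x. (dist x (q i x))\<^sup>2 \<partial>\<nu>) \<longlonglongrightarrow> (\<integral>x. 0 \<partial>\<nu>)"
  proof (rule integral_dominated_convergence[where w="\<lambda>x. 9 * (norm x)\<^sup>2"])
    have "(\<lambda>i. (dist x (q i x))\<^sup>2) \<longlonglongrightarrow> (dist x x)\<^sup>2" for x
      by (intro tendsto_power tendsto_dist tendsto_const lim)
    then show "AE x in \<nu>. (\<lambda>i. (dist x (q i x))\<^sup>2) \<longlonglongrightarrow> 0" by simp
    have "(dist x (q i x))\<^sup>2 \<le> 9 * (norm x)\<^sup>2" for i x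
    proof -
      have "dist x (q i x) \<le> 3 * norm x"
        using norm_triangle_ineq4[of x "q i x"] bd[of i x] by (simp add: dist_norm)
      then have "(dist x (q i x))\<^sup>2 \<le> (3 * norm x)\<^sup>2" by (rule power_mono) simp
      then show ?thesis by (simp add: power_mult_distrib)
    qed
    then show "AE x in \<nu>. norm ((dist x (q i x))\<^sup>2) \<le> 9 * (norm x)\<^sup>2" for i by simp
  qed (use n(4) in auto)
  then have "\<forall>\<^sub>F i in sequentially. (\<integral>x. (dist x (q i x))\<^sup>2 \<partial>\<nu>) < \<epsilon>\<^sup>2"
    by (rule order_tendstoD(2)) (use e in simp)
  then obtain i where i: "(\<integral>x. (dist x (q i x))\<^sup>2 \<partial>\<nu>) < \<epsilon>\<^sup>2"
    using eventually_happens trivial_limit_sequentially by blast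
  let ?k = "distr \<nu> borel (q i)"
  have "(wasserstein_dist (distr \<nu> borel (\<lambda>x. x)) ?k)\<^sup>2 \<le> (\<integral>x. (dist x (q i x))\<^sup>2 \<partial>\<nu>)"
    by (rule wasserstein_dist_le) (simp_all add: n(1,4) q2)
  then have "(wasserstein_dist \<nu> ?k)\<^sup>2 < \<epsilon>\<^sup>2" using i n(2) by (simp add: distr_borel_id)
  then have "wasserstein_dist \<nu> ?k < \<epsilon>" using e by (meson less_imp_le power_less_imp_less_base)
  moreover have "?k \<in> wasserstein_space" by (rule distr_in_wasserstein_space) (simp_all add: n(1,4) q2)
  moreover have fin: "finite (range (q i))" using simple_functionD(1)[OF q[of i]] n(3) by simp
  moreover have "AE x in ?k. x \<in> range (q i)"
    by (subst AE_distr_iff) (use fin in \<open>auto intro!: borel_closed finite_imp_closed\<close>)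
  ultimately show ?thesis by blast
qed

lemma lipschitz_integral_diff_le:
  fixes \<mu> \<nu> :: "'a::euclidean_space measure" and f :: "'a \<Rightarrow> real"
  assumes W: "\<mu> \<in> wasserstein_space" "\<nu> \<in> wasserstein_space"
    and [measurable]: "f \<in> borel_measurable borel" and bd: "\<And>x. \<bar>f x\<bar> \<le> B"
    and lip: "\<And>x y. \<bar>f x - f y\<bar> \<le> L * dist x y" and L: "L > 0"
  shows "\<bar>(\<integral>x. f x \<partial>\<mu>) - (\<integral>x. f x \<partial>\<nu>)\<bar> \<le> L * wasserstein_dist \<mu> \<nu>"
proof -
  \<comment> \<open>a lower bound for the root mean square distance under every coupling\<close>
  define \<Delta> where "\<Delta> = \<bar>(\<integral>x. f x \<partial>\<mu>) - (\<integral>x. f x \<partial>\<nu>)\<bar> / L"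
  have "correlation \<mu> \<nu> \<le> (second_moment \<mu> + second_moment \<nu> - \<Delta>\<^sup>2) / 2"
  proof (rule correlation_le[OF W])
    fix \<gamma> assume g: "\<gamma> \<in> couplings \<mu> \<nu>"
    note c[measurable] = couplingsD(6,7)[OF g]
    interpret prob_space \<gamma> using couplingsD[OF g] by simp
    note cost = coupling_cost(3,4)[OF W g]
    let ?d = "\<lambda>z::'a \<times> 'a. dist (fst z) (snd z)"
    have fi: "integrable \<gamma> (\<lambda>z. f (fst z))" "integrable \<gamma> (\<lambda>z. f (snd z))"
      by (rule integrable_const_bound[of _ B]; use bd in auto)+
    have di: "integrable \<gamma> ?d" by (rule integrable_of_square_integrable) (use cost in auto)
    have "\<bar>(\<integral>x. f x \<partial>\<mu>) - (\<integral>x. f x \<partial>\<nu>)\<bar> = \<bar>\<integral>z. f (fst z) - f (snd z) \<partial>\<gamma>\<bar>"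
      using fi coupling_integral(2,4)[OF g, of f] by simp
    also have "\<dots> \<le> (\<integral>z. \<bar>f (fst z) - f (snd z)\<bar> \<partial>\<gamma>)" by (rule integral_abs_bound)
    also have "\<dots> \<le> (\<integral>z. L * ?d z \<partial>\<gamma>)" using fi di lip by (intro integral_mono) auto
    also have "\<dots> = L * expectation ?d" by simp
    finally have "\<Delta> \<le> expectation ?d" using L by (simp add: \<Delta>_def divide_le_eq mult.commute)
    moreover have "\<Delta> \<ge> 0" using L by (simp add: \<Delta>_def)
    ultimately have "\<Delta>\<^sup>2 \<le> (expectation ?d)\<^sup>2" by (rule power_mono)
    also have "\<dots> \<le> expectation (\<lambda>z. (?d z)\<^sup>2)"
      using variance_eq[OF di cost(1)] variance_positive[of ?d] by linarith
    finally show "(\<integral>z. fst z \<bullet> snd z \<partial>\<gamma>) \<le> (second_moment \<mu> + second_moment \<nu> - \<Delta>\<^sup>2) / 2"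
      using cost(2) by simp
  qed
  then have "\<Delta>\<^sup>2 \<le> (wasserstein_dist \<mu> \<nu>)\<^sup>2" by (simp add: wasserstein_dist_squared)
  then have "\<Delta> \<le> wasserstein_dist \<mu> \<nu>" by (rule power2_le_imp_le) (rule wasserstein_dist_nonneg)
  then show ?thesis using L by (simp add: \<Delta>_def divide_le_eq mult.commute)
qed

text \<open>By \<open>lipschitz_integral_diff_le\<close> the two measures integrate bounded Lipschitz functions equally, and
such functions decrease to the indicator function of any nonempty closed set.\<close>

lemma wasserstein_separation:
  fixes \<mu> \<nu> :: "'a::euclidean_space measure"
  assumes W: "\<mu> \<in> wasserstein_space" "\<nu> \<in> wasserstein_space"
    and close: "\<And>\<epsilon>. \<epsilon> > 0 \<Longrightarrow> \<exists>\<kappa>\<in>wasserstein_space. wasserstein_dist \<mu> \<kappa> < \<epsilon> \<and> wasserstein_dist \<nu> \<kappa> < \<epsilon>"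
  shows "\<mu> = \<nu>"
proof -
  note m = wasserstein_spaceD[OF W(1)] and n = wasserstein_spaceD[OF W(2)]
  interpret m: prob_space \<mu> by (fact m)
  interpret n: prob_space \<nu> by (fact n)
  have [measurable_cong]: "sets \<mu> = sets borel" "sets \<nu> = sets borel" by (fact m n)+
  have lip_eq: "(\<integral>x. f x \<partial>\<mu>) = (\<integral>x. f x \<partial>\<nu>)"
    if f: "f \<in> borel_measurable borel" "\<And>x. \<bar>f x\<bar> \<le> B" "\<And>x y. \<bar>f x - f y\<bar> \<le> L * dist x y" "L > 0"
    for f :: "'a \<Rightarrow> real" and B L
  proof -
    have "\<bar>(\<integral>x. f x \<partial>\<mu>) - (\<integral>x. f x \<partial>\<nu>)\<bar> \<le> \<epsilon>" if e: "\<epsilon> > 0" for \<epsilon>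
    proof -
      obtain \<kappa> where k: "\<kappa> \<in> wasserstein_space" "wasserstein_dist \<mu> \<kappa> < \<epsilon> / (2 * L)" "wasserstein_dist \<nu> \<kappa> < \<epsilon> / (2 * L)"
        using close[of "\<epsilon> / (2 * L)"] e f(4) by auto
      have "L * wasserstein_dist \<mu> \<kappa> \<le> \<epsilon> / 2" "L * wasserstein_dist \<nu> \<kappa> \<le> \<epsilon> / 2"
        using k f(4) by (simp_all add: field_simps)
      then show ?thesis
        using lipschitz_integral_diff_le[OF W(1) k(1) f] lipschitz_integral_diff_le[OF W(2) k(1) f] by linarith
    qed
    then have "\<bar>(\<integral>x. f x \<partial>\<mu>) - (\<integral>x. f x \<partial>\<nu>)\<bar> \<le> 0" by (rule field_le_epsilon[of _ 0, simplified])
    then show ?thesis by simp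
  qed
  have closed_eq: "measure \<mu> C = measure \<nu> C" if C: "closed C" for C
  proof (cases "C = {}")
    case False
    have [measurable]: "C \<in> sets borel" using C by simp
    define f where "f j x = max 0 (1 - real (Suc j) * infdist x C)" for j x
    have fm[measurable]: "f j \<in> borel_measurable borel" for j
      unfolding f_def by (intro borel_measurable_continuous_onI continuous_intros)
    have fb: "\<bar>f j x\<bar> \<le> 1" for j x by (simp add: f_def infdist_nonneg)
    have fl: "\<bar>f j x - f j y\<bar> \<le> real (Suc j) * dist x y" for j x y
    proof -
      have "\<bar>f j x - f j y\<bar> \<le> \<bar>real (Suc j) * infdist x C - real (Suc j) * infdist y C\<bar>"
        unfolding f_def by linarith
      also have "\<dots> = real (Suc j) * \<bar>infdist x C - infdist y C\<bar>"
        by (simp add: right_diff_distrib[symmetric] abs_mult del: of_nat_Suc)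
      also have "\<dots> \<le> real (Suc j) * dist x y"
        using infdist_triangle_abs[of x C y] by (intro mult_left_mono) auto
      finally show ?thesis .
    qed
    have flim: "(\<lambda>j. f j x) \<longlonglongrightarrow> indicator C x" for x
    proof (cases "x \<in> C")
      case True then show ?thesis by (simp add: f_def)
    next
      case out: False
      then have pos: "infdist x C > 0" using C False by (metis infdist_pos_not_in_closed)
      then have "\<forall>\<^sub>F j in sequentially. 1 / real (Suc j) < infdist x C"
        by (intro order_tendstoD(2)[OF LIMSEQ_Suc[OF lim_1_over_n]]) simp
      then have "\<forall>\<^sub>F j in sequentially. f j x = 0"
      proof eventually_elim
        fix j assume "1 / real (Suc j) < infdist x C"
        then have "1 < real (Suc j) * infdist x C" by (simp add: divide_less_eq mult.commute del: of_nat_Suc)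
        then show "f j x = 0" by (simp add: f_def del: of_nat_Suc)
      qed
      then show ?thesis using out by (simp add: tendsto_eventually)
    qed
    have "(\<lambda>j. \<integral>x. f j x \<partial>\<mu>) \<longlonglongrightarrow> (\<integral>x. indicator C x \<partial>\<mu>)"
      by (rule integral_dominated_convergence[where w="\<lambda>_. 1"]) (use flim fb in auto)
    moreover have "(\<lambda>j. \<integral>x. f j x \<partial>\<nu>) \<longlonglongrightarrow> (\<integral>x. indicator C x \<partial>\<nu>)"
      by (rule integral_dominated_convergence[where w="\<lambda>_. 1"]) (use flim fb in auto)
    moreover have "(\<integral>x. f j x \<partial>\<mu>) = (\<integral>x. f j x \<partial>\<nu>)" for j
      by (rule lip_eq[OF fm fb fl]) simp
    ultimately have "(\<integral>x. indicator C x \<partial>\<mu>) = (\<integral>x. (indicator C x :: real) \<partial>\<nu>)"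
      by (metis (no_types, lifting) LIMSEQ_unique ext)
    then show ?thesis using m(3) n(3) by simp
  qed simp
  show ?thesis
  proof (rule measure_eqI_generator_eq[where E="Collect closed" and \<Omega>=UNIV and A="\<lambda>_. UNIV"])
    show "Int_stable (Collect closed :: 'a set set)" by (auto simp: Int_stable_def)
    show "sets \<mu> = sigma_sets UNIV (Collect closed)" "sets \<nu> = sigma_sets UNIV (Collect closed)"
      using m(2) n(2) by (simp_all add: borel_eq_closed)
  qed (use closed_eq in \<open>auto simp: m.emeasure_eq_measure n.emeasure_eq_measure\<close>)
qed

section \<open>Dirac masses\<close>

lemma return_in_wasserstein_space: "return borel x \<in> (wasserstein_space :: 'a::euclidean_space measure set)"
proof -
  have "distr (return borel x) borel (\<lambda>y. y) \<in> (wasserstein_space :: 'a measure set)"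
  proof (rule distr_in_wasserstein_space)
    show "prob_space (return borel x)" by (rule prob_space_return) simp
    then interpret prob_space "return borel x" .
    have "AE y in return borel x. norm ((norm y)\<^sup>2) \<le> (norm x)\<^sup>2" by (subst AE_return) auto
    then show "integrable (return borel x) (\<lambda>\<omega>. (norm \<omega>)\<^sup>2)"
      by (rule integrable_const_bound) simp
  qed simp
  then show ?thesis by (simp add: distr_borel_id)
qed

lemma barycenter_return [simp]: "barycenter (return borel x) = x"
  by (simp add: barycenter_def integral_return)

lemma second_moment_return: "second_moment (return borel x) = (norm x)\<^sup>2"
  by (simp add: second_moment_def integral_return)

lemma correlation_return:
  fixes \<mu> :: "'a::euclidean_space measure"
  assumes W: "\<mu> \<in> wasserstein_space"
  shows "correlation \<mu> (return borel x) = barycenter \<mu> \<bullet> x"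
proof (rule antisym)
  show "correlation \<mu> (return borel x) \<le> barycenter \<mu> \<bullet> x"
  proof (rule correlation_le[OF W return_in_wasserstein_space])
    fix \<gamma> assume g: "\<gamma> \<in> couplings \<mu> (return borel x)"
    note [measurable] = couplingsD(6,7)[OF g]
    have ae: "AE y in return borel x. y = x" by (subst AE_return) auto
    have "AE z in \<gamma>. fst z \<bullet> snd z = fst z \<bullet> x"
      using coupling_AE_snd[OF g ae] by eventually_elim simp
    then have "(\<integral>z. fst z \<bullet> snd z \<partial>\<gamma>) = (\<integral>z. fst z \<bullet> x \<partial>\<gamma>)"
      by (intro integral_cong_AE) auto
    also have "\<dots> = barycenter \<mu> \<bullet> x"
      using coupling_integral(2)[OF g, of "\<lambda>y. y \<bullet> x"] barycenter_inner(1)[OF W] by simp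
    finally show "(\<integral>z. fst z \<bullet> snd z \<partial>\<gamma>) \<le> barycenter \<mu> \<bullet> x" by simp
  qed
  show "barycenter \<mu> \<bullet> x \<le> correlation \<mu> (return borel x)"
    using barycenters_le_correlation[OF W return_in_wasserstein_space, of x] by simp
qed

lemma wasserstein_dist_return:
  fixes \<mu> :: "'a::euclidean_space measure"
  assumes W: "\<mu> \<in> wasserstein_space"
  shows "(wasserstein_dist \<mu> (return borel x))\<^sup>2 = second_moment \<mu> - 2 * (barycenter \<mu> \<bullet> x) + (norm x)\<^sup>2"
  by (simp add: wasserstein_dist_squared correlation_return[OF W] second_moment_return)

lemma wasserstein_dist_commute:
  fixes \<mu> \<nu> :: "'a::euclidean_space measure"
  assumes "\<mu> \<in> wasserstein_space" "\<nu> \<in> wasserstein_space"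
  shows "wasserstein_dist \<mu> \<nu> = wasserstein_dist \<nu> \<mu>"
proof -
  have "(wasserstein_dist \<mu> \<nu>)\<^sup>2 = (wasserstein_dist \<nu> \<mu>)\<^sup>2"
    by (simp add: wasserstein_dist_squared correlation_commute[OF assms])
  then show ?thesis by (simp add: wasserstein_dist_nonneg)
qed

lemma integral_square_dist:
  fixes \<mu> :: "'a::euclidean_space measure"
  assumes W: "\<mu> \<in> wasserstein_space"
  shows "integrable \<mu> (\<lambda>y. (norm (y - x))\<^sup>2)"
    "(\<integral>y. (norm (y - x))\<^sup>2 \<partial>\<mu>) = second_moment \<mu> - 2 * (barycenter \<mu> \<bullet> x) + (norm x)\<^sup>2"
proof -
  note m = wasserstein_spaceD[OF W]
  interpret prob_space \<mu> by (fact m)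
  have e: "(norm (y - x))\<^sup>2 = (norm y)\<^sup>2 - 2 * (y \<bullet> x) + (norm x)\<^sup>2" for y
    by (simp add: power2_norm_eq_inner inner_diff_left inner_diff_right inner_commute)
  show "integrable \<mu> (\<lambda>y. (norm (y - x))\<^sup>2)" unfolding e using m(4) m(6)[of x] by simp
  show "(\<integral>y. (norm (y - x))\<^sup>2 \<partial>\<mu>) = second_moment \<mu> - 2 * (barycenter \<mu> \<bullet> x) + (norm x)\<^sup>2"
    unfolding e using m(4) m(6)[of x] prob_space barycenter_inner(1)[OF W, of x]
    by (simp add: second_moment_def del: integral_inner_left)
qed

lemma barycenter_norm_le:
  fixes \<mu> :: "'a::euclidean_space measure"
  assumes W: "\<mu> \<in> wasserstein_space"
  shows "(norm (barycenter \<mu>))\<^sup>2 \<le> second_moment \<mu>"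
proof -
  have "0 \<le> (\<integral>y. (norm (y - barycenter \<mu>))\<^sup>2 \<partial>\<mu>)" by simp
  also have "\<dots> = second_moment \<mu> - (norm (barycenter \<mu>))\<^sup>2"
    unfolding integral_square_dist(2)[OF W] by (simp add: power2_norm_eq_inner)
  finally show ?thesis by simp
qed

lemma return_eqI:
  fixes \<mu> :: "'a::euclidean_space measure"
  assumes W: "\<mu> \<in> wasserstein_space" and c: "AE x in \<mu>. x = c"
  shows "\<mu> = return borel c"
proof (rule measure_eqI)
  note m = wasserstein_spaceD[OF W]
  interpret prob_space \<mu> by (fact m)
  show "sets \<mu> = sets (return borel c)" using m by simp
  fix A assume A: "A \<in> sets \<mu>"
  show "emeasure \<mu> A = emeasure (return borel c) A"
  proof (cases "c \<in> A")
    case True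
    have "emeasure \<mu> A = emeasure \<mu> (space \<mu>)"
      by (rule emeasure_eq_AE) (use A c True m in \<open>auto elim!: eventually_mono\<close>)
    then show ?thesis using True A m emeasure_space_1 by simp
  next
    case False
    have "emeasure \<mu> A = emeasure \<mu> {}"
      by (rule emeasure_eq_AE) (use A c False in \<open>auto elim!: eventually_mono\<close>)
    then show ?thesis using False A m by simp
  qed
qed

text \<open>Every measure can be joined to one twice as far from \<open>\<mu>\<close> in the same direction. From a Dirac mass this is
achieved by a dilation of the other measure.\<close>

definition reflecting :: "'a::euclidean_space measure \<Rightarrow> bool" where
  "reflecting \<mu> \<longleftrightarrow> (\<forall>\<nu>\<in>wasserstein_space. \<exists>\<nu>'\<in>wasserstein_space.
     wasserstein_dist \<mu> \<nu>' = 2 * wasserstein_dist \<mu> \<nu> \<and> wasserstein_dist \<nu> \<nu>' \<le> wasserstein_dist \<mu> \<nu>)"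

text \<open>Let \<open>\<nu>'\<close> be the measure provided for \<open>\<nu> = return borel 0\<close>. The distances force
\<open>correlation \<mu> \<nu>'\<close> to be at most minus the second moment of \<open>\<mu>\<close>, while the product coupling bounds it from
below by \<open>barycenter \<mu> \<bullet> barycenter \<nu>'\<close>. Together these make the mean square distance of \<open>\<mu>\<close> to
the point \<open>- barycenter \<nu>'\<close> vanish.\<close>

lemma reflecting_iff_return:
  fixes \<mu> :: "'a::euclidean_space measure"
  assumes W: "\<mu> \<in> wasserstein_space"
  shows "reflecting \<mu> \<longleftrightarrow> (\<exists>x. \<mu> = return borel x)"
proof
  assume "reflecting \<mu>"
  then obtain \<nu>' where N: "\<nu>' \<in> wasserstein_space"
    and far: "wasserstein_dist \<mu> \<nu>' = 2 * wasserstein_dist \<mu> (return borel 0)"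
    and near: "wasserstein_dist (return borel 0) \<nu>' \<le> wasserstein_dist \<mu> (return borel 0)"
    unfolding reflecting_def using return_in_wasserstein_space by blast
  have "(wasserstein_dist \<nu>' (return borel 0))\<^sup>2 \<le> (wasserstein_dist \<mu> (return borel 0))\<^sup>2"
    using near by (simp add: wasserstein_dist_commute[OF N return_in_wasserstein_space] power_mono wasserstein_dist_nonneg)
  then have le: "second_moment \<nu>' \<le> second_moment \<mu>" by (simp add: wasserstein_dist_return W N)
  have "(wasserstein_dist \<mu> \<nu>')\<^sup>2 = 4 * second_moment \<mu>"
    unfolding far by (simp add: power_mult_distrib wasserstein_dist_return W)
  then have c: "barycenter \<mu> \<bullet> barycenter \<nu>' \<le> - second_moment \<mu>"
    using barycenters_le_correlation[OF W N] le by (simp add: wasserstein_dist_squared)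
  let ?c = "- barycenter \<nu>'"
  have "(\<integral>y. (norm (y - ?c))\<^sup>2 \<partial>\<mu>) \<le> 0"
    unfolding integral_square_dist(2)[OF W] using c le barycenter_norm_le[OF N] by simp
  moreover have "0 \<le> (\<integral>y. (norm (y - ?c))\<^sup>2 \<partial>\<mu>)" by simp
  ultimately have "(\<integral>y. (norm (y - ?c))\<^sup>2 \<partial>\<mu>) = 0" by linarith
  then have "AE y in \<mu>. (norm (y - ?c))\<^sup>2 = 0"
    by (subst (asm) integral_nonneg_eq_0_iff_AE[OF integral_square_dist(1)[OF W]]) auto
  then have "AE y in \<mu>. y = ?c" by eventually_elim (simp add: eq_neg_iff_add_eq_0)
  then show "\<exists>x. \<mu> = return borel x" using return_eqI[OF W] by blast
next
  assume "\<exists>x. \<mu> = return borel x"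
  then obtain x where x: "\<mu> = return borel x" by blast
  have sq: "(wasserstein_dist \<mu> \<nu>)\<^sup>2 = (\<integral>y. (norm (y - x))\<^sup>2 \<partial>\<nu>)" if "\<nu> \<in> wasserstein_space" for \<nu>
    unfolding x wasserstein_dist_commute[OF return_in_wasserstein_space that]
    by (simp add: wasserstein_dist_return that integral_square_dist(2))
  show "reflecting \<mu>" unfolding reflecting_def
  proof
    fix \<nu> :: "'a measure" assume N: "\<nu> \<in> wasserstein_space"
    note n = wasserstein_spaceD[OF N]
    have [measurable_cong]: "sets \<nu> = sets borel" by (fact n)
    interpret prob_space \<nu> by (fact n)
    let ?f = "\<lambda>y. y + (y - x)"
    let ?n = "distr \<nu> borel ?f"
    have d: "norm (?f y - x) = 2 * norm (y - x)" for y
    proof -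
      have "?f y - x = 2 *\<^sub>R (y - x)" by (simp add: scaleR_2)
      then show ?thesis by (simp only:) simp
    qed
    have f2: "integrable \<nu> (\<lambda>y. (norm (?f y))\<^sup>2)"
    proof (rule Bochner_Integration.integrable_bound[of _ "\<lambda>y. 2 * (norm y)\<^sup>2 + 2 * (norm (y - x))\<^sup>2"])
      have "(norm (?f y))\<^sup>2 \<le> 2 * (norm y)\<^sup>2 + 2 * (norm (y - x))\<^sup>2" for y
      proof -
        have "(norm (?f y))\<^sup>2 \<le> (norm y + norm (y - x))\<^sup>2" by (intro power_mono norm_triangle_ineq) simp
        also have "\<dots> \<le> 2 * (norm y)\<^sup>2 + 2 * (norm (y - x))\<^sup>2"
          using sum_squares_bound[of "norm y" "norm (y - x)"] by (simp add: power2_sum)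
        finally show ?thesis .
      qed
      then show "AE y in \<nu>. norm ((norm (?f y))\<^sup>2) \<le> norm (2 * (norm y)\<^sup>2 + 2 * (norm (y - x))\<^sup>2)" by simp
    qed (use n(4) integral_square_dist(1)[OF N] in auto)
    have N': "?n \<in> wasserstein_space" by (rule distr_in_wasserstein_space) (use n(1) f2 in auto)
    have "(wasserstein_dist \<mu> ?n)\<^sup>2 = (\<integral>y. (norm (?f y - x))\<^sup>2 \<partial>\<nu>)"
      unfolding sq[OF N'] by (subst integral_distr) auto
    also have "\<dots> = (2 * wasserstein_dist \<mu> \<nu>)\<^sup>2"
      unfolding d power_mult_distrib sq[OF N] by simp
    finally have "wasserstein_dist \<mu> ?n = 2 * wasserstein_dist \<mu> \<nu>"
      by (rule power2_eq_imp_eq) (simp_all add: wasserstein_dist_nonneg)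
    moreover have "(wasserstein_dist (distr \<nu> borel (\<lambda>y. y)) ?n)\<^sup>2 \<le> (\<integral>y. (dist y (?f y))\<^sup>2 \<partial>\<nu>)"
      by (rule wasserstein_dist_le) (use n(1,4) f2 in auto)
    then have "(wasserstein_dist \<nu> ?n)\<^sup>2 \<le> (wasserstein_dist \<mu> \<nu>)\<^sup>2"
      using n(2) unfolding sq[OF N] by (simp add: distr_borel_id dist_norm norm_minus_commute)
    then have "wasserstein_dist \<nu> ?n \<le> wasserstein_dist \<mu> \<nu>"
      by (rule power2_le_imp_le) (rule wasserstein_dist_nonneg)
    ultimately show "\<exists>\<nu>'\<in>wasserstein_space. wasserstein_dist \<mu> \<nu>' = 2 * wasserstein_dist \<mu> \<nu> \<and>
        wasserstein_dist \<nu> \<nu>' \<le> wasserstein_dist \<mu> \<nu>" using N' by blast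
  qed
qed

text \<open>Maps that do not increase the cost of any coupling do not increase the distance. Isometries are
obtained from this by applying it to a map and to its inverse.\<close>

lemma wasserstein_dist_contraction:
  fixes \<mu> \<nu> :: "'a::euclidean_space measure"
  assumes W: "\<mu> \<in> wasserstein_space" "\<nu> \<in> wasserstein_space"
    and [measurable]: "f \<in> borel_measurable borel" "g \<in> borel_measurable borel"
    and f2: "integrable \<mu> (\<lambda>x. (norm (f x))\<^sup>2)" and g2: "integrable \<nu> (\<lambda>x. (norm (g x))\<^sup>2)"
    and le: "\<And>\<gamma>. \<gamma> \<in> couplings \<mu> \<nu> \<Longrightarrow>
      (\<integral>z. (dist (f (fst z)) (g (snd z)))\<^sup>2 \<partial>\<gamma>) \<le> (\<integral>z. (dist (fst z) (snd z))\<^sup>2 \<partial>\<gamma>)"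
  shows "wasserstein_dist (distr \<mu> borel f) (distr \<nu> borel (g :: 'a \<Rightarrow> 'a)) \<le> wasserstein_dist \<mu> \<nu>"
proof -
  let ?d = "wasserstein_dist (distr \<mu> borel f) (distr \<nu> borel g)"
  have "correlation \<mu> \<nu> \<le> (second_moment \<mu> + second_moment \<nu> - ?d\<^sup>2) / 2"
  proof (rule correlation_le[OF W])
    fix \<gamma> assume g: "\<gamma> \<in> couplings \<mu> \<nu>"
    note c = couplingsD[OF g]
    note [measurable] = c(6,7)
    have d: "distr \<gamma> borel (\<lambda>z. f (fst z)) = distr \<mu> borel f" "distr \<gamma> borel (\<lambda>z. g (snd z)) = distr \<nu> borel g"
      unfolding c(4,5) by (simp_all add: distr_distr comp_def)
    have "(wasserstein_dist (distr \<gamma> borel (\<lambda>z. f (fst z))) (distr \<gamma> borel (\<lambda>z. g (snd z))))\<^sup>2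
        \<le> (\<integral>z. (dist (f (fst z)) (g (snd z)))\<^sup>2 \<partial>\<gamma>)"
      using c(1) f2 g2 coupling_integral(1)[OF g, of "\<lambda>x. (norm (f x))\<^sup>2"] coupling_integral(3)[OF g, of "\<lambda>x. (norm (g x))\<^sup>2"]
      by (intro wasserstein_dist_le) simp_all
    then have "?d\<^sup>2 \<le> second_moment \<mu> + second_moment \<nu> - 2 * (\<integral>z. fst z \<bullet> snd z \<partial>\<gamma>)"
      using le[OF g] unfolding d coupling_cost(4)[OF W g] by linarith
    then show "(\<integral>z. fst z \<bullet> snd z \<partial>\<gamma>) \<le> (second_moment \<mu> + second_moment \<nu> - ?d\<^sup>2) / 2" by simp
  qed
  then have "?d\<^sup>2 \<le> (wasserstein_dist \<mu> \<nu>)\<^sup>2" by (simp add: wasserstein_dist_squared)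
  then show ?thesis by (rule power2_le_imp_le) (rule wasserstein_dist_nonneg)
qed

text \<open>The squared distance to \<open>return borel x\<close> is a polynomial in \<open>x\<close> whose coefficients are the second
moment and the barycenter.\<close>

lemma isometry_fixing_diracs_invariants:
  fixes T :: "'a::euclidean_space measure \<Rightarrow> 'a measure"
  assumes T: "T \<in> wasserstein_space \<rightarrow> wasserstein_space"
    and isometry: "\<forall>\<mu>\<in>wasserstein_space. \<forall>\<nu>\<in>wasserstein_space.
      wasserstein_dist (T \<mu>) (T \<nu>) = wasserstein_dist \<mu> \<nu>"
    and diracs: "\<forall>x. T (return borel x) = return borel x"
    and W: "\<mu> \<in> wasserstein_space"
  shows "second_moment (T \<mu>) = second_moment \<mu>" "barycenter (T \<mu>) = barycenter \<mu>"
    "\<nu> \<in> wasserstein_space \<Longrightarrow> correlation (T \<mu>) (T \<nu>) = correlation \<mu> \<nu>"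
proof -
  have mem: "\<And>\<mu>. \<mu> \<in> wasserstein_space \<Longrightarrow> T \<mu> \<in> wasserstein_space" using T by blast
  have iso: "\<And>\<mu> \<nu>. \<mu> \<in> wasserstein_space \<Longrightarrow> \<nu> \<in> wasserstein_space \<Longrightarrow>
      wasserstein_dist (T \<mu>) (T \<nu>) = wasserstein_dist \<mu> \<nu>" using isometry by blast
  have fixd: "\<And>x. T (return borel x) = return borel x" using diracs by blast
  have d: "second_moment (T \<mu>) - 2 * (barycenter (T \<mu>) \<bullet> x) = second_moment \<mu> - 2 * (barycenter \<mu> \<bullet> x)"
    if W: "\<mu> \<in> wasserstein_space" for \<mu> x
    using iso[OF W return_in_wasserstein_space, of x] wasserstein_dist_return[OF W, of x]
      wasserstein_dist_return[OF mem[OF W], of x] by (simp add: fixd)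
  have m: "second_moment (T \<mu>) = second_moment \<mu>" if W: "\<mu> \<in> wasserstein_space" for \<mu>
    using d[OF W, of 0] by simp
  show "second_moment (T \<mu>) = second_moment \<mu>" by (rule m[OF W])
  have "barycenter (T \<mu>) \<bullet> x = barycenter \<mu> \<bullet> x" for x using d[OF W, of x] m[OF W] by simp
  then show "barycenter (T \<mu>) = barycenter \<mu>" by (rule euclidean_eqI)
  show "correlation (T \<mu>) (T \<nu>) = correlation \<mu> \<nu>" if N: "\<nu> \<in> wasserstein_space"
    using wasserstein_dist_squared[of "T \<mu>" "T \<nu>"] wasserstein_dist_squared[of \<mu> \<nu>]
    by (simp add: iso[OF W N] m[OF W] m[OF N])
qed

text \<open>Finitely supported measures are determined by their barycenter and their correlations with
two-point measures, so \<open>T\<close> fixes them. Any other \<open>\<nu>\<close> is approximated by measures \<open>\<kappa>\<close> fixed by \<open>T\<close>,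
and \<open>T \<nu>\<close> has the same distances to all of them.\<close>

lemma isometry_fixing_two_points_eq_id:
  fixes T :: "'a::euclidean_space measure \<Rightarrow> 'a measure"
  assumes T: "T \<in> wasserstein_space \<rightarrow> wasserstein_space"
    and isometry: "\<forall>\<mu>\<in>wasserstein_space. \<forall>\<nu>\<in>wasserstein_space.
      wasserstein_dist (T \<mu>) (T \<nu>) = wasserstein_dist \<mu> \<nu>"
    and diracs: "\<forall>x. T (return borel x) = return borel x"
    and two_points: "\<forall>u a. norm u = 1 \<longrightarrow> a > 0 \<longrightarrow> T (two_point u a) = two_point u a"
    and W: "\<nu> \<in> wasserstein_space"
  shows "T \<nu> = \<nu>"
proof -
  have mem: "\<And>\<mu>. \<mu> \<in> wasserstein_space \<Longrightarrow> T \<mu> \<in> wasserstein_space" using T by blast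
  note inv = isometry_fixing_diracs_invariants[OF T isometry diracs]
  have fin: "T \<kappa> = \<kappa>" if K: "\<kappa> \<in> wasserstein_space" and F: "finite F" "AE x in \<kappa>. x \<in> F" for \<kappa> F
  proof -
    have b: "barycenter \<kappa> = barycenter (T \<kappa>)" by (rule inv(2)[OF K, symmetric])
    have c: "correlation (two_point u a) \<kappa> = correlation (two_point u a) (T \<kappa>)" if "norm u = 1" "a > 0" for u a
      using inv(3)[OF two_point_in_wasserstein_space K, of u a] two_points that by simp
    have s: "(\<integral>x. max (t - x \<bullet> u) 0 \<partial>\<kappa>) = (\<integral>x. max (t - x \<bullet> u) 0 \<partial>T \<kappa>)" if "norm u = 1" for u t
      by (rule stop_loss_eq[OF K mem[OF K] b _ that]) (rule c)
    have p: "distr \<kappa> borel (\<lambda>x. x \<bullet> u) = distr (T \<kappa>) borel (\<lambda>x. x \<bullet> u)" if "norm u = 1" for u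
      by (rule projection_eq[OF K mem[OF K] _ that]) (rule s)
    have "\<kappa> = T \<kappa>" by (rule finite_support_eq_of_projections[OF K mem[OF K] p F])
    then show ?thesis by simp
  qed
  show ?thesis
  proof (rule wasserstein_separation[OF mem[OF W] W])
    fix \<epsilon> :: real assume "\<epsilon> > 0"
    then obtain \<kappa> F where K: "\<kappa> \<in> wasserstein_space" and F: "finite F" "AE x in \<kappa>. x \<in> F"
      and d: "wasserstein_dist \<nu> \<kappa> < \<epsilon>" using finite_support_dense[OF W] by blast
    have "wasserstein_dist (T \<nu>) \<kappa> = wasserstein_dist \<nu> \<kappa>" using isometry W K fin[OF K F] by force
    then show "\<exists>\<kappa>\<in>wasserstein_space. wasserstein_dist (T \<nu>) \<kappa> < \<epsilon> \<and> wasserstein_dist \<nu> \<kappa> < \<epsilon>"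
      using K d by (intro bexI[of _ \<kappa>]) simp_all
  qed
qed

section \<open>Rotations about the barycenter\<close>

text \<open>Each measure is turned about its own barycenter. Dirac masses stay where they are, so these maps
are not induced by isometries of the underlying space unless \<open>\<phi>\<close> is the identity.\<close>

definition rotation :: "('a::euclidean_space \<Rightarrow> 'a) \<Rightarrow> 'a measure \<Rightarrow> 'a measure" where
  "rotation \<phi> = (\<lambda>\<mu>\<in>wasserstein_space. distr \<mu> borel (\<lambda>x. \<phi> (x - barycenter \<mu>) + barycenter \<mu>))"

lemma orthogonal_transformation_measurable:
  "orthogonal_transformation \<phi> \<Longrightarrow> \<phi> \<in> borel_measurable (borel :: 'a::euclidean_space measure)"
  by (intro borel_measurable_continuous_onI linear_continuous_on_compose[OF continuous_on_id, unfolded id_def])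
     (auto simp: orthogonal_transformation_linear)

lemma orthogonal_transformation_inv_inv:
  fixes \<phi> :: "'a::euclidean_space \<Rightarrow> 'a"
  assumes "orthogonal_transformation \<phi>"
  shows "orthogonal_transformation (inv_into UNIV \<phi>)" "\<phi> \<circ> inv_into UNIV \<phi> = id" "inv_into UNIV \<phi> \<circ> \<phi> = id"
    "\<phi> (inv_into UNIV \<phi> x) = x" "inv_into UNIV \<phi> (\<phi> x) = x"
  using assms orthogonal_transformation_inv[OF assms] orthogonal_transformation_inj[OF assms]
    orthogonal_transformation_surj[OF assms]
  by (simp_all add: surj_iff inj_iff surj_f_inv_f)

lemma orthogonal_transformation_simps:
  fixes \<phi> :: "'a::euclidean_space \<Rightarrow> 'a"
  assumes "orthogonal_transformation \<phi>"
  shows "\<phi> 0 = 0" "\<phi> (x + y) = \<phi> x + \<phi> y" "\<phi> (x - y) = \<phi> x - \<phi> y" "\<phi> (c *\<^sub>R x) = c *\<^sub>R \<phi> x"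
    "norm (\<phi> x) = norm x" "\<phi> x \<bullet> \<phi> y = x \<bullet> y"
proof -
  have l: "linear \<phi>" using assms by (rule orthogonal_transformation_linear)
  show "\<phi> 0 = 0" "\<phi> (x + y) = \<phi> x + \<phi> y" "\<phi> (x - y) = \<phi> x - \<phi> y" "\<phi> (c *\<^sub>R x) = c *\<^sub>R \<phi> x"
    using l by (simp_all add: linear_0 linear_add linear_diff linear_scale)
  show "norm (\<phi> x) = norm x" using assms by (rule orthogonal_transformation_norm)
  show "\<phi> x \<bullet> \<phi> y = x \<bullet> y" using assms by (simp add: orthogonal_transformation_def)
qed

lemma rotation_props:
  fixes \<mu> :: "'a::euclidean_space measure"
  assumes o: "orthogonal_transformation \<phi>" and W: "\<mu> \<in> wasserstein_space"
  shows "integrable \<mu> (\<lambda>x. (norm (\<phi> (x - m) + m))\<^sup>2)"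
    "rotation \<phi> \<mu> \<in> wasserstein_space" "barycenter (rotation \<phi> \<mu>) = barycenter \<mu>"
proof -
  note n = wasserstein_spaceD[OF W]
  interpret prob_space \<mu> by (fact n)
  have [measurable_cong]: "sets \<mu> = sets borel" by (fact n)
  note os = orthogonal_transformation_simps[OF o]
  note [measurable] = orthogonal_transformation_measurable[OF o]
  show sq: "integrable \<mu> (\<lambda>x. (norm (\<phi> (x - m) + m))\<^sup>2)" for m
  proof (rule Bochner_Integration.integrable_bound[of _ "\<lambda>x. 2 * (norm (x - m))\<^sup>2 + 2 * (norm m)\<^sup>2"])
    have "(norm (\<phi> (x - m) + m))\<^sup>2 \<le> 2 * (norm (x - m))\<^sup>2 + 2 * (norm m)\<^sup>2" for x
    proof -
      have "(norm (\<phi> (x - m) + m))\<^sup>2 \<le> (norm (x - m) + norm m)\<^sup>2"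
        using norm_triangle_ineq[of "\<phi> (x - m)" m] unfolding os(5) by (rule power_mono) (rule norm_ge_zero)
      also have "\<dots> \<le> 2 * (norm (x - m))\<^sup>2 + 2 * (norm m)\<^sup>2"
        using sum_squares_bound[of "norm (x - m)" "norm m"] by (simp add: power2_sum)
      finally show ?thesis .
    qed
    then show "AE x in \<mu>. norm ((norm (\<phi> (x - m) + m))\<^sup>2) \<le> norm (2 * (norm (x - m))\<^sup>2 + 2 * (norm m)\<^sup>2)" by simp
  qed (use integral_square_dist(1)[OF W] in auto)
  let ?m = "barycenter \<mu>"
  have r: "rotation \<phi> \<mu> = distr \<mu> borel (\<lambda>x. \<phi> (x - ?m) + ?m)" using W by (simp add: rotation_def)
  show "rotation \<phi> \<mu> \<in> wasserstein_space" unfolding r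
    by (rule distr_in_wasserstein_space) (simp_all add: n sq)
  have bl: "bounded_linear \<phi>" using o by (simp add: orthogonal_transformation_linear linear_conv_bounded_linear[symmetric])
  have "barycenter (rotation \<phi> \<mu>) = (\<integral>x. \<phi> (x - ?m) + ?m \<partial>\<mu>)"
    unfolding r barycenter_def by (subst integral_distr) auto
  also have "\<dots> = (\<integral>x. \<phi> (x - ?m) \<partial>\<mu>) + ?m"
    using integrable_bounded_linear[OF bl, of \<mu> "\<lambda>x. x - ?m"] n(5) prob_space by simp
  also have "(\<integral>x. \<phi> (x - ?m) \<partial>\<mu>) = \<phi> (\<integral>x. x - ?m \<partial>\<mu>)"
    using n(5) by (intro integral_bounded_linear[OF bl]) simp
  also have "(\<integral>x. x - ?m \<partial>\<mu>) = 0" using n(5) prob_space by (simp add: barycenter_def)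
  finally show "barycenter (rotation \<phi> \<mu>) = ?m" by (simp add: os)
qed

lemma rotation_comp:
  fixes \<mu> :: "'a::euclidean_space measure"
  assumes o: "orthogonal_transformation \<phi>" "orthogonal_transformation \<phi>'" and W: "\<mu> \<in> wasserstein_space"
  shows "rotation \<phi> (rotation \<phi>' \<mu>) = rotation (\<phi> \<circ> \<phi>') \<mu>"
proof -
  note n = wasserstein_spaceD[OF W]
  have [measurable_cong]: "sets \<mu> = sets borel" by (fact n)
  note [measurable] = orthogonal_transformation_measurable[OF o(1)] orthogonal_transformation_measurable[OF o(2)]
  have "rotation \<phi> (rotation \<phi>' \<mu>) = distr (rotation \<phi>' \<mu>) borel (\<lambda>x. \<phi> (x - barycenter \<mu>) + barycenter \<mu>)"
    using rotation_props(2,3)[OF o(2) W] by (subst rotation_def) simp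
  also have "\<dots> = rotation (\<phi> \<circ> \<phi>') \<mu>"
    using W by (simp add: rotation_def distr_distr comp_def)
  finally show ?thesis .
qed

lemma rotation_id: "\<mu> \<in> wasserstein_space \<Longrightarrow> rotation id \<mu> = \<mu>"
  by (simp add: rotation_def distr_borel_id wasserstein_spaceD(2))

lemma rotation_return:
  assumes o: "orthogonal_transformation \<phi>"
  shows "rotation \<phi> (return borel x) = return borel x"
proof -
  note [measurable] = orthogonal_transformation_measurable[OF o]
  have "rotation \<phi> (return borel x) = distr (return borel x) borel (\<lambda>y. \<phi> (y - x) + x)"
    by (simp add: rotation_def return_in_wasserstein_space)
  also have "\<dots> = return borel (\<phi> (x - x) + x)"
    by (rule distr_return) simp_all
  finally show ?thesis by (simp add: orthogonal_transformation_simps(1)[OF o])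
qed

text \<open>For \<open>d = (x - barycenter \<mu>) - (y - barycenter \<nu>)\<close> and \<open>\<delta> = barycenter \<mu> - barycenter \<nu>\<close> the
cost changes from \<open>(norm (d + \<delta>))\<^sup>2\<close> to \<open>(norm (\<phi> d + \<delta>))\<^sup>2\<close>. The difference is linear in \<open>d\<close>,
which has mean zero under every coupling.\<close>

lemma rotation_isometry:
  fixes \<mu> \<nu> :: "'a::euclidean_space measure"
  assumes o: "orthogonal_transformation \<phi>" and W: "\<mu> \<in> wasserstein_space" "\<nu> \<in> wasserstein_space"
  shows "wasserstein_dist (rotation \<phi> \<mu>) (rotation \<phi> \<nu>) = wasserstein_dist \<mu> \<nu>"
proof -
  have le: "wasserstein_dist (rotation \<phi> \<mu>) (rotation \<phi> \<nu>) \<le> wasserstein_dist \<mu> \<nu>"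
    if o: "orthogonal_transformation \<phi>" and W: "\<mu> \<in> wasserstein_space" "\<nu> \<in> wasserstein_space"
    for \<phi> and \<mu> \<nu> :: "'a measure"
  proof -
    note os = orthogonal_transformation_simps[OF o] and oi = orthogonal_transformation_inv_inv[OF o]
    note [measurable] = orthogonal_transformation_measurable[OF o]
    let ?f = "\<lambda>x. \<phi> (x - barycenter \<mu>) + barycenter \<mu>" and ?g = "\<lambda>x. \<phi> (x - barycenter \<nu>) + barycenter \<nu>"
    let ?\<delta> = "barycenter \<mu> - barycenter \<nu>"
    have "wasserstein_dist (distr \<mu> borel ?f) (distr \<nu> borel ?g) \<le> wasserstein_dist \<mu> \<nu>"
    proof (rule wasserstein_dist_contraction[OF W])
      fix \<gamma> assume g: "\<gamma> \<in> couplings \<mu> \<nu>"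
      interpret prob_space \<gamma> using couplingsD[OF g] by simp
      have idm: "(\<lambda>x::'a. x) \<in> borel_measurable borel" by simp
      have i: "integrable \<gamma> (\<lambda>z. fst z)" "(\<integral>z. fst z \<partial>\<gamma>) = barycenter \<mu>"
        "integrable \<gamma> (\<lambda>z. snd z)" "(\<integral>z. snd z \<partial>\<gamma>) = barycenter \<nu>"
        unfolding barycenter_def coupling_integral[OF g idm]
        by (rule refl wasserstein_spaceD(5)[OF W(1)] wasserstein_spaceD(5)[OF W(2)])+
      let ?v = "?\<delta> - inv_into UNIV \<phi> ?\<delta>"
      have pt: "(dist (?f (fst z)) (?g (snd z)))\<^sup>2 =
          (dist (fst z) (snd z))\<^sup>2 - 2 * ((fst z - snd z - ?\<delta>) \<bullet> ?v)" for z :: "'a \<times> 'a"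
      proof -
        define d where "d = fst z - snd z - ?\<delta>"
        have "d = (fst z - barycenter \<mu>) - (snd z - barycenter \<nu>)" by (simp add: d_def)
        then have "\<phi> d = \<phi> (fst z - barycenter \<mu>) - \<phi> (snd z - barycenter \<nu>)" by (simp only: os(3))
        then have "?f (fst z) - ?g (snd z) = \<phi> d + ?\<delta>" by simp
        then have "(dist (?f (fst z)) (?g (snd z)))\<^sup>2 = (norm (\<phi> d + ?\<delta>))\<^sup>2" by (simp only: dist_norm)
        also have "\<dots> = d \<bullet> d + 2 * (\<phi> d \<bullet> \<phi> (inv_into UNIV \<phi> ?\<delta>)) + ?\<delta> \<bullet> ?\<delta>"
          unfolding oi(4) power2_norm_eq_inner inner_add_left inner_add_right os(6)
          by (simp add: inner_commute)
        also have "\<phi> d \<bullet> \<phi> (inv_into UNIV \<phi> ?\<delta>) = d \<bullet> inv_into UNIV \<phi> ?\<delta>" by (rule os(6))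
        also have "d \<bullet> d + 2 * (d \<bullet> inv_into UNIV \<phi> ?\<delta>) + ?\<delta> \<bullet> ?\<delta> = (norm (d + ?\<delta>))\<^sup>2 - 2 * (d \<bullet> ?v)"
          by (simp add: power2_norm_eq_inner inner_add_left inner_add_right inner_diff_right inner_commute)
        also have "d + ?\<delta> = fst z - snd z" by (simp add: d_def)
        finally show ?thesis by (simp only: d_def dist_norm)
      qed
      have "(\<integral>z. (fst z - snd z - ?\<delta>) \<bullet> ?v \<partial>\<gamma>) = (\<integral>z. fst z - snd z - ?\<delta> \<partial>\<gamma>) \<bullet> ?v"
        using i by (intro integral_inner_left) simp
      also have "(\<integral>z. fst z - snd z - ?\<delta> \<partial>\<gamma>) = 0" using i prob_space by simp
      finally have z: "(\<integral>z. (fst z - snd z - ?\<delta>) \<bullet> ?v \<partial>\<gamma>) = 0" by simp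
      have iv: "integrable \<gamma> (\<lambda>z. (fst z - snd z - ?\<delta>) \<bullet> ?v)" using i by (intro integrable_inner_left) simp
      have "(\<integral>z. (dist (?f (fst z)) (?g (snd z)))\<^sup>2 \<partial>\<gamma>) =
          (\<integral>z. (dist (fst z) (snd z))\<^sup>2 \<partial>\<gamma>) - 2 * (\<integral>z. (fst z - snd z - ?\<delta>) \<bullet> ?v \<partial>\<gamma>)"
        unfolding pt using coupling_cost(3)[OF W g] iv
        by (subst Bochner_Integration.integral_diff) (simp_all del: integral_inner_left)
      then show "(\<integral>z. (dist (?f (fst z)) (?g (snd z)))\<^sup>2 \<partial>\<gamma>) \<le> (\<integral>z. (dist (fst z) (snd z))\<^sup>2 \<partial>\<gamma>)"
        unfolding z by simp
    qed (use rotation_props(1)[OF o] W in auto)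
    then show ?thesis using W by (simp add: rotation_def)
  qed
  have inv: "rotation (inv_into UNIV \<phi>) (rotation \<phi> \<kappa>) = \<kappa>" if "\<kappa> \<in> wasserstein_space" for \<kappa> :: "'a measure"
    using rotation_comp[OF orthogonal_transformation_inv_inv(1)[OF o] o that]
      orthogonal_transformation_inv_inv(3)[OF o] rotation_id[OF that] by simp
  show ?thesis
  proof (rule antisym[OF le[OF o W]])
    show "wasserstein_dist \<mu> \<nu> \<le> wasserstein_dist (rotation \<phi> \<mu>) (rotation \<phi> \<nu>)"
      using le[OF orthogonal_transformation_inv_inv(1)[OF o] rotation_props(2)[OF o W(1)] rotation_props(2)[OF o W(2)]]
      by (simp add: inv W)
  qed
qed

lemma rotation_two_point:
  assumes o: "orthogonal_transformation \<phi>" and a: "a > 0"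
  shows "rotation \<phi> (two_point u a) = two_point (\<phi> u) a"
proof -
  note [measurable] = orthogonal_transformation_measurable[OF o]
  have "rotation \<phi> (two_point u a) = distr (two_point u a) borel \<phi>"
    using centeredD(2)[OF two_point_centered[OF a, of u]] by (simp add: rotation_def two_point_in_wasserstein_space)
  also have "\<dots> = two_point (\<phi> u) a"
    unfolding two_point_def
  proof (subst distr_distr)
    have "\<phi> \<circ> (\<lambda>b. if b then a *\<^sub>R u else (- 1 / a) *\<^sub>R u) = (\<lambda>b. if b then a *\<^sub>R \<phi> u else (- 1 / a) *\<^sub>R \<phi> u)"
      using orthogonal_transformation_simps(4)[OF o, of a u] orthogonal_transformation_simps(4)[OF o, of "- 1 / a" u]
      by (auto simp only: fun_eq_iff comp_def split: if_split)
    then show "distr (measure_pmf (bernoulli_pmf (1 / (1 + a\<^sup>2)))) borel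
        (\<phi> \<circ> (\<lambda>b. if b then a *\<^sub>R u else (- 1 / a) *\<^sub>R u)) =
      distr (measure_pmf (bernoulli_pmf (1 / (1 + a\<^sup>2)))) borel
        (\<lambda>b. if b then a *\<^sub>R \<phi> u else (- 1 / a) *\<^sub>R \<phi> u)" by (simp only:)
  qed simp_all
  finally show ?thesis .
qed

theorem isometry_fixing_diracs:
  fixes T :: "'a::euclidean_space measure \<Rightarrow> 'a measure"
  assumes dim: "DIM('a) \<ge> 2"
    and bij: "bij_betw T wasserstein_space wasserstein_space"
    and isometry: "\<forall>\<mu>\<in>wasserstein_space. \<forall>\<nu>\<in>wasserstein_space.
      wasserstein_dist (T \<mu>) (T \<nu>) = wasserstein_dist \<mu> \<nu>"
    and diracs: "\<forall>x. T (return borel x) = return borel x"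
  shows "\<exists>\<phi>. orthogonal_transformation \<phi> \<and> (\<forall>\<mu>\<in>wasserstein_space. T \<mu> = rotation \<phi> \<mu>)"
proof -
  have T_mem: "T \<mu> \<in> wasserstein_space" if "\<mu> \<in> wasserstein_space" for \<mu>
    using bij that by (auto simp: bij_betw_def)
  have T: "T \<in> wasserstein_space \<rightarrow> wasserstein_space" using T_mem by blast
  note inv = isometry_fixing_diracs_invariants[OF T isometry diracs]
  interpret centered_isometry T
  proof
    show "bij_betw T centered centered" unfolding bij_betw_def
    proof
      show "inj_on T centered" using bij by (auto simp: bij_betw_def centered_def intro: inj_on_subset)
      show "T ` centered = centered"
      proof
        show "T ` centered \<subseteq> centered" using T_mem inv(2) by (auto simp: centered_def)
        show "centered \<subseteq> T ` centered"
        proof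
          fix \<nu> :: "'a measure" assume N: "\<nu> \<in> centered"
          then obtain \<mu> where M: "\<mu> \<in> wasserstein_space" "\<nu> = T \<mu>"
            using bij by (auto simp: bij_betw_def centered_def)
          then have "\<mu> \<in> centered" using N inv(2)[OF M(1)] by (simp add: centered_def)
          then show "\<nu> \<in> T ` centered" using M by blast
        qed
      qed
    qed
  qed (use inv in \<open>auto simp: centered_def\<close>)
  obtain \<phi> where o: "orthogonal_transformation \<phi>"
    and t: "\<And>u a. norm u = 1 \<Longrightarrow> a > 0 \<Longrightarrow> T (two_point u a) = two_point (\<phi> u) a"
    using two_point_rigidity[OF dim] by blast
  note oi = orthogonal_transformation_inv_inv[OF o]
  have id: "rotation (inv_into UNIV \<phi>) (T \<mu>) = \<mu>" if W: "\<mu> \<in> wasserstein_space" for \<mu>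
  proof (rule isometry_fixing_two_points_eq_id[where T="\<lambda>\<mu>. rotation (inv_into UNIV \<phi>) (T \<mu>)", OF _ _ _ _ W])
    show "\<forall>u a. norm u = 1 \<longrightarrow> a > 0 \<longrightarrow> rotation (inv_into UNIV \<phi>) (T (two_point u a)) = two_point u a"
      by (simp add: t rotation_two_point oi)
    show "(\<lambda>\<mu>. rotation (inv_into UNIV \<phi>) (T \<mu>)) \<in> wasserstein_space \<rightarrow> wasserstein_space"
      by (intro funcsetI rotation_props(2)[OF oi(1)]) (erule T_mem)
    show "\<forall>\<mu>\<in>wasserstein_space. \<forall>\<nu>\<in>wasserstein_space.
        wasserstein_dist (rotation (inv_into UNIV \<phi>) (T \<mu>)) (rotation (inv_into UNIV \<phi>) (T \<nu>)) = wasserstein_dist \<mu> \<nu>"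
      using isometry rotation_isometry[OF oi(1) T_mem T_mem] by simp
    show "\<forall>x. rotation (inv_into UNIV \<phi>) (T (return borel x)) = return borel x"
      using diracs rotation_return[OF oi(1)] by simp
  qed
  have "T \<mu> = rotation \<phi> \<mu>" if W: "\<mu> \<in> wasserstein_space" for \<mu>
  proof -
    have "rotation \<phi> (rotation (inv_into UNIV \<phi>) (T \<mu>)) = T \<mu>"
      using rotation_comp[OF o oi(1) T_mem[OF W]] rotation_id[OF T_mem[OF W]] oi(2) by simp
    then show ?thesis using id[OF W] by simp
  qed
  with o show ?thesis by blast
qed

section \<open>The isometry group\<close>

lemma isom_group_carrier:
  "f \<in> carrier (isom_group S d) \<longleftrightarrow>
     f \<in> extensional S \<and> bij_betw f S S \<and> (\<forall>x\<in>S. \<forall>y\<in>S. d (f x) (f y) = d x y)"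
  by (auto simp: isom_group_def Bij_def)

lemma isom_group_mult:
  "f \<in> carrier (isom_group S d) \<Longrightarrow> g \<in> carrier (isom_group S d) \<Longrightarrow>
     f \<otimes>\<^bsub>isom_group S d\<^esub> g = compose S f g"
  by (simp add: isom_group_def BijGroup_def)

lemma isom_group_one: "\<one>\<^bsub>isom_group S d\<^esub> = (\<lambda>x\<in>S. x)"
  by (simp add: isom_group_def BijGroup_def)

lemma isom_group_maps_to: "f \<in> carrier (isom_group S d) \<Longrightarrow> x \<in> S \<Longrightarrow> f x \<in> S"
  by (auto simp: isom_group_carrier bij_betw_def)

lemma isom_group_inv_apply:
  assumes "f \<in> carrier (isom_group S d)" "x \<in> S"
  shows "f ((inv\<^bsub>isom_group S d\<^esub> f) x) = x" "(inv\<^bsub>isom_group S d\<^esub> f) (f x) = x"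
proof -
  interpret group "isom_group S d" by (rule group_isom_group)
  have i: "inv\<^bsub>isom_group S d\<^esub> f \<in> carrier (isom_group S d)" using assms(1) by simp
  have "compose S f (inv\<^bsub>isom_group S d\<^esub> f) x = x"
    using r_inv[OF assms(1)] assms(2) by (simp add: isom_group_mult[OF assms(1) i] isom_group_one)
  then show "f ((inv\<^bsub>isom_group S d\<^esub> f) x) = x" using assms(2) by (simp add: compose_eq)
  have "compose S (inv\<^bsub>isom_group S d\<^esub> f) f x = x"
    using l_inv[OF assms(1)] assms(2) by (simp add: isom_group_mult[OF i assms(1)] isom_group_one)
  then show "(inv\<^bsub>isom_group S d\<^esub> f) (f x) = x" using assms(2) by (simp add: compose_eq)
qed

lemma Isom_carrier: "\<psi> \<in> carrier Isom \<longleftrightarrow> bij \<psi> \<and> (\<forall>x y. dist (\<psi> x) (\<psi> y) = dist x y)"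
  by (simp add: isom_group_carrier)

lemma Isom_mult: "f \<in> carrier Isom \<Longrightarrow> g \<in> carrier Isom \<Longrightarrow> f \<otimes>\<^bsub>Isom\<^esub> g = f \<circ> g"
  by (simp add: isom_group_mult compose_def comp_def restrict_def)

lemma linear_part_orthogonal:
  fixes \<psi> :: "'a::euclidean_space \<Rightarrow> 'a"
  assumes "\<psi> \<in> carrier Isom"
  shows "orthogonal_transformation (linear_part \<psi>)" "\<psi> x = linear_part \<psi> x + \<psi> 0"
  using assms by (auto simp: orthogonal_transformation_isometry linear_part_def Isom_carrier dist_norm)

lemma Isom_measurable:
  fixes \<psi> :: "'a::euclidean_space \<Rightarrow> 'a"
  assumes "\<psi> \<in> carrier Isom" shows "\<psi> \<in> borel_measurable borel"
proof -
  note [measurable] = orthogonal_transformation_measurable[OF linear_part_orthogonal(1)[OF assms]]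
  have "\<psi> = (\<lambda>x. linear_part \<psi> x + \<psi> 0)" using linear_part_orthogonal(2)[OF assms] by (rule ext)
  moreover have "(\<lambda>x. linear_part \<psi> x + \<psi> 0) \<in> borel_measurable borel" by measurable
  ultimately show ?thesis by metis
qed

lemma push_forward_props:
  fixes \<mu> :: "'a::euclidean_space measure"
  assumes P: "\<psi> \<in> carrier Isom" and W: "\<mu> \<in> wasserstein_space"
  shows "integrable \<mu> (\<lambda>x. (norm (\<psi> x))\<^sup>2)" "push_forward \<psi> \<mu> \<in> wasserstein_space"
    "barycenter (push_forward \<psi> \<mu>) = \<psi> (barycenter \<mu>)" "push_forward \<psi> \<mu> = distr \<mu> borel \<psi>"
proof -
  note n = wasserstein_spaceD[OF W]
  interpret prob_space \<mu> by (fact n)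
  have [measurable_cong]: "sets \<mu> = sets borel" by (fact n)
  let ?L = "linear_part \<psi>"
  note o = linear_part_orthogonal[OF P]
  note os = orthogonal_transformation_simps[OF o(1)]
  note Lm[measurable] = orthogonal_transformation_measurable[OF o(1)] and Pm[measurable] = Isom_measurable[OF P]
  show "integrable \<mu> (\<lambda>x. (norm (\<psi> x))\<^sup>2)"
  proof (rule Bochner_Integration.integrable_bound[of _ "\<lambda>x. 2 * (norm x)\<^sup>2 + 2 * (norm (\<psi> 0))\<^sup>2"])
    have "(norm (\<psi> x))\<^sup>2 \<le> 2 * (norm x)\<^sup>2 + 2 * (norm (\<psi> 0))\<^sup>2" for x
    proof -
      have "norm (\<psi> x) \<le> norm x + norm (\<psi> 0)"
        using norm_triangle_ineq[of "?L x" "\<psi> 0"] unfolding os(5) o(2)[symmetric] .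
      then have "(norm (\<psi> x))\<^sup>2 \<le> (norm x + norm (\<psi> 0))\<^sup>2" by (rule power_mono) (rule norm_ge_zero)
      also have "\<dots> \<le> 2 * (norm x)\<^sup>2 + 2 * (norm (\<psi> 0))\<^sup>2"
        using sum_squares_bound[of "norm x" "norm (\<psi> 0)"] by (simp add: power2_sum)
      finally show ?thesis .
    qed
    then show "AE x in \<mu>. norm ((norm (\<psi> x))\<^sup>2) \<le> norm (2 * (norm x)\<^sup>2 + 2 * (norm (\<psi> 0))\<^sup>2)" by simp
  qed (use n(4) in auto)
  then have "distr \<mu> borel \<psi> \<in> wasserstein_space"
    by (intro distr_in_wasserstein_space n(1)) simp_all
  then show "push_forward \<psi> \<mu> \<in> wasserstein_space" using W by (simp add: push_forward_def)
  show pf: "push_forward \<psi> \<mu> = distr \<mu> borel \<psi>" using W by (simp add: push_forward_def)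
  have bl: "bounded_linear ?L"
    using o(1) by (simp add: orthogonal_transformation_linear linear_conv_bounded_linear[symmetric])
  have "barycenter (push_forward \<psi> \<mu>) = (\<integral>x. \<psi> x \<partial>\<mu>)"
    unfolding pf barycenter_def by (rule integral_distr) simp_all
  also have "\<dots> = (\<integral>x. ?L x + \<psi> 0 \<partial>\<mu>)" by (simp only: o(2)[symmetric])
  also have "\<dots> = (\<integral>x. ?L x \<partial>\<mu>) + \<psi> 0"
    using integrable_bounded_linear[OF bl n(5)] prob_space by simp
  also have "(\<integral>x. ?L x \<partial>\<mu>) = ?L (barycenter \<mu>)"
    unfolding barycenter_def using n(5) by (rule integral_bounded_linear[OF bl])
  finally show "barycenter (push_forward \<psi> \<mu>) = \<psi> (barycenter \<mu>)" by (simp only: o(2)[symmetric])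
qed

lemma push_forward_comp:
  fixes \<mu> :: "'a::euclidean_space measure"
  assumes "\<psi> \<in> carrier Isom" "\<psi>' \<in> carrier Isom" "\<mu> \<in> wasserstein_space"
  shows "push_forward \<psi> (push_forward \<psi>' \<mu>) = push_forward (\<psi> \<circ> \<psi>') \<mu>"
proof -
  have [measurable_cong]: "sets \<mu> = sets borel" using assms by (simp add: wasserstein_spaceD)
  note [measurable] = Isom_measurable[OF assms(1)] Isom_measurable[OF assms(2)]
  have "push_forward \<psi> (push_forward \<psi>' \<mu>) = distr (distr \<mu> borel \<psi>') borel \<psi>"
    using assms push_forward_props(4)[OF assms(2,3)] push_forward_props(4)[OF assms(1) push_forward_props(2)[OF assms(2,3)]]
    by simp
  also have "\<dots> = push_forward (\<psi> \<circ> \<psi>') \<mu>" using assms(3) by (simp add: distr_distr push_forward_def)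
  finally show ?thesis .
qed

lemma push_forward_id: "\<mu> \<in> wasserstein_space \<Longrightarrow> push_forward id \<mu> = (\<mu> :: 'a::euclidean_space measure)"
  by (simp add: push_forward_def id_def distr_borel_id wasserstein_spaceD(2))

lemma push_forward_return:
  assumes "\<psi> \<in> carrier Isom"
  shows "push_forward \<psi> (return borel x) = return borel (\<psi> x :: 'a::euclidean_space)"
  using distr_return[OF Isom_measurable[OF assms], of x] by (simp add: push_forward_def return_in_wasserstein_space)

lemma Isom_inv:
  fixes \<psi> :: "'a::euclidean_space \<Rightarrow> 'a"
  assumes "\<psi> \<in> carrier Isom"
  shows "inv_into UNIV \<psi> \<in> carrier Isom" "\<psi> \<circ> inv_into UNIV \<psi> = id" "inv_into UNIV \<psi> \<circ> \<psi> = id"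
proof -
  have b: "bij \<psi>" and d: "\<And>x y. dist (\<psi> x) (\<psi> y) = dist x y" using assms by (auto simp: Isom_carrier)
  show *: "\<psi> \<circ> inv_into UNIV \<psi> = id" "inv_into UNIV \<psi> \<circ> \<psi> = id"
    using b by (simp_all add: bij_def surj_iff inj_iff)
  have "dist (inv_into UNIV \<psi> x) (inv_into UNIV \<psi> y) = dist x y" for x y
    using d[of "inv_into UNIV \<psi> x" "inv_into UNIV \<psi> y"] *(1) by (metis comp_apply id_apply)
  then show "inv_into UNIV \<psi> \<in> carrier Isom" using b by (simp add: Isom_carrier bij_imp_bij_inv)
qed

lemma push_forward_isometry:
  fixes \<mu> \<nu> :: "'a::euclidean_space measure"
  assumes P: "\<psi> \<in> carrier Isom" and W: "\<mu> \<in> wasserstein_space" "\<nu> \<in> wasserstein_space"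
  shows "wasserstein_dist (push_forward \<psi> \<mu>) (push_forward \<psi> \<nu>) = wasserstein_dist \<mu> \<nu>"
proof -
  have le: "wasserstein_dist (push_forward \<psi> \<mu>) (push_forward \<psi> \<nu>) \<le> wasserstein_dist \<mu> \<nu>"
    if P: "\<psi> \<in> carrier Isom" and W: "\<mu> \<in> wasserstein_space" "\<nu> \<in> wasserstein_space"
    for \<psi> and \<mu> \<nu> :: "'a measure"
    unfolding push_forward_props(4)[OF P W(1)] push_forward_props(4)[OF P W(2)]
    using P push_forward_props(1)[OF P] W
    by (intro wasserstein_dist_contraction Isom_measurable[OF P]) (simp_all add: Isom_carrier)
  have inv: "push_forward (inv_into UNIV \<psi>) (push_forward \<psi> \<kappa>) = \<kappa>" if "\<kappa> \<in> wasserstein_space" for \<kappa> :: "'a measure"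
    using push_forward_comp[OF Isom_inv(1)[OF P] P that] Isom_inv(3)[OF P] push_forward_id[OF that] by simp
  show ?thesis
    using le[OF P W] le[OF Isom_inv(1)[OF P] push_forward_props(2)[OF P W(1)] push_forward_props(2)[OF P W(2)]]
    by (simp add: inv W)
qed

text \<open>A push-forward moves the barycenter along, so conjugating a rotation by it only conjugates the
orthogonal map by the linear part.\<close>

lemma push_forward_rotation:
  fixes \<mu> :: "'a::euclidean_space measure"
  assumes P: "\<psi> \<in> carrier Isom" and o: "orthogonal_transformation \<phi>" and W: "\<mu> \<in> wasserstein_space"
  shows "push_forward \<psi> (rotation \<phi> \<mu>) = rotation (conj_by_linear_part \<psi> \<phi>) (push_forward \<psi> \<mu>)"
proof -
  let ?L = "linear_part \<psi>" and ?m = "barycenter \<mu>"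
  let ?c = "conj_by_linear_part \<psi> \<phi>"
  have [measurable_cong]: "sets \<mu> = sets borel" using W by (rule wasserstein_spaceD)
  note L = linear_part_orthogonal[OF P]
  note Li = orthogonal_transformation_inv_inv[OF L(1)]
  have oc: "orthogonal_transformation ?c" unfolding conj_by_linear_part_def
    by (intro orthogonal_transformation_compose L(1) o Li(1))
  note [measurable] = Isom_measurable[OF P] orthogonal_transformation_measurable[OF o]
    orthogonal_transformation_measurable[OF oc]
  have "push_forward \<psi> (rotation \<phi> \<mu>) = distr (distr \<mu> borel (\<lambda>x. \<phi> (x - ?m) + ?m)) borel \<psi>"
    using push_forward_props(4)[OF P rotation_props(2)[OF o W]] W by (simp add: rotation_def)
  also have "\<dots> = distr \<mu> borel (\<lambda>x. \<psi> (\<phi> (x - ?m) + ?m))" by (simp add: distr_distr comp_def)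
  also have "(\<lambda>x. \<psi> (\<phi> (x - ?m) + ?m)) = (\<lambda>x. ?c (\<psi> x - \<psi> ?m) + \<psi> ?m)"
  proof
    fix x
    have "\<psi> x - \<psi> ?m = ?L (x - ?m)"
      using L(2)[of x] L(2)[of ?m] orthogonal_transformation_simps(3)[OF L(1), of x ?m] by simp
    then have "?c (\<psi> x - \<psi> ?m) = ?L (\<phi> (x - ?m))" by (simp add: conj_by_linear_part_def Li(5))
    moreover have "\<psi> (\<phi> (x - ?m) + ?m) = ?L (\<phi> (x - ?m)) + \<psi> ?m"
      using L(2)[of "\<phi> (x - ?m) + ?m"] L(2)[of ?m] orthogonal_transformation_simps(2)[OF L(1), of "\<phi> (x - ?m)" ?m]
      by simp
    ultimately show "\<psi> (\<phi> (x - ?m) + ?m) = ?c (\<psi> x - \<psi> ?m) + \<psi> ?m" by simp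
  qed
  also have "distr \<mu> borel (\<lambda>x. ?c (\<psi> x - \<psi> ?m) + \<psi> ?m) = distr (distr \<mu> borel \<psi>) borel (\<lambda>y. ?c (y - \<psi> ?m) + \<psi> ?m)"
    by (simp add: distr_distr comp_def)
  also have "\<dots> = rotation ?c (push_forward \<psi> \<mu>)"
    using push_forward_props(2,3,4)[OF P W] by (simp add: rotation_def)
  finally show ?thesis .
qed

text \<open>The pair \<open>(\<psi>, \<phi>)\<close> stands for the product of \<open>\<phi>\<close> and \<open>\<psi>\<close> in this order, hence the push-forward is
applied first.\<close>

definition rotation_push :: "('a::euclidean_space \<Rightarrow> 'a) \<times> ('a \<Rightarrow> 'a) \<Rightarrow> 'a measure \<Rightarrow> 'a measure" where
  "rotation_push = (\<lambda>(\<psi>, \<phi>). \<lambda>\<mu>\<in>wasserstein_space. rotation \<phi> (push_forward \<psi> \<mu>))"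

lemma rotation_push_id: "rotation_push (id, \<phi>) = rotation \<phi>"
  by (rule ext) (simp add: rotation_push_def push_forward_id rotation_def restrict_def)

lemma rotation_push_push_forward:
  assumes "\<psi> \<in> carrier Isom" shows "rotation_push (\<psi>, id) = push_forward \<psi>"
proof
  fix \<mu> show "rotation_push (\<psi>, id) \<mu> = push_forward \<psi> \<mu>"
    using rotation_id[OF push_forward_props(2)[OF assms, of \<mu>]]
    by (cases "\<mu> \<in> wasserstein_space") (simp_all add: rotation_push_def push_forward_def)
qed

lemma rotation_push_carrier:
  fixes \<psi> \<phi> :: "'a::euclidean_space \<Rightarrow> 'a"
  assumes P: "\<psi> \<in> carrier Isom" and o: "orthogonal_transformation \<phi>"
  shows "rotation_push (\<psi>, \<phi>) \<in> carrier IsomW2"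
  unfolding isom_group_carrier
proof (intro conjI ballI)
  note oi = orthogonal_transformation_inv_inv[OF o] and Pi = Isom_inv[OF P]
  show "rotation_push (\<psi>, \<phi>) \<in> extensional wasserstein_space" by (simp add: rotation_push_def)
  show "bij_betw (rotation_push (\<psi>, \<phi>)) wasserstein_space wasserstein_space"
  proof (rule bij_betwI[where g="\<lambda>\<mu>. push_forward (inv_into UNIV \<psi>) (rotation (inv_into UNIV \<phi>) \<mu>)"])
    show "rotation_push (\<psi>, \<phi>) \<in> wasserstein_space \<rightarrow> wasserstein_space"
      using P o by (simp add: rotation_push_def push_forward_props(2) rotation_props(2))
    show "(\<lambda>\<mu>. push_forward (inv_into UNIV \<psi>) (rotation (inv_into UNIV \<phi>) \<mu>)) \<in> wasserstein_space \<rightarrow> wasserstein_space"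
      using Pi(1) oi(1) by (simp add: push_forward_props(2) rotation_props(2))
  next
    fix \<mu> :: "'a measure" assume W: "\<mu> \<in> wasserstein_space"
    note PW = push_forward_props(2)[OF P W]
    show "push_forward (inv_into UNIV \<psi>) (rotation (inv_into UNIV \<phi>) (rotation_push (\<psi>, \<phi>) \<mu>)) = \<mu>"
      using rotation_comp[OF oi(1) o PW] oi(3) rotation_id[OF PW] push_forward_comp[OF Pi(1) P W] Pi(3) push_forward_id[OF W]
      by (simp add: rotation_push_def W)
    note RW = rotation_props(2)[OF oi(1) W]
    show "rotation_push (\<psi>, \<phi>) (push_forward (inv_into UNIV \<psi>) (rotation (inv_into UNIV \<phi>) \<mu>)) = \<mu>"
      using rotation_comp[OF o oi(1) W] oi(2) rotation_id[OF W] push_forward_comp[OF P Pi(1) RW] Pi(2) push_forward_id[OF RW]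
        push_forward_props(2)[OF Pi(1) RW]
      by (simp add: rotation_push_def)
  qed
  fix \<mu> \<nu> :: "'a measure" assume W: "\<mu> \<in> wasserstein_space" "\<nu> \<in> wasserstein_space"
  show "wasserstein_dist (rotation_push (\<psi>, \<phi>) \<mu>) (rotation_push (\<psi>, \<phi>) \<nu>) = wasserstein_dist \<mu> \<nu>"
    using W by (simp add: rotation_push_def rotation_isometry[OF o] push_forward_isometry[OF P] push_forward_props(2)[OF P])
qed

lemma rotation_push_return:
  assumes "\<psi> \<in> carrier Isom" "orthogonal_transformation \<phi>"
  shows "rotation_push (\<psi>, \<phi>) (return borel x) = return borel (\<psi> x)"
  using assms by (simp add: rotation_push_def return_in_wasserstein_space push_forward_return rotation_return)

text \<open>A two-point measure with different weights at its points is moved by every orthogonal map that does not fix its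
direction.\<close>

lemma rotation_inject:
  fixes \<phi> \<phi>' :: "'a::euclidean_space \<Rightarrow> 'a"
  assumes o: "orthogonal_transformation \<phi>" "orthogonal_transformation \<phi>'"
    and e: "\<And>\<mu>. \<mu> \<in> wasserstein_space \<Longrightarrow> rotation \<phi> \<mu> = rotation \<phi>' \<mu>"
  shows "\<phi> = \<phi>'"
proof
  fix x
  show "\<phi> x = \<phi>' x"
  proof (cases "x = 0")
    case True then show ?thesis
      by (simp add: orthogonal_transformation_simps(1)[OF o(1)] orthogonal_transformation_simps(1)[OF o(2)])
  next
    case False
    define u where "u = (1 / norm x) *\<^sub>R x"
    have u: "norm u = 1" and x: "x = norm x *\<^sub>R u" using False by (simp_all add: u_def)
    have "two_point (\<phi> u) 2 = two_point (\<phi>' u) 2"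
      using e[OF two_point_in_wasserstein_space, of u 2] rotation_two_point[OF o(1), of 2 u] rotation_two_point[OF o(2), of 2 u]
      by simp
    then have "\<phi> u = \<phi>' u"
      using two_point_inject[of "\<phi> u" "\<phi>' u" 2 2] u orthogonal_transformation_simps(5)[OF o(1)]
        orthogonal_transformation_simps(5)[OF o(2)] by auto
    then show ?thesis
      using orthogonal_transformation_simps(4)[OF o(1), of "norm x" u]
        orthogonal_transformation_simps(4)[OF o(2), of "norm x" u] x by simp
  qed
qed

lemma isometry_permutes_diracs:
  fixes f :: "'a::euclidean_space measure \<Rightarrow> 'a measure"
  assumes f: "f \<in> carrier IsomW2"
  shows "\<exists>\<psi>\<in>carrier Isom. \<forall>x. f (return borel x) = return borel (\<psi> x)"
proof -
  interpret G: group "IsomW2 :: ('a measure \<Rightarrow> 'a measure) monoid" by (rule group_isom_group)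
  have refl: "reflecting (f \<mu>)"
    if f: "f \<in> carrier IsomW2" and W: "\<mu> \<in> wasserstein_space" and r: "reflecting \<mu>"
    for f and \<mu> :: "'a measure"
    unfolding reflecting_def
  proof
    have iso: "wasserstein_dist (f \<mu>) (f \<nu>) = wasserstein_dist \<mu> \<nu>"
      if "\<mu> \<in> wasserstein_space" "\<nu> \<in> wasserstein_space" for \<mu> \<nu>
      using f that by (simp add: isom_group_carrier)
    fix \<nu>0 :: "'a measure" assume "\<nu>0 \<in> wasserstein_space"
    then have "\<nu>0 \<in> f ` wasserstein_space" using f by (simp add: isom_group_carrier bij_betw_def)
    then obtain \<nu> where N: "\<nu> \<in> wasserstein_space" "\<nu>0 = f \<nu>" by blast
    then obtain \<nu>' where "\<nu>' \<in> wasserstein_space"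
      "wasserstein_dist \<mu> \<nu>' = 2 * wasserstein_dist \<mu> \<nu>" "wasserstein_dist \<nu> \<nu>' \<le> wasserstein_dist \<mu> \<nu>"
      using r by (auto simp: reflecting_def)
    then show "\<exists>\<nu>'\<in>wasserstein_space. wasserstein_dist (f \<mu>) \<nu>' = 2 * wasserstein_dist (f \<mu>) \<nu>0 \<and>
        wasserstein_dist \<nu>0 \<nu>' \<le> wasserstein_dist (f \<mu>) \<nu>0"
      using isom_group_maps_to[OF f] N W by (intro bexI[of _ "f \<nu>'"]) (simp_all add: iso)
  qed
  have dirac: "\<exists>y. f (return borel x) = return borel y" if f: "f \<in> carrier IsomW2" for f and x :: 'a
    using refl[OF f return_in_wasserstein_space, of x]
      reflecting_iff_return[OF return_in_wasserstein_space, of x]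
      reflecting_iff_return[OF isom_group_maps_to[OF f return_in_wasserstein_space[of x]]] by blast
  obtain \<psi> where P: "\<And>x. f (return borel x) = return borel (\<psi> x)" using dirac[OF f] by metis
  have fi: "inv\<^bsub>IsomW2\<^esub> f \<in> carrier IsomW2" using f by simp
  have inj: "x = y" if "return borel x = return borel y" for x y :: 'a
    using that barycenter_return by metis
  have "bij \<psi>"
  proof (rule bijI)
    show "inj \<psi>"
    proof
      fix x y assume "\<psi> x = \<psi> y"
      then have "f (return borel x) = f (return borel y)" using P by simp
      then have "return borel x = return borel y"
        using isom_group_inv_apply(2)[OF f return_in_wasserstein_space] by metis
      then show "x = y" by (rule inj)
    qed
    show "surj \<psi>"
    proof (rule surjI)
      fix y
      have "f ((inv\<^bsub>IsomW2\<^esub> f) (return borel y)) = return borel y"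
        by (rule isom_group_inv_apply(1)[OF f return_in_wasserstein_space])
      moreover have "(inv\<^bsub>IsomW2\<^esub> f) (return borel y) = return borel (SOME x. (inv\<^bsub>IsomW2\<^esub> f) (return borel y) = return borel x)"
        using someI_ex[OF dirac[OF fi, of y]] .
      ultimately show "\<psi> (SOME x. (inv\<^bsub>IsomW2\<^esub> f) (return borel y) = return borel x) = y"
        using P inj by metis
    qed
  qed
  moreover have "dist (\<psi> x) (\<psi> y) = dist x y" for x y
  proof -
    have d: "(wasserstein_dist (return borel a) (return borel b))\<^sup>2 = (dist a b)\<^sup>2" for a b :: 'a
      using wasserstein_dist_return[OF return_in_wasserstein_space, of a b]
      by (simp add: second_moment_return dist_norm power2_norm_eq_inner inner_diff_left inner_diff_right inner_commute)
    have "wasserstein_dist (f (return borel x)) (f (return borel y)) = wasserstein_dist (return borel x) (return borel y)"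
      using f by (simp add: isom_group_carrier return_in_wasserstein_space)
    then have "(dist (\<psi> x) (\<psi> y))\<^sup>2 = (dist x y)\<^sup>2" using d[of "\<psi> x" "\<psi> y"] d[of x y] by (simp add: P)
    then show ?thesis by (simp add: power2_eq_iff_nonneg)
  qed
  ultimately show ?thesis using P by (auto simp: Isom_carrier)
qed

lemma rotation_push_surj:
  fixes f :: "'a::euclidean_space measure \<Rightarrow> 'a measure"
  assumes dim: "DIM('a) \<ge> 2" and f: "f \<in> carrier IsomW2"
    and P: "\<psi> \<in> carrier Isom" and d: "\<And>x. f (return borel x) = return borel (\<psi> x)"
  shows "\<exists>\<phi>. orthogonal_transformation \<phi> \<and> f = rotation_push (\<psi>, \<phi>)"
proof -
  note Pi = Isom_inv[OF P]
  define T where "T \<mu> = f (push_forward (inv_into UNIV \<psi>) \<mu>)" for \<mu>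
  note fc = f[unfolded isom_group_carrier]
  have bp: "bij_betw (push_forward (inv_into UNIV \<psi>)) wasserstein_space (wasserstein_space :: 'a measure set)"
    using rotation_push_carrier[OF Pi(1) orthogonal_transformation_id]
    by (simp add: rotation_push_push_forward[OF Pi(1)] isom_group_carrier id_def[symmetric])
  have "\<exists>\<phi>. orthogonal_transformation \<phi> \<and> (\<forall>\<mu>\<in>wasserstein_space. T \<mu> = rotation \<phi> \<mu>)"
  proof (rule isometry_fixing_diracs[OF dim])
    show "bij_betw T wasserstein_space wasserstein_space"
      using bij_betw_trans[OF bp, of f wasserstein_space] fc by (simp add: T_def[abs_def] comp_def)
    show "\<forall>\<mu>\<in>wasserstein_space. \<forall>\<nu>\<in>wasserstein_space. wasserstein_dist (T \<mu>) (T \<nu>) = wasserstein_dist \<mu> \<nu>"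
      using fc by (simp add: T_def push_forward_props(2)[OF Pi(1)] push_forward_isometry[OF Pi(1)])
    show "\<forall>x. T (return borel x) = return borel x"
      using Pi(2) by (simp add: T_def push_forward_return[OF Pi(1)] d fun_eq_iff)
  qed
  then obtain \<phi> where o: "orthogonal_transformation \<phi>" and T: "\<And>\<mu>. \<mu> \<in> wasserstein_space \<Longrightarrow> T \<mu> = rotation \<phi> \<mu>" by blast
  have "f = rotation_push (\<psi>, \<phi>)"
  proof (rule extensionalityI[of _ wasserstein_space])
    fix \<mu> :: "'a measure" assume W: "\<mu> \<in> wasserstein_space"
    have "T (push_forward \<psi> \<mu>) = f \<mu>"
      using push_forward_comp[OF Pi(1) P W] Pi(3) push_forward_id[OF W] by (simp add: T_def)
    then show "f \<mu> = rotation_push (\<psi>, \<phi>) \<mu>" using T[OF push_forward_props(2)[OF P W]] W by (simp add: rotation_push_def)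
  qed (use fc in \<open>auto simp: rotation_push_def\<close>)
  with o show ?thesis by blast
qed

text \<open>The image of the orthogonal group is the set of isometries that fix every Dirac mass. It is normal
because every isometry permutes the Dirac masses.\<close>

theorem wasserstein_isometry_group:
  assumes dim: "DIM('a::euclidean_space) \<ge> 2"
  shows "rotation_push \<in> iso (semidirect_product (Isom :: ('a \<Rightarrow> 'a) monoid) orthogonal_group conj_by_linear_part) IsomW2"
    "rotation_push ` ({id} \<times> carrier orthogonal_group) \<lhd> (IsomW2 :: ('a measure \<Rightarrow> 'a measure) monoid)"
proof -
  interpret G: group "IsomW2 :: ('a measure \<Rightarrow> 'a measure) monoid" by (rule group_isom_group)
  have idI: "id \<in> carrier (Isom :: ('a \<Rightarrow> 'a) monoid)" by (simp add: Isom_carrier)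
  have oc: "orthogonal_transformation (conj_by_linear_part \<psi> \<phi>)"
    if "\<psi> \<in> carrier Isom" "orthogonal_transformation \<phi>" for \<psi> \<phi> :: "'a \<Rightarrow> 'a"
    unfolding conj_by_linear_part_def using linear_part_orthogonal(1)[OF that(1)]
    by (intro orthogonal_transformation_compose that(2) orthogonal_transformation_inv_inv(1))
  let ?SD = "semidirect_product (Isom :: ('a \<Rightarrow> 'a) monoid) orthogonal_group conj_by_linear_part"
  have car: "carrier ?SD = carrier Isom \<times> {\<phi>. orthogonal_transformation \<phi>}"
    by (simp add: semidirect_product_def orthogonal_group_def)
  have hom: "rotation_push (p \<otimes>\<^bsub>?SD\<^esub> q) = rotation_push p \<otimes>\<^bsub>IsomW2\<^esub> rotation_push q"
    if pq: "p \<in> carrier ?SD" "q \<in> carrier ?SD" for p q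
  proof -
    obtain \<psi> \<phi> \<psi>' \<phi>' where p: "p = (\<psi>, \<phi>)" and q: "q = (\<psi>', \<phi>')"
      and P: "\<psi> \<in> carrier Isom" "\<psi>' \<in> carrier Isom" and o: "orthogonal_transformation \<phi>" "orthogonal_transformation \<phi>'"
      using pq unfolding car by auto
    have m: "p \<otimes>\<^bsub>?SD\<^esub> q = (\<psi> \<circ> \<psi>', \<phi> \<circ> conj_by_linear_part \<psi> \<phi>')"
      unfolding p q by (simp add: semidirect_product_def Isom_mult[OF P] orthogonal_group_def)
    show ?thesis unfolding m
    proof (rule extensionalityI[of _ wasserstein_space])
      show "rotation_push (\<psi> \<circ> \<psi>', \<phi> \<circ> conj_by_linear_part \<psi> \<phi>') \<in> extensional wasserstein_space"
        by (simp add: rotation_push_def)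
      have c: "rotation_push p \<in> carrier IsomW2" "rotation_push q \<in> carrier IsomW2"
        unfolding p q by (intro rotation_push_carrier P o)+
      show "rotation_push p \<otimes>\<^bsub>IsomW2\<^esub> rotation_push q \<in> extensional wasserstein_space"
        by (simp add: isom_group_mult[OF c])
      fix \<mu> :: "'a measure" assume W: "\<mu> \<in> wasserstein_space"
      note W1 = push_forward_props(2)[OF P(2) W]
      note W2 = push_forward_props(2)[OF P(1) W1]
      have "(rotation_push p \<otimes>\<^bsub>IsomW2\<^esub> rotation_push q) \<mu> = rotation_push p (rotation_push q \<mu>)"
        using W by (simp add: isom_group_mult[OF c] compose_eq)
      also have "\<dots> = rotation \<phi> (push_forward \<psi> (rotation \<phi>' (push_forward \<psi>' \<mu>)))"
        unfolding p q using W rotation_props(2)[OF o(2) W1] by (simp add: rotation_push_def)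
      also have "\<dots> = rotation (\<phi> \<circ> conj_by_linear_part \<psi> \<phi>') (push_forward (\<psi> \<circ> \<psi>') \<mu>)"
        unfolding push_forward_rotation[OF P(1) o(2) W1] rotation_comp[OF o(1) oc[OF P(1) o(2)] W2]
        unfolding push_forward_comp[OF P W] ..
      finally show "rotation_push (\<psi> \<circ> \<psi>', \<phi> \<circ> conj_by_linear_part \<psi> \<phi>') \<mu> =
          (rotation_push p \<otimes>\<^bsub>IsomW2\<^esub> rotation_push q) \<mu>" using W by (simp add: rotation_push_def)
    qed
  qed
  have dir_inj: "x = y" if "return borel x = return borel y" for x y :: 'a
    using that barycenter_return by metis
  have inj: "inj_on rotation_push (carrier ?SD)"
  proof (rule inj_onI)
    fix p q assume pq: "p \<in> carrier ?SD" "q \<in> carrier ?SD" and e: "rotation_push p = rotation_push q"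
    obtain \<psi> \<phi> \<psi>' \<phi>' where p: "p = (\<psi>, \<phi>)" and q: "q = (\<psi>', \<phi>')"
      and P: "\<psi> \<in> carrier Isom" "\<psi>' \<in> carrier Isom" and o: "orthogonal_transformation \<phi>" "orthogonal_transformation \<phi>'"
      using pq unfolding car by auto
    have "\<psi> x = \<psi>' x" for x
      using rotation_push_return[OF P(1) o(1), of x] rotation_push_return[OF P(2) o(2), of x] e dir_inj
      unfolding p q by metis
    then have psi: "\<psi> = \<psi>'" by (rule ext)
    have "\<phi> = \<phi>'"
    proof (rule rotation_inject[OF o])
      fix \<mu> :: "'a measure" assume W: "\<mu> \<in> wasserstein_space"
      note Pi = Isom_inv[OF P(1)]
      note W' = push_forward_props(2)[OF Pi(1) W]
      have "push_forward \<psi> (push_forward (inv_into UNIV \<psi>) \<mu>) = \<mu>"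
        using push_forward_comp[OF P(1) Pi(1) W] Pi(2) push_forward_id[OF W] by simp
      then show "rotation \<phi> \<mu> = rotation \<phi>' \<mu>"
        using fun_cong[OF e, of "push_forward (inv_into UNIV \<psi>) \<mu>"] W' unfolding p q psi[symmetric]
        by (simp add: rotation_push_def)
    qed
    with psi show "p = q" by (simp add: p q)
  qed
  have surj: "f \<in> rotation_push ` carrier ?SD" if f: "f \<in> carrier IsomW2" for f
  proof -
    obtain \<psi> where P: "\<psi> \<in> carrier Isom" "\<And>x. f (return borel x) = return borel (\<psi> x)"
      using isometry_permutes_diracs[OF f] by blast
    then obtain \<phi> where "orthogonal_transformation \<phi>" "f = rotation_push (\<psi>, \<phi>)"
      using rotation_push_surj[OF dim f P] by blast
    then show ?thesis using P(1) unfolding car by blast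
  qed
  have carr: "rotation_push p \<in> carrier IsomW2" if "p \<in> carrier ?SD" for p
    using that rotation_push_carrier unfolding car by auto
  show "rotation_push \<in> iso ?SD IsomW2"
    unfolding iso_def hom_def bij_betw_def using hom inj surj carr by auto
  have N: "rotation_push ` ({id} \<times> carrier orthogonal_group) =
      {f \<in> carrier (IsomW2 :: ('a measure \<Rightarrow> 'a measure) monoid). \<forall>x. f (return borel x) = return borel x}" (is "?N = ?D")
  proof
    show "?N \<subseteq> ?D"
      using rotation_push_carrier[OF idI] rotation_push_return[OF idI] by (auto simp: orthogonal_group_def)
    show "?D \<subseteq> ?N"
    proof
      fix f assume "f \<in> ?D"
      then have f: "f \<in> carrier IsomW2" "\<And>x. f (return borel x) = return borel (id x)" by auto
      obtain \<phi> where "orthogonal_transformation \<phi>" "f = rotation_push (id, \<phi>)"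
        using rotation_push_surj[OF dim f(1) idI f(2)] by blast
      then show "f \<in> ?N" by (auto simp: orthogonal_group_def)
    qed
  qed
  have app: "(f \<otimes>\<^bsub>IsomW2\<^esub> g) (return borel x) = f (g (return borel x))"
    if "f \<in> carrier IsomW2" "g \<in> carrier IsomW2" for f g :: "'a measure \<Rightarrow> 'a measure" and x
    by (simp add: isom_group_mult[OF that] compose_eq return_in_wasserstein_space)
  show "?N \<lhd> IsomW2"
    unfolding N G.normal_inv_iff
  proof (intro conjI ballI)
    show "subgroup ?D IsomW2"
    proof (rule G.subgroupI)
      have "\<one>\<^bsub>IsomW2\<^esub> \<in> ?D" using G.one_closed by (simp add: isom_group_one return_in_wasserstein_space)
      then show "?D \<noteq> {}" by blast
      fix f assume f: "f \<in> ?D"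
      then have "(inv\<^bsub>IsomW2\<^esub> f) (return borel x) = return borel x" for x
        using isom_group_inv_apply(2)[of f wasserstein_space wasserstein_dist "return borel x"]
          return_in_wasserstein_space[of x] by simp
      then show "inv\<^bsub>IsomW2\<^esub> f \<in> ?D" using f by simp
    qed (auto simp: app)
    fix f h :: "'a measure \<Rightarrow> 'a measure" assume f: "f \<in> carrier IsomW2" and h: "h \<in> ?D"
    have fi: "inv\<^bsub>IsomW2\<^esub> f \<in> carrier IsomW2" using f by simp
    obtain \<psi> where P: "\<And>x. (inv\<^bsub>IsomW2\<^esub> f) (return borel x) = return borel (\<psi> x)"
      using isometry_permutes_diracs[OF fi] by blast
    have "(f \<otimes>\<^bsub>IsomW2\<^esub> h \<otimes>\<^bsub>IsomW2\<^esub> inv\<^bsub>IsomW2\<^esub> f) (return borel x) = return borel x" for x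
    proof -
      have "(f \<otimes>\<^bsub>IsomW2\<^esub> h \<otimes>\<^bsub>IsomW2\<^esub> inv\<^bsub>IsomW2\<^esub> f) (return borel x) = f (return borel (\<psi> x))"
        using f h fi by (simp add: app P)
      also have "\<dots> = return borel x"
        unfolding P[symmetric] by (rule isom_group_inv_apply(1)[OF f return_in_wasserstein_space])
      finally show ?thesis .
    qed
    then show "f \<otimes>\<^bsub>IsomW2\<^esub> h \<otimes>\<^bsub>IsomW2\<^esub> inv\<^bsub>IsomW2\<^esub> f \<in> ?D" using f h by simp
  qed
qed

lemma rotation_preserves_shapes:
  fixes \<phi> :: "'a::euclidean_space \<Rightarrow> 'a"
  assumes o: "orthogonal_transformation \<phi>"
  shows "preserves_shapes (rotation \<phi>)"
  unfolding preserves_shapes_def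
proof
  fix \<mu> :: "'a measure" assume W: "\<mu> \<in> wasserstein_space"
  let ?f = "\<lambda>x. \<phi> (x - barycenter \<mu>) + barycenter \<mu>"
  note oi = orthogonal_transformation_inv_inv[OF o] and os = orthogonal_transformation_simps[OF o]
  have "bij ?f"
    by (rule o_bij[of "\<lambda>y. inv_into UNIV \<phi> (y - barycenter \<mu>) + barycenter \<mu>"]) (simp_all add: fun_eq_iff oi)
  moreover have "dist (?f x) (?f y) = dist x y" for x y
  proof -
    have "?f x - ?f y = \<phi> ((x - barycenter \<mu>) - (y - barycenter \<mu>))" by (simp only: os(3)) simp
    then show ?thesis by (simp only: dist_norm os(5)) simp
  qed
  ultimately have "?f \<in> carrier Isom" by (simp add: Isom_carrier)
  moreover have "rotation \<phi> \<mu> = push_forward ?f \<mu>" using W by (simp add: rotation_def push_forward_def)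
  ultimately show "\<exists>\<psi>\<in>carrier Isom. rotation \<phi> \<mu> = push_forward \<psi> \<mu>" by blast
qed

theorem theorem1p2:
  assumes "CARD('n::finite) \<ge> 2"
  shows "\<exists>F \<in> iso (semidirect_product (Isom :: (real^'n \<Rightarrow> real^'n) monoid)
                     orthogonal_group conj_by_linear_part)
                  IsomW2.
           (\<forall>\<psi>\<in>carrier Isom. F (\<psi>, id) = push_forward \<psi>) \<and>
           F ` ({id} \<times> carrier orthogonal_group) \<lhd> IsomW2 \<and>
           (\<forall>\<phi>\<in>carrier orthogonal_group.
              (\<forall>x. F (id, \<phi>) (return borel x) = return borel x) \<and>
              preserves_shapes (F (id, \<phi>)))"
proof -
  let ?F = "rotation_push :: (real^'n \<Rightarrow> real^'n) \<times> (real^'n \<Rightarrow> real^'n) \<Rightarrow> _"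
  have dim: "DIM(real^'n) \<ge> 2" using assms by simp
  have "(\<forall>\<psi>\<in>carrier Isom. ?F (\<psi>, id) = push_forward \<psi>) \<and>
      ?F ` ({id} \<times> carrier orthogonal_group) \<lhd> IsomW2 \<and>
      (\<forall>\<phi>\<in>carrier orthogonal_group.
        (\<forall>x. ?F (id, \<phi>) (return borel x) = return borel x) \<and> preserves_shapes (?F (id, \<phi>)))"
    using wasserstein_isometry_group(2)[OF dim]
    by (auto simp: rotation_push_push_forward rotation_push_id orthogonal_group_def rotation_return
        rotation_preserves_shapes)
  then show ?thesis using wasserstein_isometry_group(1)[OF dim] by blast
qed

end
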